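(* The ideal $I(P_{ppi})$ is invariant under any ring isomorphism: if $K$ is a field, $E$ and $F$ are arbitrary directed graphs and $\varphi:L_K(E)\to L_K(F)$ is a ring isomorphism, then $\varphi(I(P_{ppi}^E))=I(P_{ppi}^F)$.
   Context: A directed graph $E=(E^0,E^1,s,r)$ consists of arbitrary sets $E^0$ (vertices), $E^1$ (edges) and maps $s,r:E^1\to E^0$ (source, range). A vertex $v$ is a sink if $s^{-1}(v)=\emptyset$, an infinite emitter if $s^{-1}(v)$ is infinite, and regular otherwise. A path is a vertex (length $0$) or a finite sequence of edges $e_1\cdots e_n$ with $r(e_i)=s(e_{i+1})$. Write $u\ge v$ if there is a path from $u$ to $v$, and $T(v)=\{u\in E^0: v\ge u\}$. A set $H\subseteq E^0$ is hereditary if $v\in H$, $v\ge w$ imply $w\in H$; it is saturated if for every regular vertex $v$, $r(s^{-1}(v))\subseteq H$ implies $v\in H$. $\overline{X}$ denotes the smallest hereditary and saturated subset of $E^0$ containing $X$. ${\rm CSP}(w)$ is the set of closed simple paths based at $w$, i.e. paths $e_1\cdots e_n$, $n>0$, with $s(e_1)=r(e_n)=w$ and $s(e_i)\ne w$ for $i\ge2$. A vertex $v$ is properly infinite if there exist vertices $w_1,\dots,w_n\in T(v)$ with $|{\rm CSP}(w_i)|\ge 2$ for all $i$ and $v\in\overline{\{w_1,\dots,w_n\}}$. $P_{pi}$ is the set of properly infinite vertices. For a hereditary saturated $H\subseteq E^0$, $B_H=\{v\in E^0\setminus H: v \text{ is an infinite emitter and } 0<|s^{-1}(v)\cap r^{-1}(E^0\setminus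 H)|<\infty\}$; a breaking vertex is a vertex lying in $B_H$ for some hereditary saturated $H$. Define $P_{ppi}=P_{ppi}^E=\{v\in E^0: T(v)\subseteq P_{pi}\text{ and }T(v)\text{ has no breaking vertices}\}$. The Leavitt path algebra $L_K(E)$ is the $K$-algebra generated by $\{v: v\in E^0\}\cup\{e,e^*: e\in E^1\}$ subject to: $vw=\delta_{v,w}v$ for $v,w\in E^0$; $s(e)e=e\,r(e)=e$ and $r(e)e^*=e^*s(e)=e^*$ for $e\in E^1$; $e^*e'=\delta_{e,e'}r(e)$ for $e,e'\in E^1$; $v=\sum_{s(e)=v}ee^*$ for every regular vertex $v$. $I(X)$ is the two-sided ideal generated by $X$. *)

theory Defs
  imports
    "HOL-Algebra.Module"
    "HOL-Algebra.QuotRing"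
    "HOL-Library.Poly_Mapping"
    "Graph_Theory.Arc_Walk"
begin

section \<open>Directed graphs\<close>

text \<open>
  A directed graph is a \<^typ>\<open>('v, 'e) pre_digraph\<close> \<open>E\<close> with \<^term>\<open>wf_digraph E\<close>: arbitrary (possibly
  empty or infinite) sets \<^term>\<open>verts E\<close> and \<^term>\<open>arcs E\<close>, source map \<^term>\<open>tail E\<close> and range map
  \<^term>\<open>head E\<close>. A path from \<open>u\<close> to \<open>v\<close> is an \<open>awalk\<close>; the empty list is the path of length 0 at a
  vertex. Cardinality conditions are stated with \<^const>\<open>finite\<close>, because \<^const>\<open>card\<close> is 0 on infinite
  sets.
\<close>

definition infinite_emitter :: "('v, 'e) pre_digraph \<Rightarrow> 'v \<Rightarrow> bool" where
  "infinite_emitter E v \<longleftrightarrow> v \<in> verts E \<and> infinite (out_arcs E v)"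

definition sink :: "('v, 'e) pre_digraph \<Rightarrow> 'v \<Rightarrow> bool" where
  "sink E v \<longleftrightarrow> v \<in> verts E \<and> out_arcs E v = {}"

definition regular_vertex :: "('v, 'e) pre_digraph \<Rightarrow> 'v \<Rightarrow> bool" where
  "regular_vertex E v \<longleftrightarrow> v \<in> verts E \<and> \<not> sink E v \<and> \<not> infinite_emitter E v"

definition connects :: "('v, 'e) pre_digraph \<Rightarrow> 'v \<Rightarrow> 'v \<Rightarrow> bool" where
  "connects E u v \<longleftrightarrow> (\<exists>p. pre_digraph.awalk E u p v)"

definition tree :: "('v, 'e) pre_digraph \<Rightarrow> 'v \<Rightarrow> 'v set" where
  "tree E v = {u \<in> verts E. connects E v u}"

definition hereditary :: "('v, 'e) pre_digraph \<Rightarrow> 'v set \<Rightarrow> bool" where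
  "hereditary E H \<longleftrightarrow> H \<subseteq> verts E \<and> (\<forall>v w. v \<in> H \<longrightarrow> connects E v w \<longrightarrow> w \<in> H)"

definition saturated :: "('v, 'e) pre_digraph \<Rightarrow> 'v set \<Rightarrow> bool" where
  "saturated E H \<longleftrightarrow> H \<subseteq> verts E \<and>
     (\<forall>v. regular_vertex E v \<longrightarrow> head E ` out_arcs E v \<subseteq> H \<longrightarrow> v \<in> H)"

definition hs_closure :: "('v, 'e) pre_digraph \<Rightarrow> 'v set \<Rightarrow> 'v set" where
  "hs_closure E X = \<Inter>{H. hereditary E H \<and> saturated E H \<and> X \<subseteq> H}"

definition CSP :: "('v, 'e) pre_digraph \<Rightarrow> 'v \<Rightarrow> 'e list set" where
  "CSP E w = {p. p \<noteq> [] \<and> pre_digraph.awalk E w p w \<and> (\<forall>e \<in> set (tl p). tail E e \<noteq> w)}"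

definition properly_infinite :: "('v, 'e) pre_digraph \<Rightarrow> 'v \<Rightarrow> bool" where
  "properly_infinite E v \<longleftrightarrow> v \<in> verts E \<and>
     (\<exists>W. finite W \<and> W \<subseteq> tree E v \<and>
          (\<forall>w \<in> W. infinite (CSP E w) \<or> 2 \<le> card (CSP E w)) \<and>
          v \<in> hs_closure E W)"

definition P_pi :: "('v, 'e) pre_digraph \<Rightarrow> 'v set" where
  "P_pi E = {v. properly_infinite E v}"

definition breaking_set :: "('v, 'e) pre_digraph \<Rightarrow> 'v set \<Rightarrow> 'v set" where
  "breaking_set E H =
     {v \<in> verts E - H. infinite_emitter E v \<and>
        (let S = {e \<in> out_arcs E v. head E e \<in> verts E - H} in finite S \<and> 0 < card S)}"

definition breaking_vertex :: "('v, 'e) pre_digraph \<Rightarrow> 'v \<Rightarrow> bool" where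
  "breaking_vertex E v \<longleftrightarrow> (\<exists>H. hereditary E H \<and> saturated E H \<and> v \<in> breaking_set E H)"

definition P_ppi :: "('v, 'e) pre_digraph \<Rightarrow> 'v set" where
  "P_ppi E = {v \<in> verts E. tree E v \<subseteq> P_pi E \<and> (\<forall>u \<in> tree E v. \<not> breaking_vertex E u)}"


section \<open>Ideals of rings without identity\<close>

text \<open>
  Leavitt path algebras of graphs with infinitely many vertices have no identity element, whereas
  the library locales \<^locale>\<open>ring\<close> and \<^locale>\<open>ideal\<close> (and hence \<^const>\<open>genideal\<close>) require one. The
  record \<^typ>\<open>'a ring\<close> is used only for its carrier, addition, zero and multiplication; its
  \<^const>\<open>one\<close> field carries no meaning below.
\<close>

definition two_sided_ideal :: "'a set \<Rightarrow> ('a, 'm) ring_scheme \<Rightarrow> bool" where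
  "two_sided_ideal I R \<longleftrightarrow> additive_subgroup I R \<and>
     (\<forall>a \<in> I. \<forall>x \<in> carrier R. x \<otimes>\<^bsub>R\<^esub> a \<in> I \<and> a \<otimes>\<^bsub>R\<^esub> x \<in> I)"

definition ideal_generated :: "('a, 'm) ring_scheme \<Rightarrow> 'a set \<Rightarrow> 'a set" where
  "ideal_generated R X = \<Inter>{I. two_sided_ideal I R \<and> X \<subseteq> I}"

text \<open>
  In an algebra without identity a two-sided ideal need not be closed under scalars, so presenting
  an algebra by relations needs the generated algebra ideal.
\<close>

definition algebra_ideal_generated :: "('k, 'a, 'm) module_scheme \<Rightarrow> 'a set \<Rightarrow> 'a set" where
  "algebra_ideal_generated A X =
     \<Inter>{I. two_sided_ideal I A \<and> (\<forall>c. \<forall>a \<in> I. c \<odot>\<^bsub>A\<^esub> a \<in> I) \<and> X \<subseteq> I}"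


section \<open>Free associative algebras\<close>

text \<open>The free monoid on \<^typ>\<open>'g\<close>, written additively to match the exponents of \<^typ>\<open>'a \<Rightarrow>\<^sub>0 'b\<close>.\<close>

datatype 'g word = Word (letters: "'g list")

instantiation word :: (type) monoid_add
begin

definition zero_word :: "'a word" where "0 = Word []"

definition plus_word :: "'a word \<Rightarrow> 'a word \<Rightarrow> 'a word" where
  "u + v = Word (letters u @ letters v)"

instance
  by standard (simp_all add: zero_word_def plus_word_def)

end

text \<open>
  The free (non-unital) \<open>K\<close>-algebra on a set \<open>X\<close> of generators: finite linear combinations of
  nonempty words in \<open>X\<close>, with the convolution product of \<^typ>\<open>'g word \<Rightarrow>\<^sub>0 'k\<close>.
\<close>

definition free_algebra :: "'g set \<Rightarrow> ('k::field, 'g word \<Rightarrow>\<^sub>0 'k) module" where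
  "free_algebra X =
     \<lparr>carrier = {f. \<forall>w \<in> Poly_Mapping.keys f. letters w \<noteq> [] \<and> set (letters w) \<subseteq> X},
      monoid.mult = (*), one = 1, zero = 0, add = (+),
      smult = (\<lambda>c f. Poly_Mapping.map (\<lambda>a. c * a) f)\<rparr>"


section \<open>Leavitt path algebras\<close>

datatype ('v, 'e) lpa_gen = Vertex 'v | Edge 'e | Ghost 'e

definition lpa_gens :: "('v, 'e) pre_digraph \<Rightarrow> ('v, 'e) lpa_gen set" where
  "lpa_gens E = Vertex ` verts E \<union> Edge ` arcs E \<union> Ghost ` arcs E"

definition gen :: "'g \<Rightarrow> 'g word \<Rightarrow>\<^sub>0 'k::field" where
  "gen x = Poly_Mapping.single (Word [x]) 1"

text \<open>Each defining relation \<open>a = b\<close> is encoded as the element \<open>a - b\<close>.\<close>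

inductive_set lpa_relations ::
    "('v, 'e) pre_digraph \<Rightarrow> (('v, 'e) lpa_gen word \<Rightarrow>\<^sub>0 'k::field) set"
  for E :: "('v, 'e) pre_digraph" where
  vertices: "v \<in> verts E \<Longrightarrow> w \<in> verts E \<Longrightarrow>
    gen (Vertex v) * gen (Vertex w) - (if v = w then gen (Vertex v) else 0) \<in> lpa_relations E"
| source_edge: "e \<in> arcs E \<Longrightarrow>
    gen (Vertex (tail E e)) * gen (Edge e) - gen (Edge e) \<in> lpa_relations E"
| edge_range: "e \<in> arcs E \<Longrightarrow>
    gen (Edge e) * gen (Vertex (head E e)) - gen (Edge e) \<in> lpa_relations E"
| range_ghost: "e \<in> arcs E \<Longrightarrow>
    gen (Vertex (head E e)) * gen (Ghost e) - gen (Ghost e) \<in> lpa_relations E"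
| ghost_source: "e \<in> arcs E \<Longrightarrow>
    gen (Ghost e) * gen (Vertex (tail E e)) - gen (Ghost e) \<in> lpa_relations E"
| CK1: "e \<in> arcs E \<Longrightarrow> e' \<in> arcs E \<Longrightarrow>
    gen (Ghost e) * gen (Edge e') - (if e = e' then gen (Vertex (head E e)) else 0)
      \<in> lpa_relations E"
| CK2: "regular_vertex E v \<Longrightarrow>
    gen (Vertex v) - (\<Sum>e \<in> out_arcs E v. gen (Edge e) * gen (Ghost e)) \<in> lpa_relations E"

definition lpa_ideal ::
    "('v, 'e) pre_digraph \<Rightarrow> (('v, 'e) lpa_gen word \<Rightarrow>\<^sub>0 'k::field) set" where
  "lpa_ideal E = algebra_ideal_generated (free_algebra (lpa_gens E)) (lpa_relations E)"

text \<open>Elements of \<open>L\<^sub>K(E)\<close> are cosets of the ideal of relations.\<close>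

type_synonym ('k, 'v, 'e) lpa = "(('v, 'e) lpa_gen word \<Rightarrow>\<^sub>0 'k) set"

definition leavitt_path_algebra ::
    "('v, 'e) pre_digraph \<Rightarrow> ('k::field, ('k, 'v, 'e) lpa) module" where
  "leavitt_path_algebra E =
     (let A = free_algebra (lpa_gens E); J = lpa_ideal E in
      ring.extend (A Quot J)
        (module.fields (\<lambda>c X. \<Union>x \<in> X. J +>\<^bsub>A\<^esub> (c \<odot>\<^bsub>A\<^esub> x))))"

definition lpa_vertex :: "('v, 'e) pre_digraph \<Rightarrow> 'v \<Rightarrow> ('k::field, 'v, 'e) lpa" where
  "lpa_vertex E v = lpa_ideal E +>\<^bsub>free_algebra (lpa_gens E)\<^esub> gen (Vertex v)"

definition vertex_ideal :: "('v, 'e) pre_digraph \<Rightarrow> 'v set \<Rightarrow> ('k::field, 'v, 'e) lpa set" where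
  "vertex_ideal E X = ideal_generated (leavitt_path_algebra E) (lpa_vertex E ` X)"


section \<open>Isomorphisms of rings without identity\<close>

text \<open>
  \<^const>\<open>ring_hom\<close> demands preservation of \<^const>\<open>one\<close>. No compatibility with scalars is required.
\<close>

definition rng_iso :: "('a, 'm) ring_scheme \<Rightarrow> ('b, 'n) ring_scheme \<Rightarrow> ('a \<Rightarrow> 'b) set" where
  "rng_iso R S = iso R S \<inter> iso (add_monoid R) (add_monoid S)"

end

theory Submission
  imports Defs "HOL-Library.Sublist"
begin

text \<open>
  Call an ideal \<open>I\<close> good if in every quotient of the ring each nonzero element of the image of \<open>I\<close>
  dominates a properly infinite idempotent. This is preserved by ring isomorphisms, and \<open>I(P_ppi)\<close> is
  the largest good ideal. It is good because, modulo any ideal \<open>J\<close>, multiplying an element of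
  \<open>I(P_ppi)\<close> outside \<open>J\<close> by suitable paths yields a vertex outside \<open>J\<close>: there are neither breaking
  vertices nor cycles without exits that could stop the usual reduction, and every vertex left is a
  properly infinite idempotent. Conversely, the vertices of a good ideal lie in \<open>P_ppi\<close> and generate it:
  a breaking vertex, a vertex with a unique closed simple path, or a polynomial in a cycle without
  exits would give an element whose corner in some quotient is commutative, and a vertex that sees no
  cycle would give a locally finite-dimensional corner; neither contains properly infinite idempotents.
\<close>

section \<open>Congruences modulo two-sided ideals\<close>

text \<open>Two obstacles shape the development. A ring isomorphism need not respect scalars and
  there is no unit to respect, so the invariant property may use only sums, products and ideals: a
  properly infinite idempotent is given by the equations \<open>r1 e s1 = e\<close>,
  \<open>r2 e s2 = e\<close>, \<open>r2 e s1 = 0\<close>, and quotients are replaced by congruences,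
  because preimages of ideals are ideals. The missing unit also makes empty paths and differences
  from 1 awkward; the calculations therefore take place in the free unital algebra over all letters
  of the type, and its ideals are compared with those of the Leavitt path algebra only at the end.
  This comparison rests on local units: an ideal of the Leavitt path algebra is not assumed to be
  closed under scalars. That a graph-theoretically properly infinite vertex \<open>v\<close> is a
  properly infinite idempotent follows from the set of all \<open>b\<close> such that
  \<open>v \<oplus> b\<close> is subordinate to \<open>v\<close>. It is an ideal, hence its vertices
  form a hereditary saturated set; it contains every vertex below \<open>v\<close> with two closed
  simple paths, and so it contains \<open>v\<close>.\<close>

definition ring_ideal :: "'a::ring_1 set \<Rightarrow> bool" where
  "ring_ideal J \<longleftrightarrow> 0 \<in> J \<and> (\<forall>x\<in>J. \<forall>y\<in>J. x + y \<in> J) \<and> (\<forall>x\<in>J. \<forall>a. a * x \<in> J \<and> x * a \<in> J)"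

locale ring_cong =
  fixes J :: "'a::ring_1 set"
  assumes ring_ideal: "ring_ideal J"
begin

lemma zero_mem [simp]: "0 \<in> J"
  and add_mem: "x \<in> J \<Longrightarrow> y \<in> J \<Longrightarrow> x + y \<in> J"
  and mult_mem_left: "x \<in> J \<Longrightarrow> a * x \<in> J"
  and mult_mem_right: "x \<in> J \<Longrightarrow> x * a \<in> J"
  using ring_ideal by (auto simp: ring_ideal_def)

lemma uminus_mem: "x \<in> J \<Longrightarrow> - x \<in> J"
  using mult_mem_left[of x "-1"] by simp

lemma diff_mem: "x \<in> J \<Longrightarrow> y \<in> J \<Longrightarrow> x - y \<in> J"
  using add_mem[OF _ uminus_mem, of x y] by simp

lemma sum_mem: "(\<And>i. i \<in> I \<Longrightarrow> f i \<in> J) \<Longrightarrow> sum f I \<in> J"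
  by (induction I rule: infinite_finite_induct) (auto intro: add_mem)

definition cong :: "'a \<Rightarrow> 'a \<Rightarrow> bool" (infix "\<approx>" 50) where
  "x \<approx> y \<longleftrightarrow> x - y \<in> J"

lemma cong_refl [simp, intro]: "x \<approx> x"
  by (simp add: cong_def)

lemma cong_sym: "x \<approx> y \<Longrightarrow> y \<approx> x"
  using uminus_mem[of "x - y"] by (simp add: cong_def)

lemma cong_trans [trans]: "x \<approx> y \<Longrightarrow> y \<approx> z \<Longrightarrow> x \<approx> z"
  using add_mem[of "x - y" "y - z"] by (simp add: cong_def)

lemma cong_eq_trans [trans]: "x \<approx> y \<Longrightarrow> y = z \<Longrightarrow> x \<approx> z"
  by simp

lemma cong_add: "x \<approx> y \<Longrightarrow> x' \<approx> y' \<Longrightarrow> x + x' \<approx> y + y'"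
  using add_mem[of "x - y" "x' - y'"] by (simp add: cong_def algebra_simps)

lemma cong_diff: "x \<approx> y \<Longrightarrow> x' \<approx> y' \<Longrightarrow> x - x' \<approx> y - y'"
  using diff_mem[of "x - y" "x' - y'"] by (simp add: cong_def algebra_simps)

lemma cong_mult: "x \<approx> y \<Longrightarrow> x' \<approx> y' \<Longrightarrow> x * x' \<approx> y * y'"
  using add_mem[OF mult_mem_right[of "x - y" x'] mult_mem_left[of "x' - y'" y]]
  by (simp add: cong_def algebra_simps)

lemma cong_sum: "(\<And>i. i \<in> I \<Longrightarrow> f i \<approx> g i) \<Longrightarrow> sum f I \<approx> sum g I"
  by (induction I rule: infinite_finite_induct) (auto intro: cong_add)

lemma cong_zero_iff: "x \<approx> 0 \<longleftrightarrow> x \<in> J"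
  by (simp add: cong_def)

lemma cong_mem: "x \<approx> y \<Longrightarrow> x \<in> J \<longleftrightarrow> y \<in> J"
  by (metis cong_trans cong_sym cong_zero_iff)

text \<open>
  Residue classes with total operations: since these pick representatives, associativity,
  commutativity of addition and distributivity hold for arbitrary sets, so that they can be
  used as unconditional rewrite rules.
\<close>

definition cls :: "'a \<Rightarrow> 'a set" where
  "cls x = {y. y \<approx> x}"

definition rep :: "'a set \<Rightarrow> 'a" where
  "rep X = (SOME x. x \<in> X)"

definition qmult :: "'a set \<Rightarrow> 'a set \<Rightarrow> 'a set" (infixl "\<odot>" 70) where
  "X \<odot> Y = cls (rep X * rep Y)"

definition qadd :: "'a set \<Rightarrow> 'a set \<Rightarrow> 'a set" (infixl "\<boxplus>" 65) where
  "X \<boxplus> Y = cls (rep X + rep Y)"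

definition qsub :: "'a set \<Rightarrow> 'a set \<Rightarrow> 'a set" (infixl "\<boxminus>" 65) where
  "X \<boxminus> Y = cls (rep X - rep Y)"

lemma cls_eq_iff: "cls x = cls y \<longleftrightarrow> x \<approx> y"
  unfolding cls_def using cong_refl cong_trans cong_sym by blast

lemma cls_eqD: "cls x = cls y \<Longrightarrow> x \<approx> y"
  by (simp add: cls_eq_iff)

lemma cong_iff: "x \<approx> y \<longleftrightarrow> cls x = cls y"
  by (simp add: cls_eq_iff)

lemma rep_cls: "rep (cls x) \<approx> x"
  unfolding rep_def cls_def by (rule someI2[of _ x]) auto

lemma cls_mult: "cls (x * y) = cls x \<odot> cls y"
  unfolding qmult_def cls_eq_iff by (intro cong_mult cong_sym[OF rep_cls])

lemma cls_add: "cls (x + y) = cls x \<boxplus> cls y"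
  unfolding qadd_def cls_eq_iff by (intro cong_add cong_sym[OF rep_cls])

lemma cls_diff: "cls (x - y) = cls x \<boxminus> cls y"
  unfolding qsub_def cls_eq_iff by (intro cong_diff cong_sym[OF rep_cls])

lemma qmult_assoc: "X \<odot> Y \<odot> Z = X \<odot> (Y \<odot> Z)"
proof -
  have "cls (rep X * rep Y) \<odot> Z = cls (rep X * rep Y * rep Z)"
    unfolding qmult_def[of _ Z] cls_eq_iff by (intro cong_mult rep_cls cong_refl)
  moreover have "X \<odot> cls (rep Y * rep Z) = cls (rep X * (rep Y * rep Z))"
    unfolding qmult_def[of X] cls_eq_iff by (intro cong_mult rep_cls cong_refl)
  ultimately show ?thesis
    by (simp add: qmult_def[of X Y] qmult_def[of Y Z] mult.assoc)
qed

lemma qadd_mult: "(X \<boxplus> Y) \<odot> Z = X \<odot> Z \<boxplus> Y \<odot> Z"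
  and qmult_add: "Z \<odot> (X \<boxplus> Y) = Z \<odot> X \<boxplus> Z \<odot> Y"
  and qsub_mult: "(X \<boxminus> Y) \<odot> Z = X \<odot> Z \<boxminus> Y \<odot> Z"
  and qmult_sub: "Z \<odot> (X \<boxminus> Y) = Z \<odot> X \<boxminus> Z \<odot> Y"
proof -
  have 1: "cls a \<odot> Z = cls (a * rep Z)" and 2: "Z \<odot> cls a = cls (rep Z * a)" for a
    unfolding qmult_def cls_eq_iff by (intro cong_mult rep_cls cong_refl)+
  show "(X \<boxplus> Y) \<odot> Z = X \<odot> Z \<boxplus> Y \<odot> Z"
    unfolding qadd_def[of X] 1 by (simp add: qmult_def distrib_right cls_add)
  show "Z \<odot> (X \<boxplus> Y) = Z \<odot> X \<boxplus> Z \<odot> Y"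
    unfolding qadd_def[of X] 2 by (simp add: qmult_def distrib_left cls_add)
  show "(X \<boxminus> Y) \<odot> Z = X \<odot> Z \<boxminus> Y \<odot> Z"
    unfolding qsub_def[of X] 1 by (simp add: qmult_def left_diff_distrib cls_diff)
  show "Z \<odot> (X \<boxminus> Y) = Z \<odot> X \<boxminus> Z \<odot> Y"
    unfolding qsub_def[of X] 2 by (simp add: qmult_def right_diff_distrib cls_diff)
qed

lemma qmult_zero [simp]: "cls 0 \<odot> X = cls 0" "X \<odot> cls 0 = cls 0"
proof -
  have "cls 0 \<odot> X = cls (0 * rep X)" "X \<odot> cls 0 = cls (rep X * 0)"
    unfolding qmult_def cls_eq_iff by (intro cong_mult rep_cls cong_refl)+
  then show "cls 0 \<odot> X = cls 0" "X \<odot> cls 0 = cls 0"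
    by simp_all
qed

lemma qadd_zero [simp]:
  "cls 0 \<boxplus> cls x = cls x" "cls x \<boxplus> cls 0 = cls x"
  "cls 0 \<boxplus> (X \<odot> Y) = X \<odot> Y" "(X \<odot> Y) \<boxplus> cls 0 = X \<odot> Y"
  by (simp_all add: qmult_def flip: cls_add)

lemma qsub_zero [simp]:
  "cls x \<boxminus> cls 0 = cls x" "(X \<odot> Y) \<boxminus> cls 0 = X \<odot> Y" "X \<boxminus> X = cls 0"
  by (simp_all add: qmult_def qsub_def[of X X] flip: cls_diff)

lemma qmult_one [simp]:
  "cls 1 \<odot> cls x = cls x" "cls x \<odot> cls 1 = cls x"
  "cls 1 \<odot> (X \<odot> Y) = X \<odot> Y" "(X \<odot> Y) \<odot> cls 1 = X \<odot> Y"
  by (simp_all add: qmult_def[of X Y] flip: cls_mult)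

lemmas cls_hom = cls_mult cls_add cls_diff qmult_assoc qadd_mult qmult_add qsub_mult qmult_sub

text \<open>A congruence between a product and an element, as a pair of rewrite rules for right-nested products.\<close>

lemma cls_rule:
  assumes "x * y \<approx> z"
  shows "cls x \<odot> cls y = cls z" "cls x \<odot> (cls y \<odot> X) = cls z \<odot> X"
  using assms cls_eq_iff[of "x * y" z] by (simp_all add: cls_mult flip: qmult_assoc)

lemma cls_swap:
  assumes "x * y \<approx> z * w"
  shows "cls x \<odot> cls y = cls z \<odot> cls w" "cls x \<odot> (cls y \<odot> X) = cls z \<odot> (cls w \<odot> X)"
  using assms cls_eq_iff[of "x * y" "z * w"] by (simp_all add: cls_mult flip: qmult_assoc)

lemma cls_rule3:
  assumes "x * y * z \<approx> w"
  shows "cls x \<odot> (cls y \<odot> cls z) = cls w" "cls x \<odot> (cls y \<odot> (cls z \<odot> X)) = cls w \<odot> X"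
proof -
  have "cls (x * y * z) = cls w"
    using assms by (simp add: cls_eq_iff)
  then show "cls x \<odot> (cls y \<odot> cls z) = cls w" "cls x \<odot> (cls y \<odot> (cls z \<odot> X)) = cls w \<odot> X"
    by (simp_all add: cls_mult flip: qmult_assoc)
qed

text \<open>Two elements built from the witnesses cannot commute: bordered by \<open>r1 c\<close>
  and \<open>d s1\<close>, the order \<open>?a\<close>, \<open>?b\<close> yields
  \<open>(r1 e s1) (r2 e s2) (r1 e s1)\<close>, that is \<open>e\<close>, whereas the opposite order
  ends in the factor \<open>r2 e s1\<close>, that is 0. So below a commutative corner every properly
  infinite idempotent vanishes.\<close>

lemma commutative_corner:
  assumes comm: "\<And>a b. y * a * y * b * y \<approx> y * b * y * a * y"
    and e: "c * y * d \<approx> e" "e * e \<approx> e"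
    and r: "r1 * e * s1 \<approx> e" "r2 * e * s2 \<approx> e" "r2 * e * s1 \<approx> 0"
  shows "e \<in> J"
proof -
  note rules = cls_rule3[OF e(1)] cls_rule[OF e(2)] cls_rule3[OF r(1)] cls_rule3[OF r(2)] cls_rule3[OF r(3)]
  let ?a = "d * s1 * r2 * c" and ?b = "d * s2 * r1 * c"
  have "r1 * c * (y * ?a * y * ?b * y) * d * s1 \<approx> e"
    by (intro cls_eqD) (simp add: cls_hom rules)
  moreover have "r1 * c * (y * ?b * y * ?a * y) * d * s1 \<approx> 0"
    by (intro cls_eqD) (simp add: cls_hom rules)
  moreover have "r1 * c * (y * ?a * y * ?b * y) * d * s1 \<approx> r1 * c * (y * ?b * y * ?a * y) * d * s1"
    by (rule cong_mult[OF cong_mult[OF cong_mult[OF cong_refl comm] cong_refl] cong_refl])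
  ultimately show ?thesis
    using cong_trans cong_sym cong_zero_iff by blast
qed

end

section \<open>The ambient free algebra with unit\<close>

text \<open>Scalars are elements of the unital ambient algebra, so its ideals absorb them without a
  separate axiom.\<close>

definition cst :: "'k::field \<Rightarrow> ('g word \<Rightarrow>\<^sub>0 'k)" where
  "cst c = Poly_Mapping.single 0 c"

lemma pm_induct [case_names single add]:
  assumes "\<And>w c. P (Poly_Mapping.single w c)" "\<And>x y. P x \<Longrightarrow> P y \<Longrightarrow> P (x + y)"
  shows "P (x :: 'w \<Rightarrow>\<^sub>0 'k::comm_monoid_add)"
proof -
  have "P (\<Sum>w\<in>S. Poly_Mapping.single w (Poly_Mapping.lookup x w))" if "finite S" for S
    using that
  proof (induction S)
    case empty
    then show ?case using assms(1)[of undefined 0] by simp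
  qed (simp add: assms)
  moreover have "(\<Sum>w\<in>Poly_Mapping.keys x. Poly_Mapping.single w (Poly_Mapping.lookup x w)) = x"
    by (rule poly_mapping_eqI)
      (simp add: lookup_sum lookup_single when_def not_in_keys_iff_lookup_eq_zero)
  ultimately show ?thesis
    by (metis finite_keys)
qed

lemma cst_simps [simp]: "cst 0 = 0" "cst 1 = 1"
  by (simp_all add: cst_def)

lemma cst_add: "cst (a + b) = cst a + cst b"
  and cst_mult: "cst (a * b) = cst a * cst b"
  and cst_uminus: "cst (- a) = - cst a"
  by (simp_all add: cst_def single_add mult_single single_uminus)

lemma cst_commute: "x * cst c = cst c * x"
  by (induction x rule: pm_induct)
    (simp_all add: cst_def mult_single mult.commute distrib_left distrib_right)

lemma cst_left_commute: "x * (cst c * y) = cst c * (x * y)"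
  by (metis cst_commute mult.assoc)

lemma single_Word: "Poly_Mapping.single (Word gs) c = cst c * prod_list (map gen gs)"
proof (induction gs)
  case Nil
  then show ?case by (simp add: cst_def zero_word_def)
next
  case (Cons g gs)
  have "Poly_Mapping.single (Word (g # gs)) c = gen g * Poly_Mapping.single (Word gs) c"
    by (simp add: gen_def mult_single plus_word_def)
  then show ?case
    by (simp add: Cons cst_left_commute)
qed

lemma word_induct [case_names word add]:
  fixes x :: "'g word \<Rightarrow>\<^sub>0 'k::field"
  assumes "\<And>c gs. P (cst c * prod_list (map gen gs))" "\<And>x y. P x \<Longrightarrow> P y \<Longrightarrow> P (x + y)"
  shows "P x"
proof (induction x rule: pm_induct)
  case (single w c)
  then show ?case
    by (metis assms(1) single_Word word.exhaust)
qed (rule assms)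

lemma ring_ideal_by_gens:
  fixes T :: "('g word \<Rightarrow>\<^sub>0 'k::field) set"
  assumes "0 \<in> T" "\<And>x y. x \<in> T \<Longrightarrow> y \<in> T \<Longrightarrow> x + y \<in> T"
    "\<And>c x. x \<in> T \<Longrightarrow> cst c * x \<in> T"
    "\<And>g x. x \<in> T \<Longrightarrow> gen g * x \<in> T" "\<And>g x. x \<in> T \<Longrightarrow> x * gen g \<in> T"
  shows "ring_ideal T"
proof -
  have l: "prod_list (map gen gs) * x \<in> T" if "x \<in> T" for x gs
    using that by (induction gs) (auto simp: mult.assoc assms)
  have r: "x * prod_list (map gen gs) \<in> T" if "x \<in> T" for x gs
    using that by (induction gs arbitrary: x) (auto simp: assms simp flip: mult.assoc)
  have "a * x \<in> T \<and> x * a \<in> T" if "x \<in> T" for a x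
  proof (induction a rule: word_induct)
    case (word c gs)
    then show ?case
      using l[OF that] r[OF that] assms(3) by (simp add: mult.assoc cst_left_commute)
  qed (simp add: distrib_left distrib_right assms)
  then show ?thesis
    by (simp add: ring_ideal_def assms)
qed

text \<open>The endomorphism that sends every letter outside \<open>G\<close> to 0. Constant terms
  survive it, so its values need not lie in the nonunital \<open>free_algebra G\<close>; multiplying
  by an element of that algebra repairs this.\<close>

definition restr :: "'g set \<Rightarrow> ('g word \<Rightarrow>\<^sub>0 'k::field) \<Rightarrow> ('g word \<Rightarrow>\<^sub>0 'k)" where
  "restr G x = Poly_Mapping.mapp (\<lambda>w c. c when set (letters w) \<subseteq> G) x"

lemma lookup_restr: "Poly_Mapping.lookup (restr G x) w = (Poly_Mapping.lookup x w when set (letters w) \<subseteq> G)"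
  by (auto simp: restr_def lookup_mapp when_def not_in_keys_iff_lookup_eq_zero)

lemma restr_add: "restr G (x + y) = restr G x + restr G y"
  by (rule poly_mapping_eqI) (simp add: lookup_restr lookup_add when_def)

lemma restr_zero [simp]: "restr G 0 = 0"
  by (rule poly_mapping_eqI) (simp add: lookup_restr)

lemma restr_single:
  "restr G (Poly_Mapping.single w c) = (if set (letters w) \<subseteq> G then Poly_Mapping.single w c else 0)"
  by (rule poly_mapping_eqI) (auto simp: lookup_restr lookup_single when_def)

lemma restr_mult: "restr G (x * y) = restr G x * restr G y"
proof (induction x rule: pm_induct)
  case (single w c)
  show ?case
    by (induction y rule: pm_induct)
      (auto simp: distrib_left restr_add restr_single mult_single plus_word_def)
qed (simp add: distrib_right restr_add)

lemma restr_gen: "restr G (gen g) = (if g \<in> G then gen g else 0)"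
  by (simp add: gen_def restr_single)

lemma restr_cst [simp]: "restr G (cst c) = cst c"
  by (simp add: cst_def restr_single zero_word_def)

lemma carrier_free_algebra: "x \<in> carrier (free_algebra G) \<longleftrightarrow>
    (\<forall>w\<in>Poly_Mapping.keys x. letters w \<noteq> [] \<and> set (letters w) \<subseteq> G)"
  by (simp add: free_algebra_def)

lemma restr_carrier: "x \<in> carrier (free_algebra G) \<Longrightarrow> restr G x = x"
  by (rule poly_mapping_eqI)
    (auto simp: carrier_free_algebra lookup_restr when_def not_in_keys_iff_lookup_eq_zero)

context
  fixes G :: "'g set"
begin

lemma carrier_zero [simp]: "0 \<in> carrier (free_algebra G)"
  by (simp add: carrier_free_algebra)

lemma carrier_add: "x \<in> carrier (free_algebra G) \<Longrightarrow> y \<in> carrier (free_algebra G) \<Longrightarrow> x + y \<in> carrier (free_algebra G)"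
  using keys_add[of x y] by (fastforce simp: carrier_free_algebra)

lemma carrier_cst_mult: "x \<in> carrier (free_algebra G) \<Longrightarrow> cst c * x \<in> carrier (free_algebra G)"
  using keys_mult[of "cst c" x]
  by (fastforce simp: carrier_free_algebra cst_def zero_word_def plus_word_def split: if_splits)

lemma carrier_mult_restr: "x \<in> carrier (free_algebra G) \<Longrightarrow> x * restr G y \<in> carrier (free_algebra G)"
  and carrier_restr_mult: "x \<in> carrier (free_algebra G) \<Longrightarrow> restr G y * x \<in> carrier (free_algebra G)"
proof -
  assume x: "x \<in> carrier (free_algebra G)"
  have k: "set (letters w) \<subseteq> G" if "w \<in> Poly_Mapping.keys (restr G y)" for w
    using that by (auto simp: in_keys_iff lookup_restr)
  show "x * restr G y \<in> carrier (free_algebra G)"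
    using x keys_mult[of x "restr G y"] k by (fastforce simp: carrier_free_algebra plus_word_def)
  show "restr G y * x \<in> carrier (free_algebra G)"
    using x keys_mult[of "restr G y" x] k by (fastforce simp: carrier_free_algebra plus_word_def)
qed

lemma carrier_mult: "x \<in> carrier (free_algebra G) \<Longrightarrow> y \<in> carrier (free_algebra G) \<Longrightarrow> x * y \<in> carrier (free_algebra G)"
  using carrier_mult_restr[of x y] by (simp add: restr_carrier)

lemma carrier_uminus: "x \<in> carrier (free_algebra G) \<Longrightarrow> - x \<in> carrier (free_algebra G)"
  using carrier_cst_mult[of x "-1"] by (simp add: cst_uminus)

lemma carrier_diff: "x \<in> carrier (free_algebra G) \<Longrightarrow> y \<in> carrier (free_algebra G) \<Longrightarrow> x - y \<in> carrier (free_algebra G)"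
  using carrier_add[of x "- y"] carrier_uminus[of y] by simp

lemma carrier_sum: "(\<And>i. i \<in> I \<Longrightarrow> f i \<in> carrier (free_algebra G)) \<Longrightarrow> sum f I \<in> carrier (free_algebra G)"
  by (induction I rule: infinite_finite_induct) (auto intro: carrier_add)

lemma carrier_gen: "g \<in> G \<Longrightarrow> gen g \<in> carrier (free_algebra G)"
  by (simp add: carrier_free_algebra gen_def)

lemma carrier_induct [consumes 1, case_names word add]:
  assumes "x \<in> carrier (free_algebra G)" "\<And>c gs. gs \<noteq> [] \<Longrightarrow> set gs \<subseteq> G \<Longrightarrow> P (cst c * prod_list (map gen gs))"
    "\<And>x y. P x \<Longrightarrow> P y \<Longrightarrow> P (x + y)"
    "P 0"
  shows "P x"
proof -
  have "P (\<Sum>w\<in>S. Poly_Mapping.single w (Poly_Mapping.lookup x w))" if "finite S" "S \<subseteq> Poly_Mapping.keys x" for S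
    using that
  proof (induction S)
    case (insert w S)
    then have "P (Poly_Mapping.single (Word (letters w)) (Poly_Mapping.lookup x w))"
      using assms(1) unfolding single_Word by (intro assms(2)) (auto simp: carrier_free_algebra)
    then show ?case
      using insert by (simp add: assms(3))
  qed (simp add: assms)
  moreover have "(\<Sum>w\<in>Poly_Mapping.keys x. Poly_Mapping.single w (Poly_Mapping.lookup x w)) = x"
    by (rule poly_mapping_eqI)
      (simp add: lookup_sum lookup_single when_def not_in_keys_iff_lookup_eq_zero)
  ultimately show ?thesis
    by (metis finite_keys order_refl)
qed

end

section \<open>Actions by partial maps\<close>

primrec word_act :: "('g \<Rightarrow> 'z \<Rightarrow> 'z option) \<Rightarrow> 'g list \<Rightarrow> 'z \<Rightarrow> 'z option" where
  "word_act act [] z = Some z"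
| "word_act act (g # gs) z = Option.bind (act g z) (word_act act gs)"

definition app :: "('z \<Rightarrow> 'k::field) \<Rightarrow> 'z option \<Rightarrow> 'k" where
  "app f z = (case z of None \<Rightarrow> 0 | Some y \<Rightarrow> f y)"

lemma app_simps [simp]: "app f None = 0" "app f (Some z) = f z"
  by (simp_all add: app_def)

definition action ::
    "('g \<Rightarrow> 'z \<Rightarrow> 'z option) \<Rightarrow> ('g word \<Rightarrow>\<^sub>0 'k::field) \<Rightarrow> ('z \<Rightarrow> 'k) \<Rightarrow> 'z \<Rightarrow> 'k" where
  "action act x f z =
     (\<Sum>w\<in>Poly_Mapping.keys x. Poly_Mapping.lookup x w * app f (word_act act (letters w) z))"

lemma action_superset:
  assumes "finite S" "Poly_Mapping.keys x \<subseteq> S"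
  shows "action act x f z =
     (\<Sum>w\<in>S. Poly_Mapping.lookup x w * app f (word_act act (letters w) z))"
  unfolding action_def using assms
  by (intro sum.mono_neutral_left) (auto simp: not_in_keys_iff_lookup_eq_zero)

lemma action_add: "action act (x + y) f z = action act x f z + action act y f z"
proof -
  let ?S = "Poly_Mapping.keys x \<union> Poly_Mapping.keys y"
  show ?thesis
    using keys_add[of x y]
    by (simp add: action_superset[of ?S] lookup_add distrib_right sum.distrib)
qed

lemma action_zero [simp]: "action act 0 f z = 0"
  by (simp add: action_def)

lemma action_uminus: "action act (- x) f z = - action act x f z"
  using action_add[of act x "- x" f z] by (simp add: eq_neg_iff_add_eq_0 add.commute)

lemma action_diff: "action act (x - y) f z = action act x f z - action act y f z"
  using action_add[of act x "- y" f z] by (simp add: action_uminus)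

lemma action_sum: "action act (sum h I) f z = (\<Sum>i\<in>I. action act (h i) f z)"
  by (induction I rule: infinite_finite_induct) (auto simp: action_add)

lemma action_single:
  "action act (Poly_Mapping.single w c) f z = c * app f (word_act act (letters w) z)"
  by (simp add: action_def)

lemma word_act_append: "word_act act (gs @ hs) z = Option.bind (word_act act gs z) (word_act act hs)"
  by (induction gs arbitrary: z) (auto split: bind_splits)

lemma action_fun_add: "action act x (\<lambda>z. f z + g z) z = action act x f z + action act x g z"
  unfolding action_def sum.distrib[symmetric]
  by (rule sum.cong) (auto simp: app_def distrib_left split: option.split)

lemma action_mult: "action act (x * y) f z = action act x (action act y f) z"
proof (induction x rule: pm_induct)
  case (single w c)
  show ?case
  proof (induction y rule: pm_induct)
    case (single v d)
    then show ?case
      by (cases "word_act act (letters w) z")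
        (auto simp: mult_single action_single plus_word_def word_act_append mult.assoc)
  next
    case (add x y)
    have "action act (x + y) f = (\<lambda>z. action act x f z + action act y f z)"
      by (auto simp: action_add)
    then show ?case
      by (simp add: distrib_left action_add add action_fun_add)
  qed
qed (simp add: distrib_right action_add)

lemma action_gen: "action act (gen g) f z = app f (act g z)"
  by (cases "act g z") (auto simp: gen_def action_single)

lemma action_cst_mult: "action act (cst c * x) f z = c * action act x f z"
  by (simp add: action_mult cst_def action_single zero_word_def)

definition ann :: "('g \<Rightarrow> 'z \<Rightarrow> 'z option) \<Rightarrow> ('g word \<Rightarrow>\<^sub>0 'k::field) set" where
  "ann act = {x. \<forall>f z. action act x f z = 0}"

lemma ring_ideal_ann: "ring_ideal (ann act)"
proof -
  have "action act a (action act x f) z = 0" if "x \<in> ann act" for a x f z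
    using that by (auto simp: ann_def action_def[of act a] app_def intro!: sum.neutral split: option.split)
  then show ?thesis
    by (auto simp: ring_ideal_def ann_def action_add action_mult)
qed

section \<open>Calculus in the Leavitt path algebra modulo an ideal\<close>

abbreviation vx :: "'v \<Rightarrow> ('v, 'e) lpa_gen word \<Rightarrow>\<^sub>0 'k::field" where "vx v \<equiv> gen (Vertex v)"
abbreviation ed :: "'e \<Rightarrow> ('v, 'e) lpa_gen word \<Rightarrow>\<^sub>0 'k::field" where "ed e \<equiv> gen (Edge e)"
abbreviation gh :: "'e \<Rightarrow> ('v, 'e) lpa_gen word \<Rightarrow>\<^sub>0 'k::field" where "gh e \<equiv> gen (Ghost e)"

definition pth :: "'e list \<Rightarrow> ('v, 'e) lpa_gen word \<Rightarrow>\<^sub>0 'k::field" where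
  "pth p = prod_list (map ed p)"

definition gth :: "'e list \<Rightarrow> ('v, 'e) lpa_gen word \<Rightarrow>\<^sub>0 'k::field" where
  "gth p = prod_list (map gh (rev p))"

lemma pth_simps [simp]: "pth [] = 1" "pth (e # p) = ed e * pth p" "pth (p @ q) = pth p * pth q"
  by (simp_all add: pth_def)

lemma gth_simps [simp]: "gth [] = 1" "gth (e # p) = gth p * gh e" "gth (p @ q) = gth q * gth p"
  by (simp_all add: gth_def)

text \<open>The usual spanning monomial \<open>p u q*\<close> of a Leavitt path algebra. The middle
  vertex is kept because two empty paths alone would give 1, which does not belong to the
  algebra.\<close>

definition mon :: "'v \<times> 'e list \<times> 'e list \<Rightarrow> ('v, 'e) lpa_gen word \<Rightarrow>\<^sub>0 'k::field" where
  "mon = (\<lambda>(u, p, q). pth p * vx u * gth q)"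

lemma hereditary_arc: "wf_digraph E \<Longrightarrow> hereditary E H \<Longrightarrow> e \<in> arcs E \<Longrightarrow> tail E e \<in> H \<Longrightarrow> head E e \<in> H"
  unfolding hereditary_def connects_def using wf_digraph.arc_implies_awalk by fastforce

lemma hereditary_awalk: "hereditary E H \<Longrightarrow> pre_digraph.awalk E u p w \<Longrightarrow> u \<in> H \<Longrightarrow> w \<in> H"
  unfolding hereditary_def connects_def by blast

text \<open>The ideals of the ambient algebra that stand for ideals of the Leavitt path algebra.
  Letters naming no vertex or edge of the graph must vanish, because the ambient algebra is built
  over the whole type.\<close>

definition lpa_good :: "('v, 'e) pre_digraph \<Rightarrow> (('v, 'e) lpa_gen word \<Rightarrow>\<^sub>0 'k::field) set \<Rightarrow> bool" where
  "lpa_good E J \<longleftrightarrow> ring_ideal J \<and> lpa_relations E \<subseteq> J \<and> (\<forall>g. g \<notin> lpa_gens E \<longrightarrow> gen g \<in> J)"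

locale alg_cong = ring_cong J for J :: "('g word \<Rightarrow>\<^sub>0 'k::field) set"
begin

text \<open>Membership is up to congruence, so a span contains \<open>J\<close> and can itself serve
  as an ideal to calculate with.\<close>

definition lspan :: "('i \<Rightarrow> 'g word \<Rightarrow>\<^sub>0 'k) \<Rightarrow> 'i set \<Rightarrow> ('g word \<Rightarrow>\<^sub>0 'k) set" where
  "lspan g I = {x. \<exists>D k. finite D \<and> D \<subseteq> I \<and> x \<approx> (\<Sum>i\<in>D. cst (k i) * g i)}"

lemma lspanI: "finite D \<Longrightarrow> D \<subseteq> I \<Longrightarrow> x \<approx> (\<Sum>i\<in>D. cst (k i) * g i) \<Longrightarrow> x \<in> lspan g I"
  unfolding lspan_def by blast

lemma lspan_cong: "x \<in> lspan g I \<Longrightarrow> y \<approx> x \<Longrightarrow> y \<in> lspan g I"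
  unfolding lspan_def using cong_trans by blast

lemma lspan_zero: "x \<in> J \<Longrightarrow> x \<in> lspan g I"
  by (rule lspanI[of "{}"]) (auto simp: cong_zero_iff)

lemma lspan_base: "i \<in> I \<Longrightarrow> g i \<in> lspan g I"
  by (rule lspanI[of "{i}" _ _ "\<lambda>_. 1"]) auto

lemma lspan_baseI: "x \<approx> g i \<Longrightarrow> i \<in> I \<Longrightarrow> x \<in> lspan g I"
  by (rule lspan_cong[OF lspan_base])

lemma lspan_zeroI: "x \<approx> 0 \<Longrightarrow> x \<in> lspan g I"
  by (simp add: lspan_zero cong_zero_iff)

lemma lspan_add:
  assumes "x \<in> lspan g I" "y \<in> lspan g I"
  shows "x + y \<in> lspan g I"
proof -
  obtain D k where D: "finite D" "D \<subseteq> I" "x \<approx> (\<Sum>i\<in>D. cst (k i) * g i)"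
    using assms(1) unfolding lspan_def by blast
  obtain D' k' where D': "finite D'" "D' \<subseteq> I" "y \<approx> (\<Sum>i\<in>D'. cst (k' i) * g i)"
    using assms(2) unfolding lspan_def by blast
  let ?k = "\<lambda>i. (if i \<in> D then k i else 0) + (if i \<in> D' then k' i else 0)"
  have "(\<Sum>i\<in>D. cst (k i) * g i) = (\<Sum>i\<in>D \<union> D'. cst (if i \<in> D then k i else 0) * g i)"
    "(\<Sum>i\<in>D'. cst (k' i) * g i) = (\<Sum>i\<in>D \<union> D'. cst (if i \<in> D' then k' i else 0) * g i)"
    using D(1) D'(1) by (auto intro!: sum.mono_neutral_cong_left)
  then have "(\<Sum>i\<in>D. cst (k i) * g i) + (\<Sum>i\<in>D'. cst (k' i) * g i) = (\<Sum>i\<in>D \<union> D'. cst (?k i) * g i)"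
    by (simp add: cst_add distrib_right sum.distrib)
  then show ?thesis
    using D D' cong_add[OF D(3) D'(3)] by (intro lspanI[of "D \<union> D'" _ _ ?k]) auto
qed

lemma lspan_sum: "(\<And>i. i \<in> A \<Longrightarrow> f i \<in> lspan g I) \<Longrightarrow> sum f A \<in> lspan g I"
  by (induction A rule: infinite_finite_induct) (auto intro: lspan_add lspan_zero)

lemma lspan_cst: "x \<in> lspan g I \<Longrightarrow> cst c * x \<in> lspan g I"
proof -
  assume "x \<in> lspan g I"
  then obtain D k where D: "finite D" "D \<subseteq> I" "x \<approx> (\<Sum>i\<in>D. cst (k i) * g i)"
    unfolding lspan_def by blast
  have "cst c * x \<approx> cst c * (\<Sum>i\<in>D. cst (k i) * g i)"
    by (intro cong_mult cong_refl D)
  also have "\<dots> = (\<Sum>i\<in>D. cst (c * k i) * g i)"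
    by (simp add: sum_distrib_left cst_mult mult.assoc)
  finally show ?thesis
    using D by (intro lspanI)
qed

lemma lspan_mult:
  assumes "x \<in> lspan g I" "\<And>i. i \<in> I \<Longrightarrow> a * g i * b \<in> lspan g' I'"
  shows "a * x * b \<in> lspan g' I'"
proof -
  obtain D k where D: "finite D" "D \<subseteq> I" "x \<approx> (\<Sum>i\<in>D. cst (k i) * g i)"
    using assms(1) unfolding lspan_def by blast
  have "a * x * b \<approx> a * (\<Sum>i\<in>D. cst (k i) * g i) * b"
    by (intro cong_mult cong_refl D)
  also have "\<dots> = (\<Sum>i\<in>D. cst (k i) * (a * g i * b))"
    by (simp add: sum_distrib_left sum_distrib_right cst_left_commute mult.assoc)
  finally have *: "a * x * b \<approx> (\<Sum>i\<in>D. cst (k i) * (a * g i * b))" .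
  show ?thesis
    by (rule lspan_cong[OF _ *], intro lspan_sum lspan_cst assms(2)) (use D(2) in blast)
qed

lemma lspan_nonzero:
  assumes "x \<in> lspan g I"
  obtains D k where "finite D" "D \<subseteq> I" "\<And>i. i \<in> D \<Longrightarrow> k i \<noteq> 0" "x \<approx> (\<Sum>i\<in>D. cst (k i) * g i)"
proof -
  obtain D k where D: "finite D" "D \<subseteq> I" "x \<approx> (\<Sum>i\<in>D. cst (k i) * g i)"
    using assms unfolding lspan_def by blast
  have "(\<Sum>i\<in>D. cst (k i) * g i) = (\<Sum>i\<in>{i\<in>D. k i \<noteq> 0}. cst (k i) * g i)"
    using D(1) by (intro sum.mono_neutral_right) auto
  with D(3) have "x \<approx> (\<Sum>i\<in>{i\<in>D. k i \<noteq> 0}. cst (k i) * g i)"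
    by (rule cong_eq_trans)
  moreover have "finite {i\<in>D. k i \<noteq> 0}" "{i\<in>D. k i \<noteq> 0} \<subseteq> I"
    using D(1,2) by auto
  ultimately show ?thesis
    using that[of "{i\<in>D. k i \<noteq> 0}" k] by blast
qed

end

locale lpa_cong = wf_digraph E + alg_cong J
  for E :: "('v, 'e) pre_digraph" and J :: "(('v, 'e) lpa_gen word \<Rightarrow>\<^sub>0 'k::field) set" +
  assumes relations: "lpa_relations E \<subseteq> J"
    and bad: "g \<notin> lpa_gens E \<Longrightarrow> gen g \<in> J"
begin

lemma good: "lpa_good E J"
  using ring_ideal relations bad by (auto simp: lpa_good_def)

lemma relD: "x - y \<in> lpa_relations E \<Longrightarrow> x \<approx> y"
  using relations by (auto simp: cong_def)

lemma vx_vx: "v \<in> verts E \<Longrightarrow> w \<in> verts E \<Longrightarrow> vx v * vx w \<approx> (if v = w then vx v else 0)"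
  by (rule relD) (rule lpa_relations.intros)

lemma vx_idem: "v \<in> verts E \<Longrightarrow> vx v * vx v \<approx> vx v"
  using vx_vx[of v v] by simp

lemma gh_ed: "e \<in> arcs E \<Longrightarrow> e' \<in> arcs E \<Longrightarrow> gh e * ed e' \<approx> (if e = e' then vx (head E e) else 0)"
  by (rule relD) (rule lpa_relations.intros)

lemma CK2_cong: "regular_vertex E v \<Longrightarrow> vx v \<approx> (\<Sum>e\<in>out_arcs E v. ed e * gh e)"
  by (rule relD) (rule lpa_relations.intros)

lemma absorb: assumes "e \<in> arcs E"
  shows "vx (tail E e) * ed e \<approx> ed e" "ed e * vx (head E e) \<approx> ed e"
    "vx (head E e) * gh e \<approx> gh e" "gh e * vx (tail E e) \<approx> gh e"
  using assms by (auto intro!: relD lpa_relations.intros)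

lemma vx_ed: "v \<in> verts E \<Longrightarrow> e \<in> arcs E \<Longrightarrow> vx v * ed e \<approx> (if v = tail E e then ed e else 0)"
  and ed_vx: "v \<in> verts E \<Longrightarrow> e \<in> arcs E \<Longrightarrow> ed e * vx v \<approx> (if v = head E e then ed e else 0)"
  and vx_gh: "v \<in> verts E \<Longrightarrow> e \<in> arcs E \<Longrightarrow> vx v * gh e \<approx> (if v = head E e then gh e else 0)"
  and gh_vx: "v \<in> verts E \<Longrightarrow> e \<in> arcs E \<Longrightarrow> gh e * vx v \<approx> (if v = tail E e then gh e else 0)"
proof -
  assume v: "v \<in> verts E" and e: "e \<in> arcs E"
  have a: "vx v * (vx (tail E e) * ed e) \<approx> vx v * ed e"
    "(ed e * vx (head E e)) * vx v \<approx> ed e * vx v"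
    "vx v * (vx (head E e) * gh e) \<approx> vx v * gh e"
    "(gh e * vx (tail E e)) * vx v \<approx> gh e * vx v"
    by (intro cong_mult cong_refl absorb e)+
  have b: "(vx v * vx (tail E e)) * ed e \<approx> (if v = tail E e then vx v else 0) * ed e"
    "ed e * (vx (head E e) * vx v) \<approx> ed e * (if head E e = v then vx (head E e) else 0)"
    "(vx v * vx (head E e)) * gh e \<approx> (if v = head E e then vx v else 0) * gh e"
    "gh e * (vx (tail E e) * vx v) \<approx> gh e * (if tail E e = v then vx (tail E e) else 0)"
    using v e by (intro cong_mult cong_refl vx_vx; simp)+
  show "vx v * ed e \<approx> (if v = tail E e then ed e else 0)"
    "ed e * vx v \<approx> (if v = head E e then ed e else 0)"
    "vx v * gh e \<approx> (if v = head E e then gh e else 0)"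
    "gh e * vx v \<approx> (if v = tail E e then gh e else 0)"
    using absorb[OF e] cong_trans[OF cong_sym[OF a(1)]] b(1)
      cong_trans[OF cong_sym[OF a(2)]] b(2)
      cong_trans[OF cong_sym[OF a(3)]] b(3)
      cong_trans[OF cong_sym[OF a(4)]] b(4)
    by (auto simp: mult.assoc)
qed

lemmas gen_rules = cls_rule[OF vx_vx] cls_rule[OF gh_ed] cls_rule[OF vx_ed] cls_rule[OF ed_vx]
  cls_rule[OF vx_gh] cls_rule[OF gh_vx]

text \<open>A commutation rule rather than an absorption rule:
  \<open>vx u * pth p \<approx> pth p\<close> would fail for the empty path, where
  \<open>pth [] = 1\<close>.\<close>

lemma vx_pth: "awalk u p w \<Longrightarrow> vx u * pth p \<approx> pth p * vx w"
proof (induction p arbitrary: u)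
  case (Cons e p)
  then have e: "e \<in> arcs E" "u = tail E e" and p: "awalk (head E e) p w"
    by (auto simp: awalk_Cons_iff)
  have "cls (vx (head E e)) \<odot> cls (pth p) = cls (pth p) \<odot> cls (vx w)"
    using Cons.IH[OF p] by (simp add: cls_eq_iff flip: cls_mult)
  then have "cls (ed e) \<odot> cls (pth p) = cls (ed e) \<odot> (cls (pth p) \<odot> cls (vx w))"
    using cls_rule(2)[OF ed_vx, of "head E e" e "cls (pth p)"] e by simp
  moreover have "cls (vx u) \<odot> (cls (ed e) \<odot> cls (pth p)) = cls (ed e) \<odot> cls (pth p)"
    using cls_rule(2)[OF vx_ed, of u e "cls (pth p)"] e by simp
  ultimately have "cls (vx u * pth (e # p)) = cls (pth (e # p) * vx w)"
    unfolding pth_simps cls_mult qmult_assoc by (rule trans[rotated])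
  then show ?case
    by (rule cls_eqD)
qed (simp add: awalk_Nil_iff)

lemma gth_vx: "awalk u p w \<Longrightarrow> gth p * vx u \<approx> vx w * gth p"
proof (induction p arbitrary: u)
  case (Cons e p)
  then have e: "e \<in> arcs E" "u = tail E e" and p: "awalk (head E e) p w"
    by (auto simp: awalk_Cons_iff)
  have "cls (gth p) \<odot> cls (vx (head E e)) = cls (vx w) \<odot> cls (gth p)"
    using Cons.IH[OF p] by (simp add: cls_eq_iff flip: cls_mult)
  then have "cls (vx w) \<odot> (cls (gth p) \<odot> cls (gh e)) = cls (gth p) \<odot> (cls (vx (head E e)) \<odot> cls (gh e))"
    by (simp flip: qmult_assoc)
  then show ?case
    using e by (intro cls_eqD) (simp add: cls_hom gen_rules)
qed (simp add: awalk_Nil_iff)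

lemma gth_pth: "awalk u q w \<Longrightarrow> vx w * gth q * pth q \<approx> vx w"
proof (induction q arbitrary: u)
  case (Cons e q)
  then have e: "e \<in> arcs E" "w \<in> verts E" and q: "awalk (head E e) q w"
    by (auto simp: awalk_Cons_iff)
  show ?case
    using e by (simp add: cong_iff cls_hom gen_rules cls_swap[OF gth_vx[OF q]] cls_rule3[OF Cons.IH[OF q]])
qed (simp add: awalk_Nil_iff)

lemma gth_pth': "awalk u q w \<Longrightarrow> gth q * pth q * vx w \<approx> vx w"
proof (induction q arbitrary: u)
  case (Cons e q)
  then have e: "e \<in> arcs E" "w \<in> verts E" and q: "awalk (head E e) q w"
    by (auto simp: awalk_Cons_iff)
  show ?case
    using e by (simp add: cong_iff cls_hom gen_rules cls_swap[OF vx_pth[OF q]] cls_rule3[OF Cons.IH[OF q]])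
qed (simp add: awalk_Nil_iff)

lemma gth_pth_self:
  assumes "awalk u p w"
  shows "gth p * vx u * pth p \<approx> vx w"
  by (simp add: cong_iff cls_hom cls_swap[OF gth_vx[OF assms]] cls_rule3[OF gth_pth[OF assms]])

text \<open>After their longest common prefix the two paths continue with different edges, and there
  the first Cuntz-Krieger relation gives 0.\<close>

lemma gth_pth_parallel:
  assumes "awalk u q w" "set p \<subseteq> arcs E" "\<not> prefix q p" "\<not> prefix p q"
  shows "gth q * pth p \<approx> 0"
proof -
  obtain r e q' e' p' where r: "e \<noteq> e'" "q = r @ e # q'" "p = r @ e' # p'"
    using parallel_decomp[of q p] assms(3,4) by blast
  have e: "e \<in> arcs E" "awalk u r (tail E e)" and e': "e' \<in> arcs E"
    using assms(1,2) r by (auto simp: awalk_Cons_iff)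
  \<comment> \<open>\<open>gth r * pth r\<close> collapses only next to a vertex, since it is 1 for
    empty \<open>r\<close>; that vertex is borrowed from \<open>gh e\<close>.\<close>
  have "cls (gh e) \<odot> (cls (gth r) \<odot> cls (pth r)) = (cls (gh e) \<odot> cls (vx (tail E e))) \<odot> (cls (gth r) \<odot> cls (pth r))"
    using e by (simp add: gen_rules)
  also have "\<dots> = cls (gh e)"
    unfolding qmult_assoc cls_rule3(1)[OF gth_pth[OF e(2)]] using e by (simp add: gen_rules)
  finally have *: "gh e * gth r * pth r \<approx> gh e"
    by (simp add: cong_iff cls_hom)
  show ?thesis
    using e e' r(1) by (simp add: r(2,3) cong_iff cls_hom cls_rule3[OF *] gen_rules)
qed

definition midx :: "'v set \<Rightarrow> ('v \<times> 'e list \<times> 'e list) set" where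
  "midx S = {(u, p, q). u \<in> S \<and> (\<exists>s. awalk s p u) \<and> (\<exists>s. awalk s q u)}"

lemma vx_mon: "v \<in> verts E \<Longrightarrow> awalk s p u \<Longrightarrow> vx v * mon (u, p, q) \<approx> (if v = s then mon (u, p, q) else 0)"
proof -
  assume v: "v \<in> verts E" and p: "awalk s p u"
  then have "s \<in> verts E"
    by blast
  then show ?thesis
    using v by (auto simp: cong_iff mon_def cls_hom gen_rules simp flip: cls_swap[OF vx_pth[OF p]])
qed

lemma mon_vx: "v \<in> verts E \<Longrightarrow> awalk s q u \<Longrightarrow> mon (u, p, q) * vx v \<approx> (if v = s then mon (u, p, q) else 0)"
proof -
  assume v: "v \<in> verts E" and q: "awalk s q u"
  then have "s \<in> verts E"
    by blast
  then show ?thesis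
    using v by (auto simp: cong_iff mon_def cls_hom gen_rules simp flip: cls_swap[OF gth_vx[OF q]])
qed

lemma mon_Nil_ed:
  assumes "u \<in> verts E" "e \<in> arcs E"
  shows "mon (u, p, []) * ed e \<approx> (if tail E e = u then mon (head E e, p @ [e], []) else 0)"
  using assms by (auto simp: cong_iff mon_def cls_hom gen_rules)

lemma mon_Cons_ed:
  assumes "awalk s (e' # q') u" "e \<in> arcs E"
  shows "mon (u, p, e' # q') * ed e \<approx> (if e' = e then mon (u, p, q') else 0)"
proof -
  have q': "e' \<in> arcs E" "awalk (head E e') q' u" "u \<in> verts E"
    using assms by (auto simp: awalk_Cons_iff)
  have "mon (u, p, e' # q') * ed e \<approx> (if e' = e then mon (u, p, q') * vx (head E e') else 0)"
    using assms(2) q' by (simp add: cong_iff mon_def cls_hom gen_rules)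
  also have "\<dots> \<approx> (if e' = e then mon (u, p, q') else 0)"
    using mon_vx[OF _ q'(2), of "head E e'" p] q'(1) by auto
  finally show ?thesis .
qed

lemma gh_mon_Nil:
  assumes "u \<in> verts E" "e \<in> arcs E"
  shows "gh e * mon (u, [], q) \<approx> (if tail E e = u then mon (head E e, [], q @ [e]) else 0)"
proof -
  have "cls (gh e) \<odot> (cls (vx u) \<odot> X) = (if tail E e = u then cls (vx (head E e)) \<odot> (cls (gh e) \<odot> X) else cls 0)" for X
    using assms by (simp add: gen_rules)
  then show ?thesis
    by (simp add: cong_iff mon_def cls_hom)
qed

lemma gh_mon_Cons:
  assumes "awalk s (e' # p') u" "e \<in> arcs E"
  shows "gh e * mon (u, e' # p', q) \<approx> (if e' = e then mon (u, p', q) else 0)"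
proof -
  have p': "e' \<in> arcs E" "awalk (head E e') p' u" "u \<in> verts E"
    using assms by (auto simp: awalk_Cons_iff)
  have "gh e * mon (u, e' # p', q) \<approx> (if e' = e then vx (head E e') * mon (u, p', q) else 0)"
    using assms(2) p' by (simp add: cong_iff mon_def cls_hom gen_rules)
  also have "\<dots> \<approx> (if e' = e then mon (u, p', q) else 0)"
    using vx_mon[OF _ p'(2), of "head E e'" q] p'(1) by auto
  finally show ?thesis .
qed

lemma ed_mon:
  assumes "awalk s p u" "e \<in> arcs E"
  shows "ed e * mon (u, p, q) \<approx> (if head E e = s then mon (u, e # p, q) else 0)"
proof -
  have "s \<in> verts E"
    using assms(1) by blast
  then show ?thesis
    using assms(2) by (auto simp: cong_iff mon_def cls_hom gen_rules simp flip: cls_swap[OF vx_pth[OF assms(1)]])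
qed

lemma mon_gh:
  assumes "awalk s q u" "e \<in> arcs E"
  shows "mon (u, p, q) * gh e \<approx> (if head E e = s then mon (u, p, e # q) else 0)"
proof -
  have "s \<in> verts E"
    using assms(1) by blast
  then show ?thesis
    using assms(2) by (auto simp: cong_iff mon_def cls_hom gen_rules simp flip: cls_swap[OF gth_vx[OF assms(1)]])
qed

end

text \<open>If one path were a proper prefix of the other, the next edge would start at
  \<open>w\<close> in the interior of a closed simple path. Distinct closed simple paths are
  therefore orthogonal by \<open>gth_pth_parallel\<close>.\<close>

lemma CSP_prefix:
  assumes "wf_digraph E" "p \<in> CSP E w" "q \<in> CSP E w" "p @ s = q @ t"
  shows "p = q"
proof -
  interpret wf_digraph E by fact
  have False if pq: "p \<in> CSP E w" "p @ r \<in> CSP E w" "r \<noteq> []" for p r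
  proof -
    obtain e r' where r: "r = e # r'"
      using \<open>r \<noteq> []\<close> by (cases r) auto
    have "awalk w p w" "awalk w (p @ e # r') w"
      using pq by (auto simp: CSP_def r)
    then have "tail E e = w"
      by (auto simp: awalk_append_iff awalk_Cons_iff dest: awalk_ends)
    moreover have "e \<in> set (tl (p @ r))"
      using pq(1) by (cases p) (auto simp: CSP_def r)
    ultimately show False
      using pq(2) by (auto simp: CSP_def)
  qed
  moreover obtain us where "p = q @ us \<or> q = p @ us"
    using assms(4) by (auto simp: append_eq_append_conv2)
  ultimately show ?thesis
    using assms(2,3) by (cases "us = []") auto
qed

section \<open>Vertices lying in an ideal, and ideals spanned by monomials\<close>

context lpa_cong
begin

definition killed :: "'v set" where
  "killed = {v \<in> verts E. vx v \<in> J}"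

lemma killed_hereditary: "hereditary E killed"
  unfolding hereditary_def
proof (intro conjI allI impI)
  fix v w assume v: "v \<in> killed" and "connects E v w"
  then obtain p where p: "awalk v p w"
    by (auto simp: connects_def)
  have "gth p * vx v * pth p \<in> J"
    using v by (auto simp: killed_def intro: mult_mem_left mult_mem_right)
  then show "w \<in> killed"
    using cong_mem[OF gth_pth_self[OF p]] p by (auto simp: killed_def)
qed (auto simp: killed_def)

lemma ed_killed: "e \<in> arcs E \<Longrightarrow> head E e \<in> killed \<Longrightarrow> ed e \<in> J"
  and gh_killed: "e \<in> arcs E \<Longrightarrow> head E e \<in> killed \<Longrightarrow> gh e \<in> J"
proof -
  assume e: "e \<in> arcs E" "head E e \<in> killed"
  then have "ed e * vx (head E e) \<in> J" "vx (head E e) * gh e \<in> J"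
    by (auto simp: killed_def mult_mem_left mult_mem_right)
  then show "ed e \<in> J" "gh e \<in> J"
    using cong_mem[OF absorb(2)[OF e(1)]] cong_mem[OF absorb(3)[OF e(1)]] by blast+
qed

lemma killed_saturated: "saturated E killed"
  unfolding saturated_def
proof (intro conjI allI impI)
  fix v assume v: "regular_vertex E v" and h: "head E ` out_arcs E v \<subseteq> killed"
  have "(\<Sum>e\<in>out_arcs E v. ed e * gh e) \<in> J"
    using h by (intro sum_mem mult_mem_right ed_killed) auto
  then show "v \<in> killed"
    using cong_mem[OF CK2_cong[OF v]] v by (auto simp: killed_def regular_vertex_def)
qed (auto simp: killed_def)

lemma midxI: "u \<in> S \<Longrightarrow> awalk s p u \<Longrightarrow> awalk t q u \<Longrightarrow> (u, p, q) \<in> midx S"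
  by (auto simp: midx_def)

text \<open>A letter changes the middle vertex only when it meets an empty path, and then
  \<open>u\<close> is replaced by the range of an edge starting at \<open>u\<close>. Heredity of
  \<open>S\<close> is what keeps the new monomial in the family.\<close>

lemma gen_mon_lspan:
  assumes S: "hereditary E S" and i: "i \<in> midx S"
  shows "gen g * mon i \<in> lspan mon (midx S)" (is "?l \<in> ?L") and "mon i * gen g \<in> lspan mon (midx S)"
proof -
  obtain u p q s t where [simp]: "i = (u, p, q)" and u: "u \<in> S" and p: "awalk s p u" and q: "awalk t q u"
    using i by (auto simp: midx_def)
  have uv: "u \<in> verts E"
    using p by blast
  have hd: "head E e \<in> S" if "e \<in> arcs E" "tail E e = u" for e
    using hereditary_arc[OF wf_digraph_axioms S that(1)] that u by simp
  have *: "x \<in> ?L" if "x \<approx> (if b then mon j else 0)" "b \<Longrightarrow> j \<in> midx S" for x b j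
    using that by (auto intro: lspan_cong lspan_base simp: cong_zero_iff lspan_zero split: if_splits)
  consider "g \<notin> lpa_gens E" | v where "g = Vertex v" "v \<in> verts E" | e where "g = Edge e" "e \<in> arcs E"
    | e where "g = Ghost e" "e \<in> arcs E"
    by (auto simp: lpa_gens_def)
  then have "?l \<in> ?L \<and> mon i * gen g \<in> ?L"
  proof cases
    case 1
    then show ?thesis
      by (intro conjI lspan_zero mult_mem_right[OF bad] mult_mem_left[OF bad])
  next
    case 2
    then show ?thesis
      using *[OF vx_mon[OF 2(2) p]] *[OF mon_vx[OF 2(2) q]] i by auto
  next
    case 3
    have "mon i * ed e \<in> ?L"
    proof (cases q)
      case Nil
      then show ?thesis
        using 3 uv u p hd
        by (auto intro!: *[OF mon_Nil_ed] midxI[of _ _ s _ "head E e"] simp: awalk_append_iff awalk_simps)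
    next
      case (Cons e' q')
      then show ?thesis
        using 3 q u p by (auto intro!: *[OF mon_Cons_ed] midxI[of _ _ s _ "head E e"] simp: awalk_Cons_iff)
    qed
    then show ?thesis
      using 3 *[OF ed_mon[OF p 3(2)]] u p q by (auto simp: awalk_Cons_iff midx_def)
  next
    case 4
    have "gh e * mon i \<in> ?L"
    proof (cases p)
      case Nil
      then show ?thesis
        using 4 uv u q hd
        by (auto intro!: *[OF gh_mon_Nil] midxI[of _ _ "head E e" _ t] simp: awalk_append_iff awalk_simps)
    next
      case (Cons e' q')
      then show ?thesis
        using 4 q u p by (auto intro!: *[OF gh_mon_Cons] midxI[of _ _ "head E e" _ t] simp: awalk_Cons_iff)
    qed
    then show ?thesis
      using 4 *[OF mon_gh[OF q 4(2)]] u p q by (auto simp: awalk_Cons_iff midx_def)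
  qed
  then show "?l \<in> ?L" "mon i * gen g \<in> ?L"
    by auto
qed

lemma lspan_good:
  assumes S: "hereditary E S"
  shows "lpa_good E (lspan mon (midx S))"
proof -
  have "ring_ideal (lspan mon (midx S))"
  proof (rule ring_ideal_by_gens)
    fix g x assume x: "x \<in> lspan mon (midx S)"
    show "gen g * x \<in> lspan mon (midx S)"
      using lspan_mult[OF x, of "gen g" 1 mon "midx S"] gen_mon_lspan[OF S] by simp
    show "x * gen g \<in> lspan mon (midx S)"
      using lspan_mult[OF x, of 1 "gen g" mon "midx S"] gen_mon_lspan[OF S] by simp
  qed (auto intro: lspan_zero lspan_add lspan_cst)
  then show ?thesis
    using relations bad lspan_zero unfolding lpa_good_def by blast
qed

lemma vx_lspan: "v \<in> S \<Longrightarrow> S \<subseteq> verts E \<Longrightarrow> vx v \<in> lspan mon (midx S)"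
  using lspan_base[of "(v, [], [])" "midx S" mon] by (auto simp: mon_def midx_def awalk_Nil_iff)

end

lemma lpa_good_locale: "wf_digraph E \<Longrightarrow> lpa_good E J \<Longrightarrow> lpa_cong E J"
  by (simp add: lpa_cong_def alg_cong_def ring_cong_def lpa_good_def lpa_cong_axioms_def)

lemma carrier_in_good:
  assumes "wf_digraph E" "lpa_good E L" "\<And>v. v \<in> verts E \<Longrightarrow> vx v \<in> L" "x \<in> carrier (free_algebra (lpa_gens E))"
  shows "x \<in> L"
proof -
  interpret lpa_cong E L
    by (rule lpa_good_locale) fact+
  have gen: "gen g \<in> L" if "g \<in> lpa_gens E" for g
    using that cong_mem[OF absorb(1)] cong_mem[OF absorb(4)] assms(3)
    by (auto simp: lpa_gens_def mult_mem_left mult_mem_right)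
  show ?thesis
    using assms(4)
  proof (induction rule: carrier_induct)
    case (word c gs)
    then obtain g hs where "gs = g # hs" "g \<in> lpa_gens E"
      by (cases gs) auto
    then show ?case
      by (simp add: mult_mem_left mult_mem_right gen)
  qed (auto intro: add_mem)
qed

context lpa_cong
begin

lemma carrier_lspan: "x \<in> carrier (free_algebra (lpa_gens E)) \<Longrightarrow> x \<in> lspan mon (midx (verts E))"
proof -
  have "hereditary E (verts E)"
    by (auto simp: hereditary_def connects_def)
  then show "x \<in> carrier (free_algebra (lpa_gens E)) \<Longrightarrow> ?thesis"
    using carrier_in_good[OF wf_digraph_axioms lspan_good] vx_lspan by blast
qed

text \<open>The column \<open>r1\<close>, \<open>r2\<close> times \<open>v\<close> times the row
  \<open>s1\<close>, \<open>s2\<close> is the diagonal matrix with entries \<open>v\<close> and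
  \<open>b\<close>: in this sense \<open>v \<oplus> b\<close> is subordinate to \<open>v\<close>. A
  vertex outside \<open>J\<close> is a properly infinite idempotent exactly if it belongs to its own
  set.\<close>

definition kset :: "'v \<Rightarrow> (('v, 'e) lpa_gen word \<Rightarrow>\<^sub>0 'k) set" where
  "kset v = {b. \<exists>r1 r2 s1 s2. r1 * vx v * s1 \<approx> vx v \<and> r1 * vx v * s2 \<approx> 0 \<and>
     r2 * vx v * s1 \<approx> 0 \<and> r2 * vx v * s2 \<approx> b}"

lemma ksetI:
  "r1 * vx v * s1 \<approx> vx v \<Longrightarrow> r1 * vx v * s2 \<approx> 0 \<Longrightarrow> r2 * vx v * s1 \<approx> 0 \<Longrightarrow> r2 * vx v * s2 \<approx> b \<Longrightarrow> b \<in> kset v"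
  unfolding kset_def by blast

text \<open>For products only \<open>r2\<close> or \<open>s2\<close> changes. For sums,
  \<open>v \<oplus> x \<oplus> y\<close> is subordinate to \<open>v \<oplus> y\<close> and this to
  \<open>v\<close>: the witnesses for \<open>x\<close> are applied inside the copy of
  \<open>v\<close> provided by those for \<open>y\<close>. Adding the last two rows and the last two
  columns then merges \<open>x\<close> and \<open>y\<close> into \<open>x + y\<close>.\<close>

lemma kset_good:
  assumes v: "v \<in> verts E"
  shows "lpa_good E (kset v)"
proof -
  have sub: "x \<in> kset v" if "x \<in> J" for x
    using that vx_idem[OF v] by (intro ksetI[of "vx v" v 1 0 0]) (auto simp: cong_zero_iff cong_sym)
  have mul: "a * x \<in> kset v \<and> x * a \<in> kset v" if "x \<in> kset v" for a x
  proof -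
    obtain r1 r2 s1 s2 where r: "r1 * vx v * s1 \<approx> vx v" "r1 * vx v * s2 \<approx> 0"
      "r2 * vx v * s1 \<approx> 0" "r2 * vx v * s2 \<approx> x"
      using \<open>x \<in> kset v\<close> unfolding kset_def by blast
    note rules = cls_rule3[OF r(1)] cls_rule3[OF r(2)] cls_rule3[OF r(3)] cls_rule3[OF r(4)]
    have "a * r2 * vx v * s1 \<approx> 0" "a * r2 * vx v * s2 \<approx> a * x"
      "r1 * vx v * (s2 * a) \<approx> 0" "r2 * vx v * (s2 * a) \<approx> x * a"
      by (rule cls_eqD, simp add: cls_hom rules)+
    then show ?thesis
      using r by (auto intro: ksetI)
  qed
  have add: "x + y \<in> kset v" if "x \<in> kset v" "y \<in> kset v" for x y
  proof -
    obtain r1 r2 s1 s2 where r: "r1 * vx v * s1 \<approx> vx v" "r1 * vx v * s2 \<approx> 0"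
      "r2 * vx v * s1 \<approx> 0" "r2 * vx v * s2 \<approx> x"
      using \<open>x \<in> kset v\<close> unfolding kset_def by blast
    obtain r1' r2' s1' s2' where r': "r1' * vx v * s1' \<approx> vx v" "r1' * vx v * s2' \<approx> 0"
      "r2' * vx v * s1' \<approx> 0" "r2' * vx v * s2' \<approx> y"
      using \<open>y \<in> kset v\<close> unfolding kset_def by blast
    note rules = cls_rule3[OF r(1)] cls_rule3[OF r(2)] cls_rule3[OF r(3)] cls_rule3[OF r(4)]
      cls_rule3[OF r'(1)] cls_rule3[OF r'(2)] cls_rule3[OF r'(3)] cls_rule3[OF r'(4)]
      cls_rule[OF vx_idem[OF v]]
    show ?thesis
    proof (rule ksetI)
      show "(r1 * vx v * r1') * vx v * (s1' * vx v * s1) \<approx> vx v"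
        "(r1 * vx v * r1') * vx v * (s1' * vx v * s2 + s2') \<approx> 0"
        "(r2 * vx v * r1' + r2') * vx v * (s1' * vx v * s1) \<approx> 0"
        "(r2 * vx v * r1' + r2') * vx v * (s1' * vx v * s2 + s2') \<approx> x + y"
        by (rule cls_eqD, simp add: cls_hom rules)+
    qed
  qed
  show ?thesis
    using relations bad sub mul add by (auto simp: lpa_good_def ring_ideal_def)
qed

text \<open>\<open>v\<close> splits into \<open>pr\<close> and the copy \<open>al * al'\<close> of
  \<open>w\<close>. The path \<open>a\<close> maps this copy into itself, and \<open>b\<close> maps
  a further copy of \<open>w\<close> into it, orthogonally to the first. Keeping \<open>pr\<close>
  fixed, \<open>v \<oplus> w\<close> fits into \<open>v\<close>.\<close>

lemma CSP_kset:
  assumes v: "awalk v p w" and c: "a \<in> CSP E w" "b \<in> CSP E w" "a \<noteq> b"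
  shows "vx w \<in> kset v"
proof -
  have vw: "v \<in> verts E" "w \<in> verts E"
    using v by blast+
  define al :: "('v, 'e) lpa_gen word \<Rightarrow>\<^sub>0 'k" where "al = vx v * pth p * vx w"
  define al' :: "('v, 'e) lpa_gen word \<Rightarrow>\<^sub>0 'k" where "al' = vx w * gth p * vx v"
  define m :: "'e list \<Rightarrow> ('v, 'e) lpa_gen word \<Rightarrow>\<^sub>0 'k" where "m a = vx w * pth a * vx w" for a
  define m' :: "'e list \<Rightarrow> ('v, 'e) lpa_gen word \<Rightarrow>\<^sub>0 'k" where "m' a = vx w * gth a * vx w" for a
  define pr where "pr = vx v - al * al'"
  have aw: "awalk w a w" "awalk w b w" "set a \<subseteq> arcs E" "set b \<subseteq> arcs E"
    using c by (auto simp: CSP_def)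
  have np: "\<not> prefix a b" "\<not> prefix b a"
    using CSP_prefix[OF wf_digraph_axioms c(1,2), of _ "[]"] CSP_prefix[OF wf_digraph_axioms c(2,1), of _ "[]"] c(3)
    by (auto simp: prefix_def)
  note vi = cls_rule[OF vx_idem[OF vw(1)]] cls_rule[OF vx_idem[OF vw(2)]]
  have self: "(vx w * gth p * vx v) * (vx v * pth p * vx w) \<approx> vx w" if "awalk v p w" "v \<in> verts E" for v p
    using vw(2) that(2) by (simp add: cong_iff cls_hom gen_rules cls_rule3[OF gth_pth_self[OF that(1)]])
  have orth: "m' a * m b \<approx> 0" if "awalk w a w" "awalk w b w" "\<not> prefix a b" "\<not> prefix b a" for a b
  proof -
    have *: "gth a * pth b \<approx> 0"
      using that by (intro gth_pth_parallel[of w a w b]) auto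
    show ?thesis
      using vw(2) by (simp add: m_def m'_def cong_iff cls_hom gen_rules cls_swap[OF vx_pth[OF that(2)]] cls_rule[OF *])
  qed
  have R: "al' * al \<approx> vx w" "m' a * m a \<approx> vx w" "m' b * m b \<approx> vx w"
    "m' a * m b \<approx> 0" "m' b * m a \<approx> 0"
    using self[OF v vw(1)] self[OF aw(1) vw(2)] self[OF aw(2) vw(2)] orth[OF aw(1,2) np] orth[OF aw(2,1) np(2,1)]
    by (simp_all add: al_def al'_def m_def m'_def)
  have I: "vx v * al \<approx> al" "al * vx w \<approx> al" "vx w * al' \<approx> al'" "al' * vx v \<approx> al'"
    "vx w * m a \<approx> m a" "m a * vx w \<approx> m a" "vx w * m' a \<approx> m' a" "m' a * vx w \<approx> m' a" for a
    unfolding al_def al'_def m_def m'_def by (rule cls_eqD, simp add: cls_hom vi)+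
  note rules = vi cls_rule[OF R(1)] cls_rule[OF R(2)] cls_rule[OF R(3)] cls_rule[OF R(4)] cls_rule[OF R(5)]
    cls_rule[OF I(1)] cls_rule[OF I(2)] cls_rule[OF I(3)] cls_rule[OF I(4)]
    cls_rule[OF I(5)] cls_rule[OF I(6)] cls_rule[OF I(7)] cls_rule[OF I(8)]
  have P: "vx v * pr \<approx> pr" "pr * vx v \<approx> pr" "pr * al \<approx> 0" "al' * pr \<approx> 0"
    unfolding pr_def by (rule cls_eqD, simp add: cls_hom rules)+
  have "pr * pr = pr * vx v - pr * al * al'"
    by (simp add: pr_def algebra_simps)
  also have "\<dots> \<approx> pr - 0 * al'"
    by (intro cong_diff cong_mult cong_refl P)
  finally have P': "pr * pr \<approx> pr" by simp
  note rules' = rules cls_rule[OF P(1)] cls_rule[OF P(2)] cls_rule[OF P(3)] cls_rule[OF P(4)] cls_rule[OF P']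
  show ?thesis
  proof (rule ksetI)
    have "(pr + al * m' a * al') * vx v * (pr + al * m a * al') \<approx> pr + al * al'"
      by (rule cls_eqD, simp add: cls_hom rules')
    then show "(pr + al * m' a * al') * vx v * (pr + al * m a * al') \<approx> vx v"
      by (simp add: pr_def)
    show "(pr + al * m' a * al') * vx v * (al * m b) \<approx> 0"
      "(m' b * al') * vx v * (pr + al * m a * al') \<approx> 0"
      "(m' b * al') * vx v * (al * m b) \<approx> vx w"
      by (rule cls_eqD, simp add: cls_hom rules')+
  qed
qed

end

lemma two_CSP: "infinite (CSP E w) \<or> 2 \<le> card (CSP E w) \<longleftrightarrow> (\<exists>a b. a \<in> CSP E w \<and> b \<in> CSP E w \<and> a \<noteq> b)"
proof
  assume "infinite (CSP E w) \<or> 2 \<le> card (CSP E w)"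
  then obtain B where "B \<subseteq> CSP E w" "card B = 2"
    using infinite_arbitrarily_large[of "CSP E w" 2] obtain_subset_with_card_n[of 2 "CSP E w"] by blast
  then show "\<exists>a b. a \<in> CSP E w \<and> b \<in> CSP E w \<and> a \<noteq> b"
    by (auto simp: card_2_iff)
next
  assume "\<exists>a b. a \<in> CSP E w \<and> b \<in> CSP E w \<and> a \<noteq> b"
  then obtain a b where "{a, b} \<subseteq> CSP E w" "card {a, b} = 2"
    by auto
  then show "infinite (CSP E w) \<or> 2 \<le> card (CSP E w)"
    using card_mono[of "CSP E w" "{a, b}"] by auto
qed

context lpa_cong
begin

text \<open>\<open>kset v\<close> is a good ideal, so its vertices form a hereditary saturated set.
  This set contains \<open>W\<close> by \<open>CSP_kset\<close>, hence the closure of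
  \<open>W\<close>, hence \<open>v\<close>.\<close>

lemma properly_infinite_kset:
  assumes "properly_infinite E v"
  shows "vx v \<in> kset v"
proof -
  obtain W where v: "v \<in> verts E" and W: "W \<subseteq> tree E v"
    "\<And>w. w \<in> W \<Longrightarrow> \<exists>a b. a \<in> CSP E w \<and> b \<in> CSP E w \<and> a \<noteq> b" "v \<in> hs_closure E W"
    using assms unfolding properly_infinite_def two_CSP by blast
  interpret K: lpa_cong E "kset v"
    by (rule lpa_good_locale[OF wf_digraph_axioms kset_good[OF v]])
  have "W \<subseteq> K.killed"
  proof
    fix w assume w: "w \<in> W"
    then obtain p where "w \<in> verts E" "awalk v p w"
      using W(1) by (auto simp: tree_def connects_def)
    then show "w \<in> K.killed"
      using W(2)[OF w] CSP_kset by (auto simp: K.killed_def)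
  qed
  then have "hs_closure E W \<subseteq> K.killed"
    using K.killed_hereditary K.killed_saturated by (auto simp: hs_closure_def)
  then show ?thesis
    using W(3) by (auto simp: K.killed_def)
qed

end

section \<open>Branching systems\<close>

text \<open>An algebraic branching system: disjoint sets at the vertices, in which the edges mark
  disjoint copies of the sets at their ranges. The functions on it form a module over the Leavitt
  path algebra; \<open>cover\<close> is the second Cuntz-Krieger relation.\<close>

locale branching = wf_digraph E for E :: "('v, 'e) pre_digraph" +
  fixes D :: "'v \<Rightarrow> 'z set" and \<theta> :: "'e \<Rightarrow> 'z \<Rightarrow> 'z"
  assumes theta_in: "e \<in> arcs E \<Longrightarrow> z \<in> D (head E e) \<Longrightarrow> \<theta> e z \<in> D (tail E e)"
    and theta_inj: "e \<in> arcs E \<Longrightarrow> inj_on (\<theta> e) (D (head E e))"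
    and theta_disjoint: "e \<in> arcs E \<Longrightarrow> e' \<in> arcs E \<Longrightarrow> e \<noteq> e' \<Longrightarrow>
      z \<in> D (head E e) \<Longrightarrow> z' \<in> D (head E e') \<Longrightarrow> \<theta> e z \<noteq> \<theta> e' z'"
    and D_disjoint: "v \<in> verts E \<Longrightarrow> w \<in> verts E \<Longrightarrow> v \<noteq> w \<Longrightarrow> D v \<inter> D w = {}"
    and cover: "regular_vertex E v \<Longrightarrow> z \<in> D v \<Longrightarrow> \<exists>e\<in>out_arcs E v. z \<in> \<theta> e ` D (head E e)"
begin

text \<open>As functions are pulled back, an edge moves points by the inverse of
  \<open>\<theta> e\<close> and a ghost edge by \<open>\<theta> e\<close> itself.\<close>

definition bact :: "('v, 'e) lpa_gen \<Rightarrow> 'z \<Rightarrow> 'z option" where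
  "bact g z = (case g of
     Vertex v \<Rightarrow> if v \<in> verts E \<and> z \<in> D v then Some z else None
   | Edge e \<Rightarrow> if e \<in> arcs E \<and> z \<in> \<theta> e ` D (head E e)
       then Some (inv_into (D (head E e)) (\<theta> e) z) else None
   | Ghost e \<Rightarrow> if e \<in> arcs E \<and> z \<in> D (head E e) then Some (\<theta> e z) else None)"

lemma bact_Vertex: "v \<in> verts E \<Longrightarrow> bact (Vertex v) z = (if z \<in> D v then Some z else None)"
  by (simp add: bact_def)

lemma bact_Edge_iff: "bact (Edge e) z = Some z' \<longleftrightarrow> e \<in> arcs E \<and> z' \<in> D (head E e) \<and> z = \<theta> e z'"
  using theta_inj by (auto simp: bact_def)

lemma bact_Edge_None: "bact (Edge e) z = None \<longleftrightarrow> \<not> (e \<in> arcs E \<and> z \<in> \<theta> e ` D (head E e))"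
  by (simp add: bact_def)

lemma bact_Ghost: "e \<in> arcs E \<Longrightarrow> bact (Ghost e) z = (if z \<in> D (head E e) then Some (\<theta> e z) else None)"
  by (simp add: bact_def)

lemma bact_bad: "g \<notin> lpa_gens E \<Longrightarrow> bact g z = None"
  by (cases g) (auto simp: bact_def lpa_gens_def)

lemma action_ed_gh:
  assumes e: "e \<in> arcs E"
  shows "action bact (ed e * gh e) f z = (if z \<in> \<theta> e ` D (head E e) then f z else 0)"
proof (cases "bact (Edge e) z")
  case None
  then have "z \<notin> \<theta> e ` D (head E e)"
    using e by (simp add: bact_Edge_None)
  then show ?thesis
    using None by (simp add: action_mult action_gen)
next
  case (Some z')
  then have "z' \<in> D (head E e)" "z = \<theta> e z'"
    by (auto simp: bact_Edge_iff)
  then show ?thesis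
    using Some e by (auto simp: action_mult action_gen bact_Ghost)
qed

lemma relations_ann: "lpa_relations E \<subseteq> (ann bact :: (_ \<Rightarrow>\<^sub>0 'k::field) set)"
proof
  fix x :: "('v, 'e) lpa_gen word \<Rightarrow>\<^sub>0 'k"
  assume "x \<in> lpa_relations E"
  then have "action bact x f z = 0" for f :: "'z \<Rightarrow> 'k" and z
  proof cases
    case (vertices v w)
    then show ?thesis
      using D_disjoint[of v w] by (auto simp: action_diff action_mult action_gen bact_Vertex)
  next
    case (source_edge e)
    have "z \<in> D (tail E e)" if "bact (Edge e) z = Some z'" for z'
      using that theta_in[of e] by (auto simp: bact_Edge_iff)
    then show ?thesis
      using source_edge by (cases "bact (Edge e) z") (auto simp: action_diff action_mult action_gen bact_Vertex)
  next
    case (edge_range e)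
    have "z' \<in> D (head E e)" if "bact (Edge e) z = Some z'" for z'
      using that by (auto simp: bact_Edge_iff)
    then show ?thesis
      using edge_range by (cases "bact (Edge e) z") (auto simp: action_diff action_mult action_gen bact_Vertex)
  next
    case (range_ghost e)
    then show ?thesis
      by (auto simp: action_diff action_mult action_gen bact_Vertex bact_Ghost)
  next
    case (ghost_source e)
    then show ?thesis
      using theta_in[of e] by (auto simp: action_diff action_mult action_gen bact_Vertex bact_Ghost)
  next
    case (CK1 e e')
    show ?thesis
    proof (cases "z \<in> D (head E e)")
      case True
      have "bact (Edge e') (\<theta> e z) = (if e = e' then Some z else None)"
        using True CK1 theta_disjoint[of e e'] by (auto simp: bact_Edge_iff bact_Edge_None)
      then show ?thesis
        using True CK1 by (auto simp: action_diff action_mult action_gen bact_Vertex bact_Ghost)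
    next
      case False
      then show ?thesis
        using CK1 by (auto simp: action_diff action_mult action_gen bact_Vertex bact_Ghost)
    qed
  next
    case (CK2 v)
    have v: "v \<in> verts E" "finite (out_arcs E v)"
      using CK2(2) by (auto simp: regular_vertex_def infinite_emitter_def)
    have s: "action bact (\<Sum>e\<in>out_arcs E v. ed e * gh e) f z
        = (\<Sum>e\<in>out_arcs E v. if z \<in> \<theta> e ` D (head E e) then f z else 0)"
      unfolding action_sum by (rule sum.cong) (simp_all add: action_ed_gh)
    have "(\<Sum>e\<in>out_arcs E v. if z \<in> \<theta> e ` D (head E e) then f z else 0) = (if z \<in> D v then f z else 0)"
    proof (cases "z \<in> D v")
      case True
      then obtain e where e: "e \<in> out_arcs E v" "z \<in> \<theta> e ` D (head E e)"
        using cover[OF CK2(2)] by blast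
      have "z \<in> \<theta> e' ` D (head E e') \<longleftrightarrow> e' = e" if "e' \<in> out_arcs E v" for e'
        using theta_disjoint[of e e'] e that by auto
      then have "(\<Sum>e'\<in>out_arcs E v. if z \<in> \<theta> e' ` D (head E e') then f z else 0)
          = (\<Sum>e'\<in>out_arcs E v. if e' = e then f z else 0)"
        by (intro sum.cong) auto
      then show ?thesis
        using True e(1) v(2) by simp
    next
      case False
      have "z \<notin> \<theta> e ` D (head E e)" if "e \<in> out_arcs E v" for e
        using that False theta_in[of e] by auto
      then show ?thesis
        using False by simp
    qed
    then show ?thesis
      unfolding CK2(1) action_diff s using v by (simp add: action_gen bact_Vertex)
  qed
  then show "x \<in> ann bact"
    by (simp add: ann_def)
qed

lemma ann_good: "lpa_good E (ann bact)"
  using ring_ideal_ann relations_ann by (auto simp: lpa_good_def ann_def action_gen bact_bad)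

lemma vx_ann_iff: "v \<in> verts E \<Longrightarrow> vx v \<in> (ann bact :: (_ \<Rightarrow>\<^sub>0 'k::field) set) \<longleftrightarrow> D v = {}"
proof
  assume v: "v \<in> verts E" and *: "vx v \<in> (ann bact :: (_ \<Rightarrow>\<^sub>0 'k::field) set)"
  have "app (\<lambda>_. 1 :: 'k) (bact (Vertex v) z) = 0" for z
    using * by (auto simp: ann_def action_gen)
  then have "z \<notin> D v" for z
    using v by (metis app_simps(2) bact_Vertex one_neq_zero)
  then show "D v = {}"
    by blast
qed (auto simp: ann_def action_gen bact_Vertex)

end

text \<open>
  Cuntz-Krieger relations need a bijection between \<open>D v\<close> and the disjoint union of the sets \<open>D (head e)\<close>
  at a regular vertex, and only an injection at an infinite emitter. Each \<open>D v\<close> is a copy of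
  \<open>nat \<times> 'e list\<close>: the first factor absorbs finitely many copies, the second one arbitrarily many.
\<close>

lemma exists_ideal_killing:
  fixes E :: "('v, 'e) pre_digraph"
  assumes wf: "wf_digraph E" and X: "hereditary E X" "saturated E X"
  obtains J :: "(('v, 'e) lpa_gen word \<Rightarrow>\<^sub>0 'k::field) set"
  where "lpa_good E J" "\<And>v. v \<in> verts E \<Longrightarrow> vx v \<in> J \<longleftrightarrow> v \<in> X"
    "\<And>v F. infinite_emitter E v \<Longrightarrow> v \<notin> X \<Longrightarrow> F \<subseteq> out_arcs E v \<Longrightarrow>
       vx v - (\<Sum>e\<in>F. ed e * gh e) \<notin> J"
proof -
  interpret wf_digraph E by fact
  define O' where "O' v = {e \<in> out_arcs E v. head E e \<notin> X}" for v
  have finO: "finite (O' v)" if "regular_vertex E v" for v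
    by (rule finite_subset[of _ "out_arcs E v"])
      (use that in \<open>auto simp: O'_def regular_vertex_def infinite_emitter_def\<close>)
  define num where "num v = (SOME f. bij_betw f (O' v) {0..<card (O' v)})" for v
  have num: "bij_betw (num v) (O' v) {0..<card (O' v)}" if "regular_vertex E v" for v
    unfolding num_def using ex_bij_betw_finite_nat[OF finO[OF that]] by (rule someI_ex)
  define D :: "'v \<Rightarrow> ('v \<times> nat \<times> 'e list) set" where
    "D v = (if v \<in> verts E - X then {v} \<times> UNIV \<times> UNIV else {})" for v
  \<comment> \<open>At a regular vertex this is division with remainder by the number of edges
    leading outside \<open>X\<close>: the quotient is the old number, the remainder names the edge.
    At other vertices the edge is pushed onto the list, so no edge reaches a point with empty
    list.\<close>
  define \<theta> :: "'e \<Rightarrow> 'v \<times> nat \<times> 'e list \<Rightarrow> 'v \<times> nat \<times> 'e list" where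
    "\<theta> e = (\<lambda>(u, n, l). if regular_vertex E (tail E e)
       then (tail E e, n * card (O' (tail E e)) + num (tail E e) e, l) else (tail E e, n, e # l))" for e
  have hd: "tail E e \<notin> X" "e \<in> O' (tail E e)" "head E e \<notin> X" if "e \<in> arcs E" "z \<in> D (head E e)" for e z
    using that hereditary_arc[OF wf X(1)] by (auto simp: D_def O'_def split: if_splits)
  have nl: "num (tail E e) e < card (O' (tail E e))"
    if "e \<in> arcs E" "z \<in> D (head E e)" "regular_vertex E (tail E e)" for e z
    using num[OF that(3)] hd[OF that(1,2)] by (auto simp: bij_betw_def)
  have dm: "m = n \<and> i = j" if "m * c + i = n * c + j" "i < c" "j < c" for m n i j c :: nat
  proof -
    have "(m * c + i) div c = m" "(m * c + i) mod c = i" "(n * c + j) div c = n" "(n * c + j) mod c = j"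
      using that(2,3) by auto
    then show ?thesis
      using that(1) by metis
  qed
  interpret B: branching E D \<theta>
  proof
    show "\<theta> e z \<in> D (tail E e)" if "e \<in> arcs E" "z \<in> D (head E e)" for e z
      using that hd[OF that] by (auto simp: D_def \<theta>_def split: if_splits)
    show "inj_on (\<theta> e) (D (head E e))" if "e \<in> arcs E" for e
    proof (rule inj_onI)
      fix z z' assume z: "z \<in> D (head E e)" "z' \<in> D (head E e)" "\<theta> e z = \<theta> e z'"
      obtain u n l u' n' l' where [simp]: "z = (u, n, l)" "z' = (u', n', l')"
        by (cases z, cases z')
      have "u = u'"
        using z(1,2) by (auto simp: D_def split: if_splits)
      moreover have "n = n' \<and> l = l'"
      proof (cases "regular_vertex E (tail E e)")
        case True
        then show ?thesis
          using z(3) dm[OF _ nl[OF that z(1) True] nl[OF that z(1) True], of n n'] by (simp add: \<theta>_def)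
      next
        case False
        then show ?thesis
          using z(3) by (simp add: \<theta>_def)
      qed
      ultimately show "z = z'"
        by simp
    qed
    show "\<theta> e z \<noteq> \<theta> e' z'" if e: "e \<in> arcs E" "e' \<in> arcs E" "e \<noteq> e'"
      and z: "z \<in> D (head E e)" "z' \<in> D (head E e')" for e e' z z'
    proof
      assume *: "\<theta> e z = \<theta> e' z'"
      then have t: "tail E e = tail E e'"
        by (auto simp: \<theta>_def split: if_splits prod.splits)
      show False
      proof (cases "regular_vertex E (tail E e)")
        case True
        then have "num (tail E e) e = num (tail E e) e'"
          using * dm[OF _ nl[OF e(1) z(1)] nl[OF e(2) z(2), folded t]] t
          by (auto simp: \<theta>_def split: prod.splits)
        moreover have "inj_on (num (tail E e)) (O' (tail E e))"
          using num[OF True] by (auto simp: bij_betw_def)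
        ultimately show False
          using hd(2)[OF e(1) z(1)] hd(2)[OF e(2) z(2)] t e(3) by (auto simp: inj_on_def)
      next
        case False
        then show False
          using * t e(3) by (auto simp: \<theta>_def split: prod.splits)
      qed
    qed
    show "D v \<inter> D w = {}" if "v \<noteq> w" for v w
      using that by (auto simp: D_def)
    show "\<exists>e\<in>out_arcs E v. z \<in> \<theta> e ` D (head E e)" if v: "regular_vertex E v" and z: "z \<in> D v" for v z
    proof -
      have vX: "v \<notin> X"
        using z by (auto simp: D_def split: if_splits)
      obtain n l where [simp]: "z = (v, n, l)"
        using z by (auto simp: D_def split: if_splits)
      \<comment> \<open>Saturation: a regular vertex outside \<open>X\<close> emits an edge ending
        outside \<open>X\<close>, so the divisor is positive.\<close>
      have "O' v \<noteq> {}"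
        using X(2) v vX by (auto simp: saturated_def O'_def)
      then have c: "card (O' v) > 0"
        using finO[OF v] by (simp add: card_gt_0_iff)
      then have "n mod card (O' v) \<in> num v ` O' v"
        using num[OF v] by (auto simp: bij_betw_def)
      then obtain e where e: "e \<in> O' v" "num v e = n mod card (O' v)"
        by auto
      then have "e \<in> out_arcs E v" "(head E e, n div card (O' v), l) \<in> D (head E e)"
        by (auto simp: O'_def D_def)
      moreover have "z = \<theta> e (head E e, n div card (O' v), l)"
        using e v by (auto simp: \<theta>_def O'_def)
      ultimately show ?thesis
        by blast
    qed
  qed
  show thesis
  proof (rule that)
    show "lpa_good E (ann B.bact :: (_ \<Rightarrow>\<^sub>0 'k) set)"
      by (rule B.ann_good)
    show "vx v \<in> (ann B.bact :: (_ \<Rightarrow>\<^sub>0 'k) set) \<longleftrightarrow> v \<in> X" if "v \<in> verts E" for v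
      using that X(1) by (auto simp: B.vx_ann_iff D_def hereditary_def)
    show "vx v - (\<Sum>e\<in>F. ed e * gh e) \<notin> (ann B.bact :: (_ \<Rightarrow>\<^sub>0 'k) set)"
      if v: "infinite_emitter E v" "v \<notin> X" and F: "F \<subseteq> out_arcs E v" for v F
    proof
      assume *: "vx v - (\<Sum>e\<in>F. ed e * gh e) \<in> (ann B.bact :: (_ \<Rightarrow>\<^sub>0 'k) set)"
      \<comment> \<open>The point with empty list lies in no image \<open>\<theta> e\<close>, so the
        sum acts as 0 on it and \<open>vx v\<close> as the identity.\<close>
      let ?z = "(v, 0, []) :: 'v \<times> nat \<times> 'e list" and ?f = "\<lambda>_. 1 :: 'k"
      have "?z \<notin> \<theta> e ` D (head E e)" if "e \<in> F" for e
        using that F v by (auto simp: \<theta>_def regular_vertex_def)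
      then have "action B.bact (\<Sum>e\<in>F. ed e * gh e) ?f ?z = 0"
        using F unfolding action_sum by (intro sum.neutral) (auto simp: B.action_ed_gh)
      moreover have "action B.bact (vx v) ?f ?z = 1"
        using v by (auto simp: action_gen B.bact_def D_def infinite_emitter_def)
      ultimately show False
        using * by (auto simp: ann_def action_diff)
    qed
  qed
qed

text \<open>
  If \<open>c\<close> is the only closed simple path at \<open>w\<close>, a point of \<open>D u\<close> is an infinite path from \<open>u\<close> ending in
  \<open>c c c \<dots>\<close> together with an integer lag: it is coded by its initial part before the first visit of \<open>w\<close>.
\<close>

lemma exists_commutative_ideal:
  fixes E :: "('v, 'e) pre_digraph"
  assumes wf: "wf_digraph E" and c: "CSP E w = {c}"
  obtains J :: "(('v, 'e) lpa_gen word \<Rightarrow>\<^sub>0 'k::field) set"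
  where "lpa_good E J" "\<And>v. v \<in> verts E \<Longrightarrow> vx v \<in> J \<longleftrightarrow> \<not> connects E v w"
    "\<And>x y. (vx w * x * vx w) * (vx w * y * vx w) - (vx w * y * vx w) * (vx w * x * vx w) \<in> J"
    "\<And>k G \<kappa>. k \<noteq> 0 \<Longrightarrow> [] \<notin> G \<Longrightarrow> cst k * vx w + (\<Sum>\<gamma>\<in>G. cst (\<kappa> \<gamma>) * (vx w * pth \<gamma> * vx w)) \<notin> J"
proof -
  interpret wf_digraph E by fact
  have c': "c \<noteq> []" "awalk w c w" "\<forall>e\<in>set (tl c). tail E e \<noteq> w"
    using c by (auto simp: CSP_def)
  have w: "w \<in> verts E"
    using c'(2) by blast
  define D :: "'v \<Rightarrow> ('e list \<times> int) set" where
    "D u = {(p, n). awalk u p w \<and> (\<forall>e\<in>set p. tail E e \<noteq> w)}" for u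
  \<comment> \<open>Prepending an edge at \<open>w\<close> completes one turn of \<open>c\<close>:
    the code of the initial part becomes empty and the lag grows by one.\<close>
  define \<theta> :: "'e \<Rightarrow> 'e list \<times> int \<Rightarrow> 'e list \<times> int" where
    "\<theta> e = (\<lambda>(p, n). if tail E e = w then ([], n + 1) else (e # p, n))" for e
  have Dw: "D w = {z. fst z = []}"
  proof -
    have "p = []" if "awalk w p w" "\<forall>e\<in>set p. tail E e \<noteq> w" for p
      using that by (cases p) (auto simp: awalk_Cons_iff)
    then show ?thesis
      using w by (auto simp: D_def awalk_Nil_iff)
  qed
  \<comment> \<open>Uniqueness of \<open>c\<close> ensures that \<open>\<theta>\<close> loses
    nothing when it discards \<open>e # p\<close>: edge and code can be read off from
    \<open>c\<close>.\<close>
  have first: "e # p = c" if "e \<in> arcs E" "tail E e = w" "(p, n) \<in> D (head E e)" for e p n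
  proof -
    have "e # p \<in> CSP E w"
      using that by (auto simp: CSP_def D_def awalk_Cons_iff)
    then show ?thesis
      using c by simp
  qed
  interpret B: branching E D \<theta>
  proof
    show "\<theta> e z \<in> D (tail E e)" if "e \<in> arcs E" "z \<in> D (head E e)" for e z
    proof (cases "tail E e = w")
      case True
      then show ?thesis
        by (auto simp: Dw \<theta>_def split: prod.split)
    next
      case False
      then show ?thesis
        using that by (auto simp: D_def \<theta>_def awalk_Cons_iff)
    qed
    show "inj_on (\<theta> e) (D (head E e))" if "e \<in> arcs E" for e
    proof (rule inj_onI)
      fix z z' assume z: "z \<in> D (head E e)" "z' \<in> D (head E e)" "\<theta> e z = \<theta> e z'"
      obtain p n p' n' where [simp]: "z = (p, n)" "z' = (p', n')"
        by (cases z, cases z')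
      show "z = z'"
        using z first[OF that, of p n] first[OF that, of p' n'] by (auto simp: \<theta>_def split: if_splits)
    qed
    show "\<theta> e z \<noteq> \<theta> e' z'" if e: "e \<in> arcs E" "e' \<in> arcs E" "e \<noteq> e'"
      and z: "z \<in> D (head E e)" "z' \<in> D (head E e')" for e e' z z'
    proof -
      obtain p n p' n' where [simp]: "z = (p, n)" "z' = (p', n')"
        by (cases z, cases z')
      show ?thesis
        using z first[OF e(1), of p n] first[OF e(2), of p' n'] e(3) by (auto simp: \<theta>_def)
    qed
    show "D u \<inter> D v = {}" if "u \<noteq> v" for u v
    proof -
      have "u = v" if "awalk u p w" "awalk v p w" for p
        using that by (cases p) (auto simp: awalk_Nil_iff awalk_Cons_iff)
      then show ?thesis
        using that by (auto simp: D_def)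
    qed
    show "\<exists>e\<in>out_arcs E v. z \<in> \<theta> e ` D (head E e)" if "regular_vertex E v" and z: "z \<in> D v" for v z
    proof -
      obtain p n where [simp]: "z = (p, n)"
        by (cases z)
      show ?thesis
      proof (cases p)
        case Nil
        then have v: "v = w"
          using z by (auto simp: D_def awalk_Nil_iff)
        obtain e p' where "c = e # p'"
          using c'(1) by (cases c) auto
        then have "e \<in> out_arcs E v" "(p', n - 1) \<in> D (head E e)" "z = \<theta> e (p', n - 1)"
          using c' v Nil by (auto simp: D_def \<theta>_def awalk_Cons_iff)
        then show ?thesis by blast
      next
        case (Cons e p')
        then have "e \<in> out_arcs E v" "(p', n) \<in> D (head E e)" "z = \<theta> e (p', n)"
          using z by (auto simp: D_def \<theta>_def awalk_Cons_iff)
        then show ?thesis by blast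
      qed
    qed
  qed
  let ?act = B.bact
  \<comment> \<open>All letters commute with shifts of the lag. Hence a word taking
    \<open>([], 0)\<close> to \<open>([], d)\<close> takes every \<open>([], n)\<close> to
    \<open>([], n + d)\<close>, and the corner at \<open>w\<close> acts by Laurent polynomials in
    one shift. This is why it is commutative.\<close>
  define sh :: "int \<Rightarrow> 'e list \<times> int \<Rightarrow> 'e list \<times> int" where "sh m = (\<lambda>(p, n). (p, n + m))" for m
  have shD: "sh m z \<in> D u \<longleftrightarrow> z \<in> D u" for m z u
    by (cases z) (simp add: sh_def D_def)
  have sh\<theta>: "\<theta> e (sh m z) = sh m (\<theta> e z)" for e m z
    by (cases z) (simp add: sh_def \<theta>_def)
  have sh0: "sh m (sh (- m) z) = z" for m z
    by (cases z) (simp add: sh_def)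
  have sh_act: "?act g (sh m z) = map_option (sh m) (?act g z)" for g m z
  proof (cases g)
    case (Edge e)
    show ?thesis
    proof (cases "?act (Edge e) z")
      case None
      have "?act (Edge e) (sh m z) = None"
      proof (rule ccontr)
        assume "?act (Edge e) (sh m z) \<noteq> None"
        then obtain z' where "e \<in> arcs E" "z' \<in> D (head E e)" "sh m z = \<theta> e z'"
          by (auto simp: B.bact_Edge_iff)
        moreover from this(3) have "z = \<theta> e (sh (- m) z')"
          by (metis sh0 sh\<theta> minus_minus)
        ultimately show False
          using None shD[of "- m" z' "head E e"] by (auto simp: B.bact_Edge_None)
      qed
      then show ?thesis
        using None Edge by simp
    next
      case (Some z')
      then have "?act (Edge e) (sh m z) = Some (sh m z')"
        using shD sh\<theta> by (auto simp: B.bact_Edge_iff)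
      then show ?thesis
        using Some Edge by simp
    qed
  qed (auto simp: B.bact_def shD sh\<theta>)
  have sh_word: "word_act ?act gs (sh m z) = map_option (sh m) (word_act ?act gs z)" for gs m z
  proof (induction gs arbitrary: z)
    case (Cons g gs)
    then show ?case
      by (cases "?act g z") (simp_all add: sh_act)
  qed simp
  define \<delta> where "\<delta> a = (case word_act ?act (letters a) ([], 0) of
     Some (p, d) \<Rightarrow> if p = [] then Some d else None | None \<Rightarrow> None)" for a
  have corner: "action ?act (vx w * x * vx w) f ([], n) =
      (\<Sum>a\<in>Poly_Mapping.keys x. Poly_Mapping.lookup x a *
         (case \<delta> a of None \<Rightarrow> 0 | Some d \<Rightarrow> f ([], n + d)))" for x and f :: "'e list \<times> int \<Rightarrow> 'k" and n
  proof -
    have "app (action ?act (vx w) f) (word_act ?act (letters a) ([], n))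
        = (case \<delta> a of None \<Rightarrow> 0 | Some d \<Rightarrow> f ([], n + d))" for a
    proof -
      have "word_act ?act (letters a) ([], n) = map_option (sh n) (word_act ?act (letters a) ([], 0))"
        using sh_word[of "letters a" n "([], 0)"] by (simp add: sh_def)
      then show ?thesis
        using w by (auto simp: \<delta>_def sh_def action_gen B.bact_Vertex Dw add.commute split: option.split)
    qed
    then show ?thesis
      using w by (simp add: action_mult action_gen B.bact_Vertex Dw action_def[of ?act x])
  qed
  have zero: "action ?act (vx w * x * vx w) f z = 0" if "z \<notin> D w" for x and f :: "'e list \<times> int \<Rightarrow> 'k" and z
    using that w by (simp add: action_mult action_gen B.bact_Vertex)
  have swap: "action ?act ((vx w * x * vx w) * (vx w * y * vx w)) f ([], n)
      = action ?act ((vx w * y * vx w) * (vx w * x * vx w)) f ([], n)"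
    for x y and f :: "'e list \<times> int \<Rightarrow> 'k" and n
  proof -
    have 1: "action ?act ((vx w * x * vx w) * (vx w * y * vx w)) f ([], n) =
        (\<Sum>a\<in>Poly_Mapping.keys x. \<Sum>b\<in>Poly_Mapping.keys y.
          Poly_Mapping.lookup x a * Poly_Mapping.lookup y b *
          (case \<delta> a of None \<Rightarrow> 0 | Some d \<Rightarrow> case \<delta> b of None \<Rightarrow> 0 | Some d' \<Rightarrow> f ([], n + d + d')))" for x y
      unfolding action_mult[of _ "_ * _ * _" "_ * _ * _"] corner
      by (auto intro!: sum.cong simp: sum_distrib_left mult.assoc split: option.split)
    show ?thesis
      unfolding 1 sum.swap[of _ "Poly_Mapping.keys y"]
      by (intro sum.cong refl) (auto simp: ac_simps split: option.split)
  qed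
  \<comment> \<open>An edge undoes \<open>\<theta>\<close>, and leaving \<open>w\<close> costs one
    turn. A nonempty path from \<open>w\<close> to \<open>w\<close> thus strictly lowers the lag, so
    it contributes nothing at lag 0, where only the constant term remains.\<close>
  have edge: "m' \<le> m" "p = [] \<Longrightarrow> m' < m" if "?act (Edge e) (p, m) = Some (p', m')" for e p m p' m'
    using that by (auto simp: B.bact_Edge_iff \<theta>_def split: if_splits)
  have word_le: "m' \<le> m" if "word_act ?act (map Edge \<gamma>) (p, m) = Some (p', m')" for \<gamma> p m p' m'
    using that
  proof (induction \<gamma> arbitrary: p m)
    case (Cons e \<gamma>)
    then obtain p1 m1 where "?act (Edge e) (p, m) = Some (p1, m1)"
      "word_act ?act (map Edge \<gamma>) (p1, m1) = Some (p', m')"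
      by (auto split: bind_splits)
    then show ?case
      using edge(1) Cons.IH order_trans by blast
  qed simp
  have closed: "action ?act (vx w * pth \<gamma> * vx w) (\<lambda>z. if z = ([], 0) then 1 else 0 :: 'k) ([], 0) = 0"
    if nonempty: "\<gamma> \<noteq> []" for \<gamma>
  proof -
    have p: "pth \<gamma> = Poly_Mapping.single (Word (map Edge \<gamma>)) (1 :: 'k)"
      by (simp add: single_Word pth_def o_def)
    have "word_act ?act (map Edge \<gamma>) ([], 0) \<noteq> Some ([], 0)"
    proof
      assume *: "word_act ?act (map Edge \<gamma>) ([], 0) = Some ([], 0)"
      obtain e \<gamma>' where "\<gamma> = e # \<gamma>'"
        using nonempty by (cases \<gamma>) auto
      then obtain p1 m1 where "?act (Edge e) ([], 0) = Some (p1, m1)"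
        "word_act ?act (map Edge \<gamma>') (p1, m1) = Some ([], 0)"
        using * by (auto split: bind_splits)
      then show False
        using edge(2) word_le by fastforce
    qed
    then show ?thesis
      using w by (auto simp: corner p \<delta>_def split: option.split)
  qed
  show thesis
  proof (rule that)
    show "lpa_good E (ann ?act :: (_ \<Rightarrow>\<^sub>0 'k) set)"
      by (rule B.ann_good)
    show "vx v \<in> (ann ?act :: (_ \<Rightarrow>\<^sub>0 'k) set) \<longleftrightarrow> \<not> connects E v w" if v: "v \<in> verts E" for v
    proof -
      \<comment> \<open>A path to \<open>w\<close>, cut at its first visit of \<open>w\<close>, is a
        code, so \<open>D v\<close> is nonempty.\<close>
      have "\<exists>q. awalk v q w \<and> (\<forall>e\<in>set q. tail E e \<noteq> w)" if "awalk v p w" for p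
        using that
      proof (induction p arbitrary: v)
        case (Cons e p)
        then obtain q where q: "awalk (head E e) q w" "\<forall>e\<in>set q. tail E e \<noteq> w"
          by (auto simp: awalk_Cons_iff)
        show ?case
        proof (cases "v = w")
          case True
          then show ?thesis
            using w by (intro exI[of _ "[]"]) (simp add: awalk_Nil_iff)
        next
          case False
          then show ?thesis
            using q Cons.prems by (intro exI[of _ "e # q"]) (auto simp: awalk_Cons_iff)
        qed
      qed (auto intro!: exI[of _ "[]"])
      then have "D v = {} \<longleftrightarrow> \<not> connects E v w"
        unfolding D_def connects_def by blast
      then show ?thesis
        using v by (simp add: B.vx_ann_iff)
    qed
    show "(vx w * x * vx w) * (vx w * y * vx w) - (vx w * y * vx w) * (vx w * x * vx w) \<in> (ann ?act :: (_ \<Rightarrow>\<^sub>0 'k) set)"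
      for x y
    proof -
      have "action ?act ((vx w * x * vx w) * (vx w * y * vx w)) f z
          = action ?act ((vx w * y * vx w) * (vx w * x * vx w)) f z" for f :: "'e list \<times> int \<Rightarrow> 'k" and z
      proof (cases "z \<in> D w")
        case True
        then obtain n where "z = ([], n)"
          by (cases z) (auto simp: Dw)
        then show ?thesis
          using swap by simp
      next
        case False
        then show ?thesis
          by (simp add: action_mult[of _ "_ * _ * _" "_ * _ * _"] zero)
      qed
      then show ?thesis
        by (simp add: ann_def action_diff)
    qed
    show "cst k * vx w + (\<Sum>\<gamma>\<in>G. cst (\<kappa> \<gamma>) * (vx w * pth \<gamma> * vx w)) \<notin> (ann ?act :: (_ \<Rightarrow>\<^sub>0 'k) set)"
      if "k \<noteq> 0" "[] \<notin> G" for k G \<kappa>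
    proof
      let ?f = "\<lambda>z. if z = ([], 0) then 1 else 0 :: 'k"
      assume "cst k * vx w + (\<Sum>\<gamma>\<in>G. cst (\<kappa> \<gamma>) * (vx w * pth \<gamma> * vx w)) \<in> (ann ?act :: (_ \<Rightarrow>\<^sub>0 'k) set)"
      then have "action ?act (cst k * vx w + (\<Sum>\<gamma>\<in>G. cst (\<kappa> \<gamma>) * (vx w * pth \<gamma> * vx w))) ?f ([], 0) = 0"
        by (auto simp: ann_def)
      moreover have "(\<Sum>\<gamma>\<in>G. action ?act (cst (\<kappa> \<gamma>) * (vx w * pth \<gamma> * vx w)) ?f ([], 0)) = 0"
      proof (intro sum.neutral ballI)
        fix \<gamma> assume "\<gamma> \<in> G"
        then have "\<gamma> \<noteq> []"
          using that(2) by auto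
        then show "action ?act (cst (\<kappa> \<gamma>) * (vx w * pth \<gamma> * vx w)) ?f ([], 0) = 0"
          using closed by (simp add: action_cst_mult)
      qed
      ultimately show False
        using that(1) w by (simp add: action_add action_sum action_cst_mult action_gen B.bact_Vertex Dw)
    qed
  qed
qed

section \<open>Reduction of elements to vertices\<close>

context wf_digraph
begin

text \<open>Cutting a closed path at an intermediate visit of \<open>u\<close> leaves a shorter
  nonempty closed path.\<close>

lemma closed_walk_CSP:
  assumes "awalk u p u" "p \<noteq> []"
  shows "CSP G u \<noteq> {}"
  using assms
proof (induction "length p" arbitrary: p rule: less_induct)
  case less
  show ?case
  proof (cases "\<exists>e\<in>set (tl p). tail G e = u")
    case False
    then have "p \<in> CSP G u"
      using less.prems by (auto simp: CSP_def)
    then show ?thesis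
      by blast
  next
    case True
    obtain e0 p' where p: "p = e0 # p'"
      using less.prems(2) by (cases p) auto
    obtain e a b where "p' = a @ e # b" "tail G e = u"
      using True p split_list by (metis list.sel(3))
    then have "awalk u (e0 # a) u" "length (e0 # a) < length p"
      using less.prems(1) p by (auto simp: awalk_append_iff awalk_Cons_iff)
    then show ?thesis
      using less.hyps by blast
  qed
qed

text \<open>Along repeated turns of \<open>a\<close> the vertex \<open>u\<close> is met only between
  two turns, because \<open>a\<close> avoids it in its interior.\<close>

lemma closed_prefix_power:
  assumes "a \<in> CSP G u"
  shows "awalk u p u \<Longrightarrow> prefix p (concat (replicate N a)) \<Longrightarrow> \<exists>j. p = concat (replicate j a)"
proof (induction N arbitrary: p)
  case 0
  then show ?case
    by (auto intro!: exI[of _ 0])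
next
  case (Suc N)
  have a: "awalk u a u"
    using assms by (auto simp: CSP_def)
  consider s where "p @ s = a" | p' where "p = a @ p'" "prefix p' (concat (replicate N a))"
  proof -
    have "prefix p a \<or> (\<exists>p'. p = a @ p' \<and> prefix p' (concat (replicate N a)))"
      using Suc.prems(2) by (simp add: prefix_append)
    then show thesis
      using that by (metis prefixE)
  qed
  then show ?case
  proof cases
    case (1 s)
    consider "s = []" | "p = []" | e s' where "s = e # s'" "p \<noteq> []"
      by (cases s) auto
    then show ?thesis
    proof cases
      case 3
      then have "tail G e = u" "e \<in> set (tl a)"
        using 1 Suc.prems(1) a by (auto simp: awalk_append_iff awalk_Cons_iff dest: awalk_ends)
      then show ?thesis
        using assms by (auto simp: CSP_def)
    qed (use 1 in \<open>auto intro: exI[of _ 0] exI[of _ 1]\<close>)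
  next
    case (2 p')
    then have "awalk u p' u"
      using Suc.prems(1) a by (auto simp: awalk_append_iff dest: awalk_ends)
    then obtain j where "p' = concat (replicate j a)"
      using Suc.IH 2(2) by blast
    then show ?thesis
      using 2(1) by (intro exI[of _ "Suc j"]) simp
  qed
qed

text \<open>Otherwise \<open>p\<close>, not longer than the \<open>N\<close> turns of
  \<open>a\<close>, would be a prefix of them and hence a power of \<open>a\<close>. Cancelling the
  turns leaves a path that begins both with \<open>a\<close> and with \<open>b\<close>, against
  \<open>CSP_prefix\<close>.\<close>

lemma exit_path_not_prefix:
  assumes "a \<in> CSP G u" "b \<in> CSP G u" "a \<noteq> b" "awalk u p u" "p \<noteq> []" "length p \<le> N"
    "\<tau> = concat (replicate N a) @ b"
  shows "p @ \<tau> \<noteq> \<tau> @ t"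
proof
  assume *: "p @ \<tau> = \<tau> @ t"
  have "length a \<ge> 1"
    using assms(1) by (cases a) (auto simp: CSP_def)
  then have "N \<le> length (concat (replicate N a))"
    by (simp add: length_concat sum_list_replicate)
  then have "prefix p (concat (replicate N a))"
    using * assms(6,7) by (metis append.assoc le_trans prefixI prefix_length_prefix)
  then obtain j where j: "p = concat (replicate j a)"
    using closed_prefix_power[OF assms(1,4)] by blast
  then obtain j' where j': "j = Suc j'"
    using assms(5) by (cases j) auto
  have "concat (replicate j a) @ concat (replicate N a) = concat (replicate N a) @ concat (replicate j a)"
    by (simp add: replicate_add[symmetric] add.commute flip: concat_append)
  then have "concat (replicate j a) @ b = b @ t"
    using * assms(7) j by (metis append.assoc same_append_eq)
  then have "a @ (concat (replicate j' a) @ b) = b @ t"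
    using j' by simp
  then show False
    using CSP_prefix[OF wf_digraph_axioms assms(1,2)] assms(3) by blast
qed

lemma closed_power_walk: "awalk u a u \<Longrightarrow> awalk u (concat (replicate N a)) u"
  by (induction N) (auto simp: awalk_append_iff awalk_Nil_iff dest: awalk_ends)

end

section \<open>Normal forms modulo an ideal\<close>

context lpa_cong
begin

definition esc :: "'v \<Rightarrow> 'e set" where
  "esc u = {e \<in> out_arcs E u. head E e \<notin> killed}"

text \<open>For an infinite emitter with finite nonempty \<open>esc u\<close> this is the standard
  element attached to a breaking vertex of the hereditary saturated set \<open>killed\<close>. At a
  regular vertex it lies in \<open>J\<close> by the second Cuntz-Krieger relation.\<close>

definition hat :: "'v \<Rightarrow> ('v, 'e) lpa_gen word \<Rightarrow>\<^sub>0 'k" where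
  "hat u = vx u - (\<Sum>e\<in>esc u. ed e * gh e)"

context
  fixes u assumes u: "u \<in> verts E" and fin: "finite (esc u)"
begin

lemma hat_ed:
  assumes e: "e \<in> arcs E"
  shows "hat u * ed e \<approx> 0"
proof -
  have "hat u * ed e = vx u * ed e - (\<Sum>f\<in>esc u. ed f * (gh f * ed e))"
    by (simp add: hat_def left_diff_distrib sum_distrib_right mult.assoc)
  also have "\<dots> \<approx> vx u * ed e - (\<Sum>f\<in>esc u. ed f * (if f = e then vx (head E f) else 0))"
    using e by (intro cong_diff cong_sum cong_mult cong_refl gh_ed) (auto simp: esc_def)
  also have "(\<Sum>f\<in>esc u. ed f * (if f = e then vx (head E f) else 0))
      = (if e \<in> esc u then ed e * vx (head E e) else 0)"
    using fin by (simp add: if_distrib[of "(*) _"] sum.delta cong: if_cong)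
  also have "vx u * ed e - (if e \<in> esc u then ed e * vx (head E e) else 0) \<approx> 0"
  proof (cases "e \<in> esc u")
    case True
    then show ?thesis
      using cong_diff[OF absorb(1)[OF e] absorb(2)[OF e]] by (simp add: esc_def)
  next
    case False
    then have "tail E e \<noteq> u \<or> ed e \<in> J"
      using e ed_killed by (auto simp: esc_def)
    then show ?thesis
      using False vx_ed[OF u e] by (auto simp: cong_zero_iff mult_mem_left)
  qed
  finally show ?thesis .
qed

lemma gh_hat:
  assumes e: "e \<in> arcs E"
  shows "gh e * hat u \<approx> 0"
proof -
  have "gh e * hat u = gh e * vx u - (\<Sum>f\<in>esc u. (gh e * ed f) * gh f)"
    by (simp add: hat_def right_diff_distrib sum_distrib_left mult.assoc)
  also have "\<dots> \<approx> gh e * vx u - (\<Sum>f\<in>esc u. (if e = f then vx (head E e) else 0) * gh f)"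
    using e by (intro cong_diff cong_sum cong_mult cong_refl gh_ed) (auto simp: esc_def)
  also have "(\<Sum>f\<in>esc u. (if e = f then vx (head E e) else 0) * gh f)
      = (\<Sum>f\<in>esc u. if e = f then vx (head E e) * gh f else 0)"
    by (rule sum.cong) auto
  also have "\<dots> = (if e \<in> esc u then vx (head E e) * gh e else 0)"
    using fin by (simp add: sum.delta')
  also have "gh e * vx u - (if e \<in> esc u then vx (head E e) * gh e else 0) \<approx> 0"
  proof (cases "e \<in> esc u")
    case True
    then show ?thesis
      using cong_diff[OF absorb(4)[OF e] absorb(3)[OF e]] by (simp add: esc_def)
  next
    case False
    then have "tail E e \<noteq> u \<or> gh e \<in> J"
      using e gh_killed by (auto simp: esc_def)
    then show ?thesis
      using False gh_vx[OF u e] by (auto simp: cong_zero_iff mult_mem_right)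
  qed
  finally show ?thesis .
qed

lemma hat_vx:
  assumes v: "v \<in> verts E"
  shows "hat u * vx v \<approx> (if v = u then hat u else 0)"
proof -
  have "hat u * vx v = vx u * vx v - (\<Sum>f\<in>esc u. ed f * (gh f * vx v))"
    by (simp add: hat_def left_diff_distrib sum_distrib_right mult.assoc)
  also have "\<dots> \<approx> (if u = v then vx u else 0) - (\<Sum>f\<in>esc u. ed f * (if v = tail E f then gh f else 0))"
    using v u by (intro cong_diff cong_sum cong_mult cong_refl vx_vx gh_vx) (auto simp: esc_def)
  also have "(\<Sum>f\<in>esc u. ed f * (if v = tail E f then gh f else 0))
      = (\<Sum>f\<in>esc u. if v = u then ed f * gh f else 0)"
    by (rule sum.cong) (auto simp: esc_def)
  also have "(if u = v then vx u else 0) - \<dots> = (if v = u then hat u else 0)"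
    by (auto simp: hat_def)
  finally show ?thesis .
qed

lemma hat_idem: "hat u * hat u \<approx> hat u"
proof -
  have "hat u * hat u = hat u * vx u - (\<Sum>e\<in>esc u. (hat u * ed e) * gh e)"
    by (subst (2) hat_def) (simp add: right_diff_distrib sum_distrib_left mult.assoc)
  also have "\<dots> \<approx> hat u - (\<Sum>e\<in>esc u. 0 * gh e)"
    using hat_vx[OF u] by (intro cong_diff cong_sum cong_mult cong_refl hat_ed) (auto simp: esc_def)
  finally show ?thesis by simp
qed

lemma vx_hat: "vx u * hat u \<approx> hat u"
proof -
  have "vx u * hat u = vx u * vx u - (\<Sum>f\<in>esc u. (vx u * ed f) * gh f)"
    by (simp add: hat_def right_diff_distrib sum_distrib_left mult.assoc)
  also have "\<dots> \<approx> vx u - (\<Sum>f\<in>esc u. ed f * gh f)"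
    using absorb(1) by (intro cong_diff cong_sum cong_mult cong_refl vx_idem u) (auto simp: esc_def)
  finally show ?thesis by (simp add: hat_def)
qed

lemma hat_mon_hat:
  assumes "i \<in> midx (verts E)"
  shows "hat u * mon i * hat u \<in> lspan (\<lambda>_::unit. hat u) UNIV"
proof -
  obtain w p q s t where i: "i = (w, p, q)" "w \<in> verts E" and "awalk s p w" "awalk t q w"
    using assms by (auto simp: midx_def)
  then have pq: "set p \<subseteq> arcs E" "set q \<subseteq> arcs E"
    by blast+
  show ?thesis
  proof (cases "p = [] \<and> q = []")
    case True
    have "hat u * mon i * hat u = (hat u * vx w) * hat u"
      using True by (simp add: i mon_def)
    also have "\<dots> \<approx> (if w = u then hat u else 0) * hat u"
      by (intro cong_mult cong_refl hat_vx i)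
    also have "\<dots> \<approx> (if w = u then hat u else 0)"
      using hat_idem by auto
    finally show ?thesis
      using lspan_baseI[of _ "\<lambda>_. hat u" "()" UNIV] lspan_zeroI by (cases "w = u") auto
  next
    case False
    have "hat u * mon i * hat u \<in> J"
    proof (cases p)
      case (Cons e p')
      then have "hat u * ed e \<in> J"
        using hat_ed pq by (simp add: cong_zero_iff)
      moreover have "hat u * mon i * hat u = (hat u * ed e) * (pth p' * vx w * gth q * hat u)"
        by (simp add: i mon_def Cons mult.assoc)
      ultimately show ?thesis
        using mult_mem_right by presburger
    next
      case Nil
      then obtain e q' where q: "q = e # q'"
        using False by (cases q) auto
      then have "gh e * hat u \<in> J"
        using gh_hat pq by (simp add: cong_zero_iff)
      moreover have "hat u * mon i * hat u = (hat u * pth p * vx w * gth q') * (gh e * hat u)"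
        by (simp add: i mon_def q mult.assoc)
      ultimately show ?thesis
        using mult_mem_left by presburger
    qed
    then show ?thesis
      by (rule lspan_zero)
  qed
qed

text \<open>\<open>hat u * ed e\<close> and \<open>gh e * hat u\<close> vanish for all edges, so
  between two copies of \<open>hat u\<close> only the monomial \<open>vx u\<close> survives: modulo
  \<open>J\<close> the corner has dimension at most one.\<close>

lemma hat_corner: "\<exists>k. hat u * a * hat u \<approx> cst k * hat u"
proof -
  let ?L = "lspan mon (midx (verts E))"
  interpret L: lpa_cong E ?L
    by (intro lpa_good_locale lspan_good wf_digraph_axioms) (auto simp: hereditary_def connects_def)
  have "vx u * a * vx u \<in> ?L"
    using vx_lspan[of u] u by (intro L.mult_mem_left) auto
  then have "hat u * (vx u * a * vx u) * hat u \<in> lspan (\<lambda>_::unit. hat u) UNIV"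
    by (rule lspan_mult) (rule hat_mon_hat)
  moreover have "hat u * a * hat u \<approx> (hat u * vx u) * a * (vx u * hat u)"
    using hat_vx[OF u] by (intro cong_mult cong_refl cong_sym[OF vx_hat] cong_sym[of "hat u * vx u"]) auto
  ultimately have "hat u * a * hat u \<in> lspan (\<lambda>_::unit. hat u) UNIV"
    by (auto intro: lspan_cong simp: mult.assoc)
  then obtain D k where "finite (D :: unit set)" "hat u * a * hat u \<approx> (\<Sum>i\<in>D. cst (k i) * hat u)"
    unfolding lspan_def by auto
  moreover have "(\<Sum>i\<in>D. cst (k i) * hat u) = cst (\<Sum>i\<in>D. k i) * hat u"
    using \<open>finite D\<close> by (induction D) (auto simp: cst_add distrib_right)
  ultimately show ?thesis
    by metis
qed

lemma hat_commutes: "hat u * a * hat u * b * hat u \<approx> hat u * b * hat u * a * hat u"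
proof -
  obtain k l where k: "hat u * a * hat u \<approx> cst k * hat u" and l: "hat u * b * hat u \<approx> cst l * hat u"
    using hat_corner by metis
  have "hat u * a * hat u * b * hat u \<approx> cst k * hat u * b * hat u"
    by (intro cong_mult k cong_refl)
  also have "\<dots> = cst k * (hat u * b * hat u)"
    by (simp add: mult.assoc)
  also have "\<dots> \<approx> cst k * (cst l * hat u)"
    by (intro cong_mult l cong_refl)
  also have "\<dots> = cst l * (cst k * hat u)"
    by (simp add: mult.commute flip: mult.assoc cst_mult)
  also have "\<dots> \<approx> cst l * (hat u * a * hat u)"
    by (intro cong_mult cong_sym[OF k] cong_refl)
  also have "\<dots> = cst l * hat u * a * hat u"
    by (simp add: mult.assoc)
  also have "\<dots> \<approx> hat u * b * hat u * a * hat u"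
    by (intro cong_mult cong_sym[OF l] cong_refl)
  finally show ?thesis .
qed

end

definition loops :: "'v \<Rightarrow> 'e list set" where
  "loops u = {p. p \<noteq> [] \<and> awalk u p u}"

abbreviation loop_el :: "'v \<Rightarrow> 'e list \<Rightarrow> ('v, 'e) lpa_gen word \<Rightarrow>\<^sub>0 'k" where
  "loop_el u p \<equiv> vx u * pth p * vx u"

text \<open>As \<open>loops u\<close> excludes the empty path, \<open>k\<close> plays the role of a
  constant term.\<close>

definition reduces :: "'v set \<Rightarrow> (('v, 'e) lpa_gen word \<Rightarrow>\<^sub>0 'k) \<Rightarrow> bool" where
  "reduces S x \<longleftrightarrow> (\<exists>c d u. u \<in> S \<and> u \<in> verts E \<and> vx u \<notin> J \<and>
     ((\<exists>k r. k \<noteq> 0 \<and> r \<in> lspan (loop_el u) (loops u) \<and> c * x * d \<approx> cst k * vx u + r) \<or>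
      (infinite_emitter E u \<and> finite (esc u) \<and> hat u \<notin> J \<and> c * x * d \<approx> hat u)))"

lemma reduces_mult: "reduces S (a * x * b) \<Longrightarrow> reduces S x"
proof -
  have "c * (a * x * b) * d = (c * a) * x * (b * d)" for c d
    by (simp add: mult.assoc)
  then show "reduces S (a * x * b) \<Longrightarrow> reduces S x"
    unfolding reduces_def by metis
qed

lemma reduces_mult_right: "reduces S (x * b) \<Longrightarrow> reduces S x"
  using reduces_mult[of S 1 x b] by simp

lemma reduces_cong: "x \<approx> y \<Longrightarrow> reduces S x \<Longrightarrow> reduces S y"
proof -
  assume "x \<approx> y"
  then have "c * y * d \<approx> z" if "c * x * d \<approx> z" for c d z
    using that by (meson cong_mult cong_refl cong_sym cong_trans)
  then show "reduces S x \<Longrightarrow> reduces S y"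
    unfolding reduces_def by metis
qed

text \<open>Multiply from the left by the ghost of a shortest path \<open>p1\<close> of the
  combination, prolonged by \<open>\<tau>\<close>. Its summand becomes \<open>vx u\<close>. Since
  \<open>p1\<close> is shortest, every other summand vanishes or leaves a nonempty real path ending
  at \<open>u\<close>; no ghost edges remain.\<close>

lemma real_reduces:
  assumes y: "y \<approx> (\<Sum>p\<in>D. cst (k p) * (pth p * vx w))" and D: "finite D" "D \<noteq> {}"
    and nz: "\<And>p. p \<in> D \<Longrightarrow> k p \<noteq> 0" and walk: "\<And>p. p \<in> D \<Longrightarrow> \<exists>s. awalk s p w"
    and t: "awalk w \<tau> u" and u: "u \<in> S" "vx u \<notin> J"
  shows "reduces S (y * pth \<tau>)"
proof -
  have uv: "u \<in> verts E"
    using t by blast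
  obtain p1 where p1: "p1 \<in> D" "\<And>p. p \<in> D \<Longrightarrow> length p1 \<le> length p"
    using ex_min_if_finite[of "length ` D"] D
    by (metis (mono_tags, lifting) arg_min_if_finite(1) arg_min_least)
  define q where "q = p1 @ \<tau>"
  define T :: "'e list \<Rightarrow> ('v, 'e) lpa_gen word \<Rightarrow>\<^sub>0 'k"
    where "T p = vx u * gth q * (pth p * vx w) * pth \<tau> * vx u" for p
  have T: "T p \<approx> vx u * gth q * pth (p @ \<tau>) * vx u" for p
    using uv by (simp add: T_def cong_iff cls_hom gen_rules cls_swap[OF vx_pth[OF t]])
  obtain s1 where s1: "awalk s1 q u"
    using walk[OF p1(1)] t by (auto simp: q_def)
  have T_prefix: "T p \<approx> loop_el u t'" if "p @ \<tau> = q @ t'" for p t'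
    by (rule cong_trans[OF T]) (simp add: that cong_iff cls_hom cls_rule3[OF gth_pth[OF s1]])
  have T1: "T p1 \<approx> vx u"
    using T_prefix[of p1 "[]"] vx_idem[OF uv] cong_trans by (auto simp: q_def)
  have T2: "T p \<in> lspan (loop_el u) (loops u)" if p: "p \<in> D" "p \<noteq> p1" for p
  proof -
    obtain s where s: "awalk s (p @ \<tau>) u"
      using walk[OF p(1)] t by auto
    show ?thesis
    proof (cases "prefix q (p @ \<tau>)")
      case True
      then obtain t' where t': "p @ \<tau> = q @ t'"
        by (auto simp: prefix_def)
      have "t' \<noteq> []"
        using t' p(2) by (auto simp: q_def)
      obtain x where x: "awalk x t' u"
        using s unfolding t' by (metis awalk_append_iff)
      note * = T_prefix[OF t']
      show ?thesis
      proof (cases "x = u")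
        case True
        then show ?thesis
          using x \<open>t' \<noteq> []\<close> by (intro lspan_baseI[where i = t'] *) (simp add: loops_def)
      next
        case False
        have "loop_el u t' \<approx> 0"
          using False x uv by (auto simp: cong_iff cls_hom gen_rules simp flip: cls_swap[OF vx_pth[OF x]])
        then show ?thesis
          by (rule lspan_zeroI[OF cong_trans[OF *]])
      qed
    next
      case False
      then have "\<not> prefix (p @ \<tau>) q"
        using p1(2)[OF p(1)] prefix_length_prefix[of q q "p @ \<tau>"] by (auto simp: q_def)
      then have 0: "gth q * pth (p @ \<tau>) \<approx> 0"
        using False s by (intro gth_pth_parallel[OF s1]) auto
      have "vx u * gth q * pth (p @ \<tau>) * vx u \<approx> 0"
        by (simp only: cong_iff cls_hom cls_rule[OF 0] qmult_zero)
      then show ?thesis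
        by (rule lspan_zeroI[OF cong_trans[OF T]])
    qed
  qed
  let ?c = "vx u * gth q"
  have "?c * (y * pth \<tau>) * vx u \<approx> ?c * ((\<Sum>p\<in>D. cst (k p) * (pth p * vx w)) * pth \<tau>) * vx u"
    by (intro cong_mult cong_refl y)
  also have "\<dots> = (\<Sum>p\<in>D. cst (k p) * T p)"
    by (simp add: T_def sum_distrib_left sum_distrib_right cst_left_commute mult.assoc)
  also have "\<dots> = cst (k p1) * T p1 + (\<Sum>p\<in>D - {p1}. cst (k p) * T p)"
    using D p1 by (simp add: sum.remove)
  also have "\<dots> \<approx> cst (k p1) * vx u + (\<Sum>p\<in>D - {p1}. cst (k p) * T p)"
    by (intro cong_add cong_mult T1 cong_refl)
  finally have "?c * (y * pth \<tau>) * vx u \<approx> cst (k p1) * vx u + (\<Sum>p\<in>D - {p1}. cst (k p) * T p)" .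
  moreover have "(\<Sum>p\<in>D - {p1}. cst (k p) * T p) \<in> lspan (loop_el u) (loops u)"
    using T2 by (intro lspan_sum lspan_cst) auto
  ultimately show ?thesis
    unfolding reduces_def using u uv nz[OF p1(1)] by blast
qed

text \<open>As in \<open>real_reduces\<close>, but a rest behind the shortest path begins with an
  edge, which \<open>hat w\<close> annihilates; so not even closed paths are left.\<close>

lemma real_hat_reduces:
  assumes x: "x \<approx> (\<Sum>p\<in>D. cst (k p) * (pth p * vx w)) * hat w" and D: "finite D"
    and nz: "\<And>p. p \<in> D \<Longrightarrow> k p \<noteq> 0" and walk: "\<And>p. p \<in> D \<Longrightarrow> \<exists>s. awalk s p w"
    and w: "w \<in> S" "infinite_emitter E w" "finite (esc w)" and xJ: "x \<notin> J"
  shows "reduces S x"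
proof -
  have wv: "w \<in> verts E"
    using w(2) by (simp add: infinite_emitter_def)
  note hat = hat_ed[OF wv w(3)] hat_vx[OF wv w(3) wv] hat_idem[OF wv w(3)]
  have "hat w \<notin> J"
    using xJ cong_mem[OF x] mult_mem_left by blast
  then have "vx w \<notin> J"
    using cong_mem[OF vx_hat[OF wv w(3)]] mult_mem_right by blast
  have "D \<noteq> {}"
    using x xJ by (auto simp: cong_zero_iff)
  then obtain p1 where p1: "p1 \<in> D" "\<And>p. p \<in> D \<Longrightarrow> length p1 \<le> length p"
    using D by (metis (mono_tags, lifting) arg_min_if_finite(1) arg_min_least)
  obtain s1 where s1: "awalk s1 p1 w"
    using walk[OF p1(1)] by blast
  define T where "T p = hat w * gth p1 * (pth p * vx w) * hat w" for p
  note rules = cls_rule[OF hat(2)[simplified]] cls_rule[OF hat(3)]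
  have T1: "T p1 \<approx> hat w"
    by (simp add: T_def cong_iff cls_hom cls_rule3[OF gth_pth'[OF s1]] rules)
  have T2: "T p \<approx> 0" if p: "p \<in> D" "p \<noteq> p1" for p
  proof (cases "prefix p1 p")
    case True
    then obtain e t where t: "p = p1 @ e # t"
      using p(2) by (metis append_Nil2 list.exhaust prefix_def)
    then have e: "e \<in> arcs E"
      using walk[OF p(1)] by auto
    have "hat w * gth p1 * pth p1 \<approx> hat w * vx w * gth p1 * pth p1"
      by (simp add: cong_iff cls_hom rules)
    also have "\<dots> \<approx> hat w"
      unfolding cong_iff cls_hom cls_rule3(1)[OF gth_pth[OF s1]] by (simp add: rules)
    finally have *: "hat w * gth p1 * pth p1 \<approx> hat w" .
    show ?thesis
      by (simp add: T_def t cong_iff cls_hom cls_rule3[OF *] cls_rule[OF hat(1)[OF e]])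
  next
    case False
    then have "\<not> prefix p p1"
      using p1(2)[OF p(1)] prefix_length_prefix[of p1 p1 p] by blast
    then have *: "gth p1 * pth p \<approx> 0"
      using False walk[OF p(1)] by (intro gth_pth_parallel[OF s1]) auto
    show ?thesis
      by (simp add: T_def cong_iff cls_hom cls_rule[OF *])
  qed
  have "cst (1 / k p1) * hat w * gth p1 * x * 1
      \<approx> cst (1 / k p1) * hat w * gth p1 * ((\<Sum>p\<in>D. cst (k p) * (pth p * vx w)) * hat w) * 1"
    by (intro cong_mult cong_refl x)
  also have "\<dots> = cst (1 / k p1) * (hat w * gth p1 * (\<Sum>p\<in>D. cst (k p) * (pth p * vx w)) * hat w)"
    by (simp add: mult.assoc)
  also have "hat w * gth p1 * (\<Sum>p\<in>D. cst (k p) * (pth p * vx w)) * hat w = (\<Sum>p\<in>D. cst (k p) * T p)"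
    by (simp add: T_def sum_distrib_left sum_distrib_right cst_left_commute mult.assoc)
  also have "(\<Sum>p\<in>D. cst (k p) * T p) = cst (k p1) * T p1 + (\<Sum>p\<in>D - {p1}. cst (k p) * T p)"
    using D p1 by (simp add: sum.remove)
  also have "cst (1 / k p1) * \<dots> \<approx> cst (1 / k p1) * (cst (k p1) * hat w + (\<Sum>p\<in>D - {p1}. cst (k p) * 0))"
    by (intro cong_mult cong_add cong_sum cong_refl T1 T2) auto
  also have "\<dots> = hat w"
    using nz[OF p1(1)] by (simp flip: mult.assoc cst_mult)
  finally show ?thesis
    unfolding reduces_def using w wv \<open>hat w \<notin> J\<close> \<open>vx w \<notin> J\<close> by blast
qed

text \<open>Induction runs over \<open>n\<close>: all ghost parts belong to the same vertex
  \<open>w\<close>, so multiplying from the right by an edge at \<open>w\<close> shortens each of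
  them, annihilates its monomial, or prolongs the real part if the ghost part is empty.\<close>

definition ridx :: "'v set \<Rightarrow> 'v \<Rightarrow> nat \<Rightarrow> ('v \<times> 'e list \<times> 'e list) set" where
  "ridx S w n = {(u, p, q). u \<in> S \<and> (\<exists>s. awalk s p u) \<and> awalk w q u \<and> length q \<le> n}"

lemma ridx_vx:
  assumes x: "x \<in> lspan mon (ridx S w n)"
  shows "x * vx w \<approx> x"
proof -
  obtain D k where D: "D \<subseteq> ridx S w n" "x \<approx> (\<Sum>i\<in>D. cst (k i) * mon i)"
    using x unfolding lspan_def by blast
  have m: "mon i * vx w \<approx> mon i" if "i \<in> D" for i
    using that D(1) mon_vx[of w w] by (force simp: ridx_def)
  have "x * vx w \<approx> (\<Sum>i\<in>D. cst (k i) * mon i) * vx w"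
    by (intro cong_mult cong_refl D)
  also have "\<dots> = (\<Sum>i\<in>D. cst (k i) * (mon i * vx w))"
    by (simp add: sum_distrib_right mult.assoc)
  also have "\<dots> \<approx> (\<Sum>i\<in>D. cst (k i) * mon i)"
    by (intro cong_sum cong_mult cong_refl m)
  also have "\<dots> \<approx> x"
    by (rule cong_sym[OF D(2)])
  finally show ?thesis .
qed

lemma ridx_ed:
  assumes S: "hereditary E S" and x: "x \<in> lspan mon (ridx S w (Suc n))" and e: "e \<in> out_arcs E w"
  shows "x * ed e \<in> lspan mon (ridx S (head E e) n)"
proof -
  have "mon i * ed e \<in> lspan mon (ridx S (head E e) n)" if "i \<in> ridx S w (Suc n)" for i
  proof -
    obtain u p q s where i: "i = (u, p, q)" "u \<in> S" "awalk s p u" "awalk w q u" "length q \<le> Suc n"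
      using \<open>i \<in> ridx S w (Suc n)\<close> by (auto simp: ridx_def)
    have e': "e \<in> arcs E" "tail E e = w" "head E e \<in> verts E"
      using e by auto
    show ?thesis
    proof (cases q)
      case Nil
      then have "u = w"
        using i by (simp add: awalk_Nil_iff)
      then have "(head E e, p @ [e], []) \<in> ridx S (head E e) n"
        unfolding ridx_def mem_Collect_eq prod.case
        using i e' hereditary_arc[OF wf_digraph_axioms S e'(1)]
        by (intro conjI exI[of _ s] awalk_appendI[OF i(3)]) (auto simp: awalk_simps)
      moreover have "mon i * ed e \<approx> mon (head E e, p @ [e], [])"
        using mon_Nil_ed[of u e p] i e' Nil \<open>u = w\<close> by auto
      ultimately show ?thesis
        by (intro lspan_baseI)
    next
      case (Cons f q')
      then have *: "mon i * ed e \<approx> (if f = e then mon (u, p, q') else 0)"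
        using mon_Cons_ed[of w f q' u e p] i e' by simp
      show ?thesis
      proof (cases "f = e")
        case True
        then have "(u, p, q') \<in> ridx S (head E e) n"
          using i Cons by (auto simp: ridx_def awalk_Cons_iff)
        then show ?thesis
          using * True by (intro lspan_baseI[where i = "(u, p, q')"]) auto
      next
        case False
        then show ?thesis
          using * by (intro lspan_zeroI) simp
      qed
    qed
  qed
  then show ?thesis
    using lspan_mult[OF x, of 1 "ed e" mon] by simp
qed

text \<open>If some edge at \<open>w\<close> keeps \<open>x\<close> outside \<open>J\<close>, the
  induction hypothesis applies. Otherwise \<open>x\<close> is its part without ghost edges times
  \<open>w\<close> minus finitely many \<open>f f*\<close>, and the kind of vertex that
  \<open>w\<close> is decides how this product is brought to a normal form.\<close>

lemma ridx_reduces: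
  assumes S: "hereditary E S"
  shows "x \<in> lspan mon (ridx S w n) \<Longrightarrow> x \<notin> J \<Longrightarrow> w \<in> verts E \<Longrightarrow> reduces S x"
proof (induction n arbitrary: x w)
  case (0 x w)
  obtain D k where D: "finite D" "D \<subseteq> ridx S w 0" "\<And>i. i \<in> D \<Longrightarrow> k i \<noteq> 0" "x \<approx> (\<Sum>i\<in>D. cst (k i) * mon i)"
    using lspan_nonzero[OF 0(1)] by blast
  let ?f = "\<lambda>p. (w, p, [] :: 'e list)"
  define D' where "D' = {p. ?f p \<in> D}"
  have D_eq: "D = ?f ` D'"
    using D(2) by (force simp: D'_def ridx_def awalk_Nil_iff)
  have "finite D'"
    using D(1) unfolding D_eq by (rule finite_imageD) (simp add: inj_on_def)
  have "D' \<noteq> {}"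
    using D(4) 0(2) by (auto simp: D_eq cong_zero_iff)
  then have "w \<in> S"
    using D(2) by (auto simp: D'_def ridx_def)
  have sum: "(\<Sum>i\<in>D. cst (k i) * mon i) = (\<Sum>p\<in>D'. cst (k (?f p)) * (pth p * vx w))"
    unfolding D_eq by (subst sum.reindex) (auto simp: inj_on_def mon_def)
  have "vx w \<notin> J"
    using 0(2) cong_mem[OF ridx_vx[OF 0(1)]] mult_mem_left by blast
  have "reduces S (x * pth [])"
    using D(2,3) 0(3) \<open>w \<in> S\<close> \<open>vx w \<notin> J\<close> \<open>D' \<noteq> {}\<close> \<open>finite D'\<close>
    by (intro real_reduces[where D = D' and k = "\<lambda>p. k (?f p)" and w = w and u = w] D(4)[unfolded sum])
      (auto simp: D'_def ridx_def awalk_Nil_iff)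
  then show ?case
    by simp
next
  case (Suc n x w)
  show ?case
  proof (cases "\<exists>e\<in>out_arcs E w. x * ed e \<notin> J")
    case True
    then obtain e where e: "e \<in> out_arcs E w" "x * ed e \<notin> J"
      by blast
    have "reduces S (x * ed e)"
      using e by (intro Suc.IH[OF ridx_ed[OF S Suc.prems(1)]]) auto
    then show ?thesis
      by (rule reduces_mult_right)
  next
    case False
    then have kill: "x * ed e \<in> J" if "e \<in> out_arcs E w" for e
      using that by blast
    have xw: "x * vx w \<approx> x"
      by (rule ridx_vx[OF Suc.prems(1)])
    have vw: "vx w \<notin> J"
      using Suc.prems(2) cong_mem[OF xw] mult_mem_left by blast
    obtain D k where D: "finite D" "D \<subseteq> ridx S w (Suc n)" "\<And>i. i \<in> D \<Longrightarrow> k i \<noteq> 0"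
      "x \<approx> (\<Sum>i\<in>D. cst (k i) * mon i)"
      using lspan_nonzero[OF Suc.prems(1)] by blast
    let ?f = "\<lambda>p. (w, p, [] :: 'e list)"
    define D0 where "D0 = {p. ?f p \<in> D}"
    define D1 where "D1 = {i \<in> D. snd (snd i) \<noteq> []}"
    have D_eq: "D = ?f ` D0 \<union> D1" "?f ` D0 \<inter> D1 = {}"
      using D(2) by (force simp: D0_def D1_def ridx_def awalk_Nil_iff)+
    have "D1 \<subseteq> D" and f: "?f ` D0 \<subseteq> D" and "inj_on ?f D0"
      by (auto simp: D0_def D1_def inj_on_def)
    have "finite D1"
      by (rule finite_subset[OF \<open>D1 \<subseteq> D\<close> D(1)])
    have f': "finite (?f ` D0)"
      by (rule finite_subset[OF f D(1)])
    then have "finite D0"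
      using \<open>inj_on ?f D0\<close> by (rule finite_imageD)
    define y0 where "y0 = (\<Sum>p\<in>D0. cst (k (?f p)) * (pth p * vx w))"
    define y1 where "y1 = (\<Sum>i\<in>D1. cst (k i) * mon i)"
    have "(\<Sum>i\<in>D. cst (k i) * mon i) = (\<Sum>i\<in>?f ` D0. cst (k i) * mon i) + y1"
      unfolding y1_def using sum.union_disjoint[OF f' \<open>finite D1\<close> D_eq(2)] by (simp flip: D_eq(1))
    also have "(\<Sum>i\<in>?f ` D0. cst (k i) * mon i) = y0"
      unfolding y0_def by (subst sum.reindex) (auto simp: inj_on_def mon_def)
    finally have x: "x \<approx> y0 + y1"
      using D(4) by simp
    define F where "F = (\<lambda>i. hd (snd (snd i))) ` D1"
    have F: "finite F" "F \<subseteq> out_arcs E w"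
      using \<open>finite D1\<close> D(2)
      by (auto simp: F_def D1_def ridx_def neq_Nil_conv awalk_Cons_iff)
    have nz: "\<And>p. p \<in> D0 \<Longrightarrow> k (?f p) \<noteq> 0" and walk: "\<And>p. p \<in> D0 \<Longrightarrow> \<exists>s. awalk s p w"
      and wS: "D0 \<noteq> {} \<Longrightarrow> w \<in> S"
      using D(2,3) by (auto simp: D0_def ridx_def)
    \<comment> \<open>\<open>x\<close> absorbs the factor because every edge annihilates it, whereas
      the factor annihilates each summand whose ghost part begins with an edge of
      \<open>F'\<close>.\<close>
    have key: "x \<approx> y0 * (vx w - (\<Sum>f\<in>F'. ed f * gh f))" if F': "finite F'" "F \<subseteq> F'" "F' \<subseteq> out_arcs E w" for F'
    proof -
      let ?V = "vx w - (\<Sum>f\<in>F'. ed f * gh f)"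
      have "mon i * ?V \<approx> 0" if "i \<in> D1" for i
      proof -
        obtain u p e q where i: "i = (u, p, e # q)" "awalk w (e # q) u"
          using \<open>i \<in> D1\<close> D(2) by (auto simp: D1_def ridx_def neq_Nil_conv)
        have e: "e \<in> F'" "e \<in> arcs E"
          using \<open>i \<in> D1\<close> i F' by (auto simp: F_def)
        have "mon i * ?V = mon i * vx w - (\<Sum>f\<in>F'. (mon i * ed f) * gh f)"
          by (simp add: right_diff_distrib sum_distrib_left mult.assoc)
        also have "\<dots> \<approx> mon i - (\<Sum>f\<in>F'. (if e = f then mon (u, p, q) else 0) * gh f)"
          using mon_vx[OF Suc.prems(3) i(2)] F'(3) unfolding i(1)
          by (intro cong_diff cong_sum cong_mult cong_refl mon_Cons_ed[OF i(2)]) auto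
        also have "(\<Sum>f\<in>F'. (if e = f then mon (u, p, q) else 0) * gh f)
            = (\<Sum>f\<in>F'. if e = f then mon (u, p, q) * gh f else 0)"
          by (rule sum.cong) auto
        also have "\<dots> = mon i"
          using F'(1) e by (simp add: i mon_def mult.assoc)
        finally show ?thesis by simp
      qed
      then have "(\<Sum>i\<in>D1. cst (k i) * (mon i * ?V)) \<approx> (\<Sum>i\<in>D1. cst (k i) * 0)"
        by (intro cong_sum cong_mult cong_refl)
      then have y1: "y1 * ?V \<approx> 0"
        by (simp add: y1_def sum_distrib_right mult.assoc)
      have "x \<approx> x * vx w - (\<Sum>f\<in>F'. 0 * gh f)"
        using cong_sym[OF xw] by simp
      also have "\<dots> \<approx> x * vx w - (\<Sum>f\<in>F'. (x * ed f) * gh f)"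
        using kill F'(3)
        by (intro cong_diff cong_sum cong_mult cong_refl cong_sym[of "x * ed _"]) (auto simp: cong_zero_iff)
      also have "\<dots> = x * ?V"
        by (simp add: right_diff_distrib sum_distrib_left mult.assoc)
      also have "\<dots> \<approx> (y0 + y1) * ?V"
        by (intro cong_mult cong_refl x)
      also have "\<dots> = y0 * ?V + y1 * ?V"
        by (simp add: distrib_right)
      also have "\<dots> \<approx> y0 * ?V + 0"
        by (intro cong_add cong_refl y1)
      finally show ?thesis by simp
    qed
    have "y0 \<notin> J"
      using Suc.prems(2) cong_mem[OF key[OF F(1) order_refl F(2)]] mult_mem_right by blast
    then have D0: "D0 \<noteq> {}"
      by (auto simp: y0_def)
    note real = real_reduces[OF _ \<open>finite D0\<close> D0 nz walk]
    consider "regular_vertex E w" | "sink E w" | "infinite_emitter E w" "infinite (esc w)"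
      | "infinite_emitter E w" "finite (esc w)"
      using Suc.prems(3) by (auto simp: regular_vertex_def)
    then show ?thesis
    proof cases
      case 1
      \<comment> \<open>Annihilation by all edges puts \<open>x\<close> into \<open>J\<close> by the
        second Cuntz-Krieger relation, so a regular \<open>w\<close> is impossible here.\<close>
      have "x \<approx> x * (\<Sum>e\<in>out_arcs E w. ed e * gh e)"
        using cong_trans[OF cong_sym[OF xw] cong_mult[OF cong_refl CK2_cong[OF 1]]] .
      also have "\<dots> = (\<Sum>e\<in>out_arcs E w. (x * ed e) * gh e)"
        by (simp add: sum_distrib_left mult.assoc)
      finally have *: "x \<approx> (\<Sum>e\<in>out_arcs E w. (x * ed e) * gh e)" .
      have "(\<Sum>e\<in>out_arcs E w. (x * ed e) * gh e) \<in> J"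
        by (intro sum_mem mult_mem_right kill)
      then show ?thesis
        using Suc.prems(2) cong_mem[OF *] by simp
    next
      case 2
      then have "F = {}"
        using F(2) by (auto simp: sink_def)
      then have "x \<approx> y0 * vx w"
        using key[of "{}"] by simp
      also have "\<dots> = (\<Sum>p\<in>D0. cst (k (?f p)) * (pth p * (vx w * vx w)))"
        by (simp add: y0_def sum_distrib_right mult.assoc)
      also have "\<dots> \<approx> (\<Sum>p\<in>D0. cst (k (?f p)) * (pth p * vx w))"
        by (intro cong_sum cong_mult cong_refl vx_idem Suc.prems(3))
      finally have "reduces S (x * pth [])"
        using vw wS[OF D0] Suc.prems(3) by (intro real[where u = w]) (auto simp: awalk_Nil_iff)
      then show ?thesis
        by simp
    next
      case 3
      \<comment> \<open>An edge outside \<open>F\<close> is orthogonal to the subtracted sum; it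
        carries the part without ghost edges to a vertex outside \<open>J\<close>.\<close>
      then obtain e where e: "e \<in> esc w" "e \<notin> F"
        using F(1) by (meson finite_subset subsetI)
      have e': "e \<in> arcs E" "tail E e = w"
        using e(1) by (auto simp: esc_def)
      have "x * ed e \<approx> y0 * (vx w - (\<Sum>f\<in>F. ed f * gh f)) * ed e"
        by (intro cong_mult cong_refl key F order_refl)
      also have "\<dots> = y0 * (vx w * ed e - (\<Sum>f\<in>F. ed f * (gh f * ed e)))"
        by (simp add: left_diff_distrib sum_distrib_right mult.assoc)
      also have "\<dots> \<approx> y0 * (ed e - (\<Sum>f\<in>F. ed f * 0))"
      proof (intro cong_mult cong_diff cong_sum cong_refl)
        show "vx w * ed e \<approx> ed e"
          using absorb(1)[OF e'(1)] e'(2) by simp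
        show "gh f * ed e \<approx> 0" if "f \<in> F" for f
          using gh_ed[of f e] subsetD[OF F(2) that] that e(2) e'(1) by (auto split: if_splits)
      qed
      finally have xe: "x * ed e \<approx> y0 * pth [e]"
        by simp
      have "reduces S (y0 * pth [e])"
        using e(1) e' hereditary_arc[OF wf_digraph_axioms S e'(1)] wS[OF D0]
        by (intro real[where u = "head E e"])
          (auto simp: y0_def awalk_simps esc_def killed_def)
      then show ?thesis
        by (intro reduces_mult_right[OF reduces_cong[OF cong_sym[OF xe]]])
    next
      case 4
      \<comment> \<open>With all surviving edges added to \<open>F\<close> the factor becomes
        \<open>hat w\<close>, because the remaining edges of \<open>F\<close> lie in
        \<open>J\<close>.\<close>
      have fin: "finite (F \<union> esc w)"
        using F(1) 4(2) by simp
      have sub: "F \<union> esc w \<subseteq> out_arcs E w"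
        using F(2) by (auto simp: esc_def)
      have "ed f * gh f \<in> J" if "f \<in> F - esc w" for f
        using that subsetD[OF F(2), of f] by (intro mult_mem_right ed_killed) (auto simp: esc_def)
      then have "(\<Sum>f\<in>F - esc w. ed f * gh f) \<in> J"
        by (rule sum_mem)
      moreover have "(\<Sum>f\<in>F \<union> esc w. ed f * gh f)
          = (\<Sum>f\<in>F - esc w. ed f * gh f) + (\<Sum>f\<in>esc w. ed f * gh f :: ('v, 'e) lpa_gen word \<Rightarrow>\<^sub>0 'k)"
        using F(1) 4(2) by (subst sum.union_disjoint[symmetric]) (auto intro: sum.cong)
      ultimately have V: "vx w - (\<Sum>f\<in>F \<union> esc w. ed f * gh f) \<approx> hat w"
        using uminus_mem by (auto simp: cong_def hat_def)
      have "x \<approx> y0 * hat w"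
        by (rule cong_trans[OF key[OF fin _ sub] cong_mult[OF cong_refl V]]) simp
      then show ?thesis
        unfolding y0_def
        using nz walk wS[OF D0] 4 Suc.prems(2) \<open>finite D0\<close> by (intro real_hat_reduces) auto
    qed
  qed
qed

text \<open>The sum of the finitely many vertices at which the ghost parts start fixes
  \<open>x\<close>, so one of them keeps \<open>x\<close> outside \<open>J\<close>. It is the common
  vertex \<open>w\<close> with which the induction begins.\<close>

lemma lspan_reduces:
  assumes S: "hereditary E S" and x: "x \<in> lspan mon (midx S)" "x \<notin> J"
  shows "reduces S x"
proof -
  obtain D k where D: "finite D" "D \<subseteq> midx S" "x \<approx> (\<Sum>i\<in>D. cst (k i) * mon i)"
    using x(1) unfolding lspan_def by blast
  have "\<exists>s. awalk s (snd (snd i)) (fst i)" if "i \<in> D" for i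
    using subsetD[OF D(2) that] by (auto simp: midx_def)
  then obtain s where s: "\<And>i. i \<in> D \<Longrightarrow> awalk (s i) (snd (snd i)) (fst i)"
    by metis
  have sv: "s i \<in> verts E" if "i \<in> D" for i
    using s[OF that] by blast
  have m: "mon i * vx v \<approx> (if v = s i then mon i else 0)" if "i \<in> D" "v \<in> verts E" for i v
    using mon_vx[OF that(2) s[OF that(1)], of "fst (snd i)"] by (simp only: prod.collapse)
  have "x * (\<Sum>v\<in>s ` D. vx v) \<approx> (\<Sum>i\<in>D. cst (k i) * mon i) * (\<Sum>v\<in>s ` D. vx v)"
    by (intro cong_mult cong_refl D)
  also have "\<dots> = (\<Sum>i\<in>D. cst (k i) * (\<Sum>v\<in>s ` D. mon i * vx v))"
    by (simp add: sum_distrib_left sum_distrib_right mult.assoc) (rule sum.swap)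
  also have "\<dots> \<approx> (\<Sum>i\<in>D. cst (k i) * (\<Sum>v\<in>s ` D. if v = s i then mon i else 0))"
    using sv by (intro cong_sum cong_mult cong_refl m) auto
  also have "\<dots> = (\<Sum>i\<in>D. cst (k i) * mon i)"
    using D(1) by (intro sum.cong) auto
  also have "\<dots> \<approx> x"
    by (rule cong_sym[OF D(3)])
  finally have "(\<Sum>v\<in>s ` D. x * vx v) \<notin> J"
    using x(2) cong_mem by (simp add: sum_distrib_left)
  then obtain w where w: "w \<in> s ` D" "x * vx w \<notin> J"
    using sum_mem by metis
  define n where "n = Max ((\<lambda>i. length (snd (snd i))) ` D)"
  have n: "length (snd (snd i)) \<le> n" if "i \<in> D" for i
    using D(1) that by (simp add: n_def)
  have wv: "w \<in> verts E"
    using w(1) sv by blast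
  have "x \<in> lspan mon D"
    using D by (intro lspanI[of D]) auto
  moreover have "1 * mon i * vx w \<in> lspan mon (ridx S w n)" if i: "i \<in> D" for i
  proof (cases "w = s i")
    case True
    then have "i \<in> ridx S w n"
      using s[OF i] n[OF i] D(2) i by (auto simp: ridx_def midx_def)
    then show ?thesis
      using m[OF i wv] True by (intro lspan_baseI[of _ mon i]) auto
  next
    case False
    then show ?thesis
      using m[OF i wv] by (intro lspan_zeroI) simp
  qed
  ultimately have "1 * x * vx w \<in> lspan mon (ridx S w n)"
    by (rule lspan_mult)
  then have "reduces S (x * vx w)"
    using ridx_reduces[OF S _ w(2) wv] by simp
  then show ?thesis
    by (rule reduces_mult_right)
qed

text \<open>Conjugation by the path \<open>\<tau>\<close> of \<open>exit_path_not_prefix\<close>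
  fixes \<open>vx u\<close>. It annihilates the closed paths in \<open>r\<close>, since none of them
  followed by \<open>\<tau>\<close> begins with \<open>\<tau>\<close>; \<open>N\<close> is chosen to
  bound their lengths.\<close>

lemma two_CSP_conjugate:
  assumes u: "u \<in> verts E" and ab: "a \<in> CSP E u" "b \<in> CSP E u" "a \<noteq> b"
    and r: "r \<in> lspan (loop_el u) (loops u)"
  shows "\<exists>c d. \<forall>k. c * (cst k * vx u + r) * d \<approx> cst k * vx u"
proof -
  obtain D \<kappa> where D: "finite D" "D \<subseteq> loops u" "r \<approx> (\<Sum>p\<in>D. cst (\<kappa> p) * loop_el u p)"
    using r unfolding lspan_def by blast
  define N where "N = Max (length ` D)"
  have N: "length p \<le> N" if "p \<in> D" for p
    using that D(1) by (simp add: N_def)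
  define \<tau> where "\<tau> = concat (replicate N a) @ b"
  have t: "awalk u \<tau> u"
    using closed_power_walk[of u a N] ab by (auto simp: \<tau>_def CSP_def)
  let ?c = "vx u * gth \<tau>" and ?d = "pth \<tau> * vx u"
  have 1: "?c * vx u * ?d \<approx> vx u"
    using u by (simp add: cong_iff cls_hom gen_rules cls_rule3[OF gth_pth_self[OF t]])
  have 2: "?c * loop_el u p * ?d \<approx> 0" if p: "p \<in> D" for p
  proof -
    have p': "awalk u p u" "p \<noteq> []"
      using p D(2) by (auto simp: loops_def)
    have "\<not> prefix \<tau> (p @ \<tau>)"
      using exit_path_not_prefix[OF ab p' N[OF p] \<tau>_def] by (auto simp: prefix_def)
    moreover have "\<not> prefix (p @ \<tau>) \<tau>"
      using p'(2) by (auto dest: prefix_length_le)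
    ultimately have "gth \<tau> * pth (p @ \<tau>) \<approx> 0"
      using p' t by (intro gth_pth_parallel[OF t]) auto
    then have *: "gth \<tau> * pth p * pth \<tau> \<approx> 0"
      by (simp add: mult.assoc)
    show ?thesis
      by (simp add: cong_iff cls_hom cls_swap[OF vx_pth[OF p'(1)]] cls_swap[OF vx_pth[OF t]] cls_rule3[OF *])
  qed
  have "?c * (cst k * vx u + r) * ?d \<approx> cst k * vx u" for k
  proof -
    have "?c * (cst k * vx u + r) * ?d \<approx> ?c * (cst k * vx u + (\<Sum>p\<in>D. cst (\<kappa> p) * loop_el u p)) * ?d"
      by (intro cong_mult cong_add cong_refl D)
    also have "\<dots> = cst k * (?c * vx u * ?d) + (\<Sum>p\<in>D. cst (\<kappa> p) * (?c * loop_el u p * ?d))"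
      by (simp add: distrib_left distrib_right sum_distrib_left sum_distrib_right cst_left_commute mult.assoc)
    also have "\<dots> \<approx> cst k * vx u + (\<Sum>p\<in>D. cst (\<kappa> p) * 0)"
      by (intro cong_mult cong_add cong_sum cong_refl 1 2)
    finally show ?thesis by simp
  qed
  then show ?thesis
    by blast
qed

text \<open>The closed simple paths at \<open>u\<close> decide what becomes of \<open>r\<close>: if
  there are none, there are no closed paths at all; if there are two, conjugation removes
  \<open>r\<close>; a single one leaves the case \<open>cycle\<close>.\<close>

theorem reduction:
  assumes S: "hereditary E S" and x: "x \<in> lspan mon (midx S)" "x \<notin> J"
  obtains (vertex) c d u where "u \<in> S" "u \<in> verts E" "vx u \<notin> J" "c * x * d \<approx> vx u"
  | (cycle) c d u k r p where "u \<in> S" "u \<in> verts E" "vx u \<notin> J" "CSP E u = {p}" "k \<noteq> 0"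
      "r \<in> lspan (loop_el u) (loops u)" "c * x * d \<approx> cst k * vx u + r"
  | (emitter) c d u where "u \<in> S" "infinite_emitter E u" "finite (esc u)" "vx u \<notin> J" "hat u \<notin> J"
      "c * x * d \<approx> hat u"
proof -
  obtain c d u where u: "u \<in> S" "u \<in> verts E" "vx u \<notin> J"
    and *: "(\<exists>k r. k \<noteq> 0 \<and> r \<in> lspan (loop_el u) (loops u) \<and> c * x * d \<approx> cst k * vx u + r) \<or>
      (infinite_emitter E u \<and> finite (esc u) \<and> hat u \<notin> J \<and> c * x * d \<approx> hat u)"
    using lspan_reduces[OF assms] unfolding reduces_def by blast
  from * show thesis
  proof (elim disjE exE conjE)
    fix k r assume k: "k \<noteq> 0" and r: "r \<in> lspan (loop_el u) (loops u)" and cxd: "c * x * d \<approx> cst k * vx u + r"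
    have vertex': thesis if "c' * (cst k * vx u + r) * d' \<approx> cst k * vx u" for c' d'
    proof -
      have "(cst (1 / k) * c' * c) * x * (d * d') = cst (1 / k) * (c' * (c * x * d) * d')"
        by (simp add: mult.assoc)
      also have "\<dots> \<approx> cst (1 / k) * (c' * (cst k * vx u + r) * d')"
        by (intro cong_mult cong_refl cxd)
      also have "\<dots> \<approx> cst (1 / k) * (cst k * vx u)"
        by (intro cong_mult cong_refl that)
      also have "\<dots> = vx u"
        using k by (simp flip: mult.assoc cst_mult)
      finally show thesis
        using u by (intro vertex)
    qed
    consider "CSP E u = {}" | p where "CSP E u = {p}" | a b where "a \<in> CSP E u" "b \<in> CSP E u" "a \<noteq> b"
      by blast
    then show thesis
    proof cases
      case 1
      then have "loops u = {}"
        using closed_walk_CSP by (auto simp: loops_def)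
      then have "r \<in> J"
        using r by (auto simp: lspan_def cong_zero_iff)
      then have "1 * (cst k * vx u + r) * 1 \<approx> cst k * vx u"
        by (simp add: cong_def)
      then show thesis
        by (rule vertex')
    next
      case 2
      then show thesis
        by (intro cycle[OF u _ k r cxd])
    next
      case 3
      then obtain c' d' where "\<And>k. c' * (cst k * vx u + r) * d' \<approx> cst k * vx u"
        using two_CSP_conjugate[OF u(2) 3 r] by metis
      then show thesis
        by (rule vertex')
    qed
  next
    assume "infinite_emitter E u" "finite (esc u)" "hat u \<notin> J" "c * x * d \<approx> hat u"
    then show thesis
      by (intro emitter[OF u(1) _ _ u(3)])
  qed
qed

end

section \<open>Corners at vertices without cycles\<close>

text \<open>Gaussian elimination: the vector \<open>j\<close> clears coordinate \<open>d\<close> in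
  all others, and its coefficient in \<open>b\<close> is chosen to undo the clearing.\<close>

lemma nontrivial_relation:
  fixes f :: "'n \<Rightarrow> 'i \<Rightarrow> 'k::field"
  assumes "finite D" "finite N" "card D < card N"
  shows "\<exists>a. (\<exists>n\<in>N. a n \<noteq> 0) \<and> (\<forall>i\<in>D. (\<Sum>n\<in>N. a n * f n i) = 0)"
  using assms
proof (induction D arbitrary: N f)
  case empty
  then obtain n where "n \<in> N"
    by fastforce
  then show ?case
    by (intro exI[of _ "\<lambda>_. 1"]) auto
next
  case (insert d D)
  show ?case
  proof (cases "\<forall>n\<in>N. f n d = 0")
    case True
    obtain a where "\<exists>n\<in>N. a n \<noteq> 0" "\<forall>i\<in>D. (\<Sum>n\<in>N. a n * f n i) = 0"
      using insert.IH[of N f] insert.prems insert.hyps by auto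
    then show ?thesis
      using True by (intro exI[of _ a]) auto
  next
    case False
    then obtain j where j: "j \<in> N" "f j d \<noteq> 0"
      by blast
    define g where "g n i = f n i - f n d / f j d * f j i" for n i
    have "card D < card (N - {j})"
      using insert j by auto
    then obtain a where a: "\<exists>n\<in>N - {j}. a n \<noteq> 0" "\<And>i. i \<in> D \<Longrightarrow> (\<Sum>n\<in>N - {j}. a n * g n i) = 0"
      using insert.IH[of "N - {j}" g] insert.prems by auto
    have d: "(\<Sum>n\<in>N - {j}. a n * g n d) = 0"
      using j(2) by (simp add: g_def)
    define b where "b = a(j := - (\<Sum>n\<in>N - {j}. a n * (f n d / f j d)))"
    have "(\<Sum>n\<in>N. b n * f n i) = (\<Sum>n\<in>N - {j}. a n * g n i)" for i
    proof -
      have "(\<Sum>n\<in>N. b n * f n i) = b j * f j i + (\<Sum>n\<in>N - {j}. b n * f n i)"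
        using j insert.prems by (simp add: sum.remove)
      also have "(\<Sum>n\<in>N - {j}. b n * f n i) = (\<Sum>n\<in>N - {j}. a n * f n i)"
        by (rule sum.cong) (auto simp: b_def)
      finally show ?thesis
        by (simp add: b_def g_def algebra_simps sum_subtractf sum_distrib_right sum_distrib_left)
    qed
    then have "\<forall>i\<in>insert d D. (\<Sum>n\<in>N. b n * f n i) = 0"
      using a(2) d by simp
    moreover have "\<exists>n\<in>N. b n \<noteq> 0"
      using a(1) by (auto simp: b_def)
    ultimately show ?thesis
      by blast
  qed
qed

lemma (in alg_cong) lspan_finite:
  assumes "x \<in> lspan g I" "finite I"
  obtains k where "x \<approx> (\<Sum>i\<in>I. cst (k i) * g i)"
proof -
  obtain D k where D: "finite D" "D \<subseteq> I" "x \<approx> (\<Sum>i\<in>D. cst (k i) * g i)"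
    using assms(1) unfolding lspan_def by blast
  have "(\<Sum>i\<in>D. cst (k i) * g i) = (\<Sum>i\<in>I. cst (if i \<in> D then k i else 0) * g i)"
    using D(2) assms(2) by (intro sum.mono_neutral_cong_left) auto
  then show thesis
    by (rule that[OF cong_eq_trans[OF D(3)]])
qed

section \<open>Finite-dimensional subalgebras of a corner\<close>

context lpa_cong
begin

lemma mon_mult:
  assumes "awalk v p u" "awalk v q u" "awalk v p' u'" "awalk v q' u'"
  shows "(\<exists>t. p' = q @ t \<and> awalk v (p @ t) u' \<and> mon (u, p, q) * mon (u', p', q') \<approx> mon (u', p @ t, q'))
    \<or> (\<exists>t. q = p' @ t \<and> awalk v (q' @ t) u \<and> mon (u, p, q) * mon (u', p', q') \<approx> mon (u, p, q' @ t))
    \<or> mon (u, p, q) * mon (u', p', q') \<approx> 0"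
proof -
  have uv: "u \<in> verts E" "u' \<in> verts E"
    using assms(1,3) by blast+
  consider t where "p' = q @ t" | t where "q = p' @ t" | "\<not> prefix q p'" "\<not> prefix p' q"
    by (auto simp: prefix_def)
  then show ?thesis
  proof cases
    case (1 t)
    have t: "awalk u t u'"
      using assms(2,3) unfolding 1 by (auto simp: awalk_append_iff)
    have "mon (u, p, q) * mon (u', p', q') \<approx> mon (u', p @ t, q')"
      using uv by (simp add: 1 mon_def cong_iff cls_hom gen_rules cls_rule3[OF gth_pth[OF assms(2)]] cls_swap[OF vx_pth[OF t]])
    then show ?thesis
      using 1 awalk_appendI[OF assms(1) t] by blast
  next
    case (2 t)
    have t: "awalk u' t u"
      using assms(2,3) unfolding 2 by (auto simp: awalk_append_iff)
    have "mon (u, p, q) * mon (u', p', q') \<approx> mon (u, p, q' @ t)"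
      using uv by (simp add: 2 mon_def cong_iff cls_hom gen_rules cls_rule3[OF gth_pth'[OF assms(3)]] cls_swap[OF gth_vx[OF t]])
    then show ?thesis
      using 2 awalk_appendI[OF assms(4) t] by blast
  next
    case 3
    have *: "gth q * pth p' \<approx> 0"
      using 3 assms(3) by (intro gth_pth_parallel[OF assms(2)]) auto
    have "mon (u, p, q) * mon (u', p', q') \<approx> 0"
      by (simp add: mon_def cong_iff cls_hom cls_rule[OF *])
    then show ?thesis
      by simp
  qed
qed

text \<open>Fixing a set \<open>G\<close> of edges gives a family closed under products, because
  \<open>mon_mult\<close> only joins pieces of the given paths. For finite \<open>G\<close> and
  without cycles the family is finite.\<close>

definition cidx :: "'v \<Rightarrow> 'e set \<Rightarrow> ('v \<times> 'e list \<times> 'e list) set" where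
  "cidx v G = {(u, p, q). vx u \<notin> J \<and> awalk v p u \<and> awalk v q u \<and> set p \<subseteq> G \<and> set q \<subseteq> G}"

lemma corner_cidx:
  assumes v: "v \<in> verts E"
  obtains G where "finite G" "vx v * x * vx v \<in> lspan mon (cidx v G)"
proof -
  let ?L = "lspan mon (midx (verts E))"
  interpret L: lpa_cong E ?L
    by (intro lpa_good_locale lspan_good wf_digraph_axioms) (auto simp: hereditary_def connects_def)
  have "vx v * x * vx v \<in> ?L"
    using vx_lspan[of v] v by (intro L.mult_mem_left) auto
  then obtain D k where D: "finite D" "D \<subseteq> midx (verts E)"
    "vx v * x * vx v \<approx> (\<Sum>i\<in>D. cst (k i) * mon i)"
    unfolding lspan_def by blast
  define G where "G = (\<Union>(u, p, q)\<in>D. set p \<union> set q)"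
  have G: "set p \<subseteq> G" "set q \<subseteq> G" if "(u, p, q) \<in> D" for u p q
    using that by (auto simp: G_def)
  have *: "vx v * mon i * vx v \<in> lspan mon (cidx v G)" if i: "i \<in> D" for i
  proof -
    obtain u p q s t where i': "i = (u, p, q)" and st: "awalk s p u" "awalk t q u"
      using subsetD[OF D(2) i] by (auto simp: midx_def)
    have *: "vx v * mon i * vx v \<approx> (if v = s then mon i else 0) * vx v"
      unfolding i' by (intro cong_mult cong_refl vx_mon v st)
    consider "v \<noteq> s" | "v = s" "v \<noteq> t" | "v = s" "v = t" "vx u \<in> J" | "v = s" "v = t" "vx u \<notin> J"
      by blast
    then show ?thesis
    proof cases
      case 1
      then show ?thesis
        using * by (intro lspan_zeroI) simp
    next
      case 2
      then show ?thesis
        using cong_trans[OF _ mon_vx[OF v st(2)], of "vx v * mon i * vx v" p] * i' by (intro lspan_zeroI) simp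
    next
      case 3
      then have "mon i \<in> J"
        by (simp add: i' mon_def mult_mem_left mult_mem_right)
      then show ?thesis
        by (intro lspan_zero mult_mem_left mult_mem_right)
    next
      case 4
      then have "i \<in> cidx v G"
        using st i G unfolding i' by (auto simp: cidx_def)
      moreover have "vx v * mon i * vx v \<approx> mon i"
        using cong_trans[OF _ mon_vx[OF v st(2)], of "vx v * mon i * vx v" p] * i' 4 by simp
      ultimately show ?thesis
        by (rule lspan_baseI[rotated])
    qed
  qed
  have "vx v * x * vx v \<in> lspan mon D"
    using D by (intro lspanI[of D]) auto
  then have "vx v * (vx v * x * vx v) * vx v \<in> lspan mon (cidx v G)"
    using * by (rule lspan_mult)
  moreover have "vx v * x * vx v \<approx> vx v * (vx v * x * vx v) * vx v"
    by (rule cls_eqD) (simp add: cls_hom cls_rule[OF vx_idem[OF v]])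
  ultimately have "vx v * x * vx v \<in> lspan mon (cidx v G)"
    by (rule lspan_cong)
  moreover have "finite G"
    using D(1) by (auto simp: G_def)
  ultimately show thesis
    by (rule that[rotated])
qed

lemma cidx_mult:
  assumes "x \<in> lspan mon (cidx v G)" "y \<in> lspan mon (cidx v G)"
  shows "x * y \<in> lspan mon (cidx v G)"
proof -
  have *: "mon i * mon j \<in> lspan mon (cidx v G)" if ij: "i \<in> cidx v G" "j \<in> cidx v G" for i j
  proof -
    obtain u p q where i: "i = (u, p, q)" "vx u \<notin> J" "awalk v p u" "awalk v q u" "set p \<subseteq> G" "set q \<subseteq> G"
      using ij(1) by (auto simp: cidx_def)
    obtain u' p' q' where j: "j = (u', p', q')" "vx u' \<notin> J" "awalk v p' u'" "awalk v q' u'" "set p' \<subseteq> G" "set q' \<subseteq> G"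
      using ij(2) by (auto simp: cidx_def)
    from mon_mult[OF i(3,4) j(3,4)] show ?thesis
    proof (elim disjE exE conjE)
      fix t assume t: "p' = q @ t" "awalk v (p @ t) u'" "mon (u, p, q) * mon (u', p', q') \<approx> mon (u', p @ t, q')"
      have "(u', p @ t, q') \<in> cidx v G"
        using t i j by (auto simp: cidx_def)
      then show ?thesis
        unfolding i(1) j(1) by (rule lspan_baseI[of _ mon, OF t(3)])
    next
      fix t assume t: "q = p' @ t" "awalk v (q' @ t) u" "mon (u, p, q) * mon (u', p', q') \<approx> mon (u, p, q' @ t)"
      have "(u, p, q' @ t) \<in> cidx v G"
        using t i j by (auto simp: cidx_def)
      then show ?thesis
        unfolding i(1) j(1) by (rule lspan_baseI[of _ mon, OF t(3)])
    next
      assume "mon (u, p, q) * mon (u', p', q') \<approx> 0"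
      then show ?thesis
        unfolding i(1) j(1) by (rule lspan_zeroI)
    qed
  qed
  have "1 * x * mon j \<in> lspan mon (cidx v G)" if "j \<in> cidx v G" for j
    using that * by (intro lspan_mult[OF assms(1), of 1]) simp
  then show ?thesis
    using lspan_mult[OF assms(2), of x 1 mon "cidx v G"] by simp
qed

text \<open>A path that repeats an edge passes a vertex with a closed path. This vertex survives
  because the end of the path does, contrary to acyclicity. So the paths have distinct edges and
  length at most \<open>card G\<close>.\<close>

lemma finite_cidx:
  assumes acyclic: "\<And>w. connects E v w \<Longrightarrow> vx w \<notin> J \<Longrightarrow> CSP E w = {}" and G: "finite G"
  shows "finite (cidx v G)"
proof -
  have d: "distinct p" if p: "awalk v p u" "vx u \<notin> J" for p u
  proof (rule ccontr)
    assume "\<not> distinct p"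
    then obtain xs ys zs e where "p = xs @ [e] @ ys @ [e] @ zs"
      using not_distinct_decomp by blast
    then have "awalk v xs (tail E e)" "awalk (tail E e) (e # ys) (tail E e)" "awalk (tail E e) (e # zs) u"
      using p(1) by (auto simp: awalk_append_iff awalk_Cons_iff)
    moreover from this(3) have "vx (tail E e) \<notin> J"
      using hereditary_awalk[OF killed_hereditary, of "tail E e" "e # zs" u] p(2)
      by (auto simp: killed_def awalk_Cons_iff)
    ultimately show False
      using acyclic[of "tail E e"] closed_walk_CSP[of "tail E e" "e # ys"] by (auto simp: connects_def)
  qed
  let ?P = "{p. set p \<subseteq> G \<and> length p \<le> card G}"
  \<comment> \<open>The middle vertex is determined as the end of \<open>p\<close>, so counting
    pairs of paths is enough.\<close>
  have "cidx v G \<subseteq> (\<lambda>(p, q). (awlast v p, p, q)) ` (?P \<times> ?P)"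
  proof
    fix i assume "i \<in> cidx v G"
    then obtain u p q where i: "i = (u, p, q)" "vx u \<notin> J" "awalk v p u" "awalk v q u" "set p \<subseteq> G" "set q \<subseteq> G"
      by (auto simp: cidx_def)
    have "length p \<le> card G" if "awalk v p u" "set p \<subseteq> G" for p
      using distinct_card[OF d[OF that(1) i(2)]] card_mono[OF G that(2)] by simp
    then have pq: "(p, q) \<in> ?P \<times> ?P"
      using i(3-6) by blast
    have u: "awlast v p = u"
      using i(3) by blast
    show "i \<in> (\<lambda>(p, q). (awlast v p, p, q)) ` (?P \<times> ?P)"
      by (rule image_eqI[OF _ pq]) (simp only: i(1) prod.case u)
  qed
  then show ?thesis
    by (rule finite_subset) (intro finite_imageI finite_cartesian_product finite_lists_length_le G)
qed

text \<open>
  If \<open>e\<close> were properly infinite, \<open>s\<close> below would be injective but not surjective in the corner at \<open>v\<close>,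
  which is locally finite-dimensional. A shortest relation between the powers of \<open>s\<close> is cancelled with \<open>r1\<close>.
\<close>

lemma acyclic_corner:
  assumes v: "v \<in> verts E" and acyclic: "\<And>w. connects E v w \<Longrightarrow> vx w \<notin> J \<Longrightarrow> CSP E w = {}"
    and e: "c * vx v * d \<approx> e" "e * e \<approx> e"
    and r: "r1 * e * s1 \<approx> e" "r2 * e * s2 \<approx> e" "r2 * e * s1 \<approx> 0"
  shows "e \<in> J"
proof -
  define s where "s = vx v * (d * s1 * c) * vx v"
  obtain G where G: "finite G" "s \<in> lspan mon (cidx v G)"
    using corner_cidx[OF v] unfolding s_def by blast
  have fin: "finite (cidx v G)"
    using acyclic G(1) by (rule finite_cidx)
  define X where "X n = s ^ n * vx v" for n
  have X0: "X 0 = vx v" and XSuc: "X (Suc n) = s * X n" for n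
    by (simp_all add: X_def mult.assoc)
  have X: "X n \<in> lspan mon (cidx v G)" for n
  proof (induction n)
    case 0
    show ?case
    proof (cases "vx v \<in> J")
      case False
      then have "(v, [], []) \<in> cidx v G"
        using v by (auto simp: cidx_def awalk_Nil_iff)
      then show ?thesis
        using lspan_base[of "(v, [], [])" "cidx v G" mon] by (simp add: X0 mon_def)
    qed (simp add: X0 lspan_zero)
  qed (simp add: XSuc cidx_mult G(2))
  have vX: "vx v * X n \<approx> X n" for n
    by (cases n) (rule cls_eqD, simp add: X0 XSuc s_def cls_hom cls_rule[OF vx_idem[OF v]])+
  have "\<exists>k. X n \<approx> (\<Sum>i\<in>cidx v G. cst (k i) * mon i)" for n
    by (rule lspan_finite[OF X fin]) blast
  then obtain f where f: "\<And>n. X n \<approx> (\<Sum>i\<in>cidx v G. cst (f n i) * mon i)"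
    by metis
  \<comment> \<open>Starting at 0, this is one power more than there are monomials, which forces a
    linear relation.\<close>
  define N where "N = {..card (cidx v G)}"
  obtain a where a: "\<exists>n\<in>N. a n \<noteq> 0" "\<And>i. i \<in> cidx v G \<Longrightarrow> (\<Sum>n\<in>N. a n * f n i) = 0"
    using nontrivial_relation[OF fin, of N f] by (auto simp: N_def)
  have rel: "(\<Sum>n\<in>N. cst (a n) * X n) \<approx> 0"
  proof -
    have "(\<Sum>n\<in>N. cst (a n) * X n) \<approx> (\<Sum>n\<in>N. cst (a n) * (\<Sum>i\<in>cidx v G. cst (f n i) * mon i))"
      by (intro cong_sum cong_mult cong_refl f)
    also have "\<dots> = (\<Sum>i\<in>cidx v G. \<Sum>n\<in>N. cst (a n * f n i) * mon i)"
      by (simp add: sum_distrib_left cst_mult mult.assoc) (rule sum.swap)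
    also have "\<dots> = (\<Sum>i\<in>cidx v G. cst (\<Sum>n\<in>N. a n * f n i) * mon i)"
    proof -
      have "(cst (sum h N) :: ('v, 'e) lpa_gen word \<Rightarrow>\<^sub>0 'k) = (\<Sum>n\<in>N. cst (h n))" for h
        by (induction N rule: infinite_finite_induct) (auto simp: cst_add)
      then show ?thesis
        by (simp add: sum_distrib_right)
    qed
    also have "\<dots> = 0"
      using a(2) by simp
    finally show ?thesis .
  qed
  \<comment> \<open>The factor \<open>e * c\<close> turns powers of \<open>s\<close> into a chain:
    \<open>r1\<close> lowers the index by one, and \<open>r2\<close> annihilates every positive
    index.\<close>
  define W where "W n = e * c * X n" for n
  note rules = cls_rule3[OF e(1)] cls_rule[OF e(2)] cls_rule3[OF r(1)] cls_rule3[OF r(2)] cls_rule3[OF r(3)]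
    cls_rule[OF vX]
  have r1W: "r1 * W (Suc n) \<approx> W n" and r2W: "r2 * W (Suc n) \<approx> 0" for n
    unfolding W_def XSuc s_def by (rule cls_eqD, simp add: cls_hom rules)+
  have pow: "r1 ^ k * W (n + k) \<approx> W n" for k n
  proof (induction k)
    case (Suc k)
    have "r1 ^ Suc k * W (n + Suc k) = r1 ^ k * (r1 * W (Suc (n + k)))"
      by (simp add: power_Suc2 mult.assoc del: power_Suc)
    also have "\<dots> \<approx> r1 ^ k * W (n + k)"
      by (intro cong_mult cong_refl r1W)
    also have "\<dots> \<approx> W n"
      by (rule Suc)
    finally show ?case .
  qed simp
  obtain m where m: "m \<in> N" "a m \<noteq> 0" "\<And>n. n < m \<Longrightarrow> n \<in> N \<Longrightarrow> a n = 0"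
  proof -
    from a(1) have "\<exists>n. n \<in> N \<and> a n \<noteq> 0"
      by blast
    then show thesis
      unfolding exists_least_iff[of "\<lambda>n. n \<in> N \<and> a n \<noteq> 0"] using that by blast
  qed
  have summand: "cst (a n) * (r2 * (r1 ^ m * W n)) \<approx> (if n = m then cst (a m) * (r2 * W 0) else 0)"
    if "n \<in> N" for n
  proof -
    consider "n < m" | "n = m" | k where "n = Suc k + m"
    proof (cases n m rule: linorder_cases)
      case greater
      then show thesis
        using less_imp_Suc_add[of m n] that(3) by (auto simp: add.commute)
    qed (use that in blast)+
    then show ?thesis
    proof cases
      case 1
      then show ?thesis
        using m(3) that by simp
    next
      case 2
      then show ?thesis
        using pow[of m 0] by (auto intro!: cong_mult)
    next
      case (3 k)
      have "cst (a n) * (r2 * (r1 ^ m * W n)) \<approx> cst (a n) * (r2 * W (Suc k))"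
        unfolding 3 by (intro cong_mult cong_refl pow)
      also have "\<dots> \<approx> cst (a n) * 0"
        by (intro cong_mult cong_refl r2W)
      finally show ?thesis
        using 3 by simp
    qed
  qed
  \<comment> \<open>\<open>r2 * r1 ^ m\<close> isolates the lowest term of the relation: smaller
    indices have coefficient 0, larger ones keep a positive index and are annihilated. The factor
    \<open>d * s2\<close> finally turns \<open>r2 * W 0\<close> into \<open>e\<close>.\<close>
  have "r2 * r1 ^ m * e * c * (\<Sum>n\<in>N. cst (a n) * X n) \<approx> r2 * r1 ^ m * e * c * 0"
    by (intro cong_mult cong_refl rel)
  then have "0 \<approx> r2 * r1 ^ m * e * c * (\<Sum>n\<in>N. cst (a n) * X n)"
    by (simp add: cong_sym)
  also have "\<dots> = (\<Sum>n\<in>N. cst (a n) * (r2 * (r1 ^ m * W n)))"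
    by (simp add: W_def sum_distrib_left cst_left_commute mult.assoc)
  also have "\<dots> \<approx> (\<Sum>n\<in>N. if n = m then cst (a m) * (r2 * W 0) else 0)"
    by (intro cong_sum summand)
  also have "\<dots> = cst (a m) * (r2 * W 0)"
    using m(1) by (simp add: N_def)
  finally have "0 \<approx> cst (a m) * (r2 * W 0)" .
  then have "cst (a m) * (r2 * W 0) \<in> J"
    by (rule cong_zero_iff[THEN iffD1, OF cong_sym])
  then have "cst (1 / a m) * (cst (a m) * (r2 * W 0)) * (d * s2) \<in> J"
    by (rule mult_mem_right[OF mult_mem_left])
  moreover have "cst (1 / a m) * (cst (a m) * (r2 * W 0)) = r2 * W 0"
    using m(2) by (simp flip: mult.assoc cst_mult)
  moreover have "r2 * W 0 * (d * s2) \<approx> e"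
    unfolding W_def X0 by (rule cls_eqD, simp add: cls_hom rules)
  ultimately show ?thesis
    using cong_mem by metis
qed

end

section \<open>The ideal generated by \<open>P_ppi\<close>\<close>

text \<open>For empty \<open>X\<close> this is the ideal of the defining relations in the ambient
  algebra.\<close>

definition gideal :: "('v, 'e) pre_digraph \<Rightarrow> 'v set \<Rightarrow> (('v, 'e) lpa_gen word \<Rightarrow>\<^sub>0 'k::field) set" where
  "gideal E X = \<Inter>{J. lpa_good E J \<and> vx ` X \<subseteq> J}"

lemma gideal_good: "lpa_good E (gideal E X)"
  unfolding lpa_good_def ring_ideal_def gideal_def by blast

lemma gideal_least: "lpa_good E J \<Longrightarrow> vx ` X \<subseteq> J \<Longrightarrow> gideal E X \<subseteq> J"
  unfolding gideal_def by blast

lemma vx_gideal: "v \<in> X \<Longrightarrow> vx v \<in> gideal E X"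
  unfolding gideal_def by blast

lemma gideal_mono: "X \<subseteq> Y \<Longrightarrow> gideal E X \<subseteq> gideal E Y"
  unfolding gideal_def by blast

text \<open>A word with a foreign letter lies in every good ideal, so coefficients may be replaced
  by ones over the letters of the graph.\<close>

lemma (in lpa_cong) restr_cong: "x \<approx> restr (lpa_gens E) x"
proof (induction x rule: word_induct)
  case (word c gs)
  show ?case
  proof (cases "set gs \<subseteq> lpa_gens E")
    case True
    then have "restr (lpa_gens E) (cst c * prod_list (map gen gs)) = cst c * prod_list (map gen gs)"
      by (simp add: restr_single flip: single_Word)
    then show ?thesis
      by simp
  next
    case False
    then obtain hs g ks where "gs = hs @ g # ks" "g \<notin> lpa_gens E"
      by (meson split_list subsetI)
    then have "cst c * prod_list (map gen gs) \<in> J"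
      by (simp add: mult_mem_left mult_mem_right bad)
    moreover have "restr (lpa_gens E) (cst c * prod_list (map gen gs)) = 0"
      using False by (simp add: restr_single flip: single_Word)
    ultimately show ?thesis
      by (simp add: cong_zero_iff)
  qed
next
  case (add x y)
  then show ?case
    by (simp add: restr_add cong_add)
qed

lemma tree_refl: "wf_digraph E \<Longrightarrow> v \<in> verts E \<Longrightarrow> v \<in> tree E v"
  using wf_digraph.awalk_Nil_iff by (fastforce simp: tree_def connects_def)

lemma tree_trans: "wf_digraph E \<Longrightarrow> w \<in> tree E v \<Longrightarrow> tree E w \<subseteq> tree E v"
  unfolding tree_def connects_def using wf_digraph.awalk_appendI by fast

lemma P_ppi_hereditary:
  assumes "wf_digraph E"
  shows "hereditary E (P_ppi E)"
  unfolding hereditary_def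
proof (intro conjI allI impI)
  fix v w assume v: "v \<in> P_ppi E" and "connects E v w"
  then have "w \<in> tree E v"
    using wf_digraph.awalk_last_in_verts[OF assms] by (auto simp: tree_def connects_def)
  then have "w \<in> verts E" "tree E w \<subseteq> tree E v"
    using tree_trans[OF assms] by (auto simp: tree_def)
  then show "w \<in> P_ppi E"
    using v unfolding P_ppi_def by blast
qed (auto simp: P_ppi_def)

lemma hs_closure_hereditary: "hereditary E (verts E) \<Longrightarrow> X \<subseteq> verts E \<Longrightarrow> hereditary E (hs_closure E X)"
  and hs_closure_saturated: "hereditary E (verts E) \<Longrightarrow> X \<subseteq> verts E \<Longrightarrow> saturated E (hs_closure E X)"
  and hs_closure_mono: "X \<subseteq> Y \<Longrightarrow> hs_closure E X \<subseteq> hs_closure E Y"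
  and hs_closure_superset: "X \<subseteq> hs_closure E X"
proof -
  assume h: "hereditary E (verts E)" "X \<subseteq> verts E"
  moreover have "saturated E (verts E)"
    by (auto simp: saturated_def regular_vertex_def)
  ultimately have "hs_closure E X \<subseteq> verts E"
    unfolding hs_closure_def by blast
  then show "hereditary E (hs_closure E X)" "saturated E (hs_closure E X)"
    unfolding hs_closure_def hereditary_def saturated_def by blast+
qed (auto simp: hs_closure_def)

lemma hereditary_verts: "wf_digraph E \<Longrightarrow> hereditary E (verts E)"
  using wf_digraph.awalk_last_in_verts by (fastforce simp: hereditary_def connects_def)

text \<open>The product regroups into two elements of the corner at \<open>w\<close>, one for
  \<open>a\<close> and one for \<open>b\<close>, followed by a factor common to both orders.\<close>

lemma (in lpa_cong) commutes_if_corner_commutes: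
  assumes w: "w \<in> verts E"
    and comm: "\<And>x y. (vx w * x * vx w) * (vx w * y * vx w) \<approx> (vx w * y * vx w) * (vx w * x * vx w)"
    and y: "y \<approx> vx w * y * vx w"
  shows "y * a * y * b * y \<approx> y * b * y * a * y"
proof -
  have 1: "y * a * y * b * y \<approx> ((vx w * (y * vx w * a) * vx w) * (vx w * (y * vx w * b) * vx w)) * (y * vx w)" for a b
  proof -
    have "y * a * y * b * y \<approx> (vx w * y * vx w) * a * (vx w * y * vx w) * b * (vx w * y * vx w)"
      by (intro cong_mult cong_refl y)
    also have "\<dots> \<approx> ((vx w * (y * vx w * a) * vx w) * (vx w * (y * vx w * b) * vx w)) * (y * vx w)"
      by (rule cls_eqD) (simp add: cls_hom cls_rule[OF vx_idem[OF w]])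
    finally show ?thesis .
  qed
  have "y * a * y * b * y \<approx> ((vx w * (y * vx w * b) * vx w) * (vx w * (y * vx w * a) * vx w)) * (y * vx w)"
    by (rule cong_trans[OF 1]) (intro cong_mult[OF comm cong_refl])
  then show ?thesis
    by (rule cong_trans[OF _ cong_sym[OF 1]])
qed

lemma (in lpa_cong) properly_infinite_noncommutative:
  assumes v: "properly_infinite E v"
    and comm: "\<And>a b. vx v * a * vx v * b * vx v \<approx> vx v * b * vx v * a * vx v"
  shows "vx v \<in> J"
proof -
  have "v \<in> verts E"
    using v by (simp add: properly_infinite_def)
  obtain r1 r2 s1 s2 where "r1 * vx v * s1 \<approx> vx v" "r2 * vx v * s1 \<approx> 0" "r2 * vx v * s2 \<approx> vx v"
    using properly_infinite_kset[OF v] unfolding kset_def by blast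
  then show ?thesis
    using vx_idem[OF \<open>v \<in> verts E\<close>]
    by (intro commutative_corner[OF comm, where c = 1 and d = 1 and ?r1.0 = r1 and ?s1.0 = s1 and ?r2.0 = r2 and ?s2.0 = s2]) auto
qed

text \<open>With \<open>xi = e si e\<close> and \<open>yi = e ri e\<close>, the equations give
  \<open>y1 x1 = e\<close>, \<open>y2 x2 = e\<close> and \<open>y2 x1 = 0\<close>. Replacing
  \<open>x2\<close> by \<open>(e - x1 y1) x2\<close> yields the second orthogonality relation as
  well, so modulo \<open>J\<close> the nonzero idempotent \<open>e\<close> contains two orthogonal
  copies of itself.\<close>

definition (in ring_cong) pinf_witness :: "'a \<Rightarrow> 'a \<Rightarrow> 'a \<Rightarrow> 'a \<Rightarrow> 'a \<Rightarrow> bool" where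
  "pinf_witness e r1 r2 s1 s2 \<longleftrightarrow> e \<notin> J \<and> e * e \<approx> e \<and> r1 * e * s1 \<approx> e \<and> r2 * e * s2 \<approx> e \<and> r2 * e * s1 \<approx> 0"

text \<open>Only the case \<open>vertex\<close> of the reduction is possible. In the case
  \<open>cycle\<close> a properly infinite vertex would have a commutative nonzero corner modulo the
  ideal of \<open>exists_commutative_ideal\<close>; in the case \<open>emitter\<close> the vertex
  would be breaking or have a one-dimensional corner.\<close>

lemma P_ppi_pinf:
  fixes J :: "(('v, 'e) lpa_gen word \<Rightarrow>\<^sub>0 'k::field) set"
  assumes wf: "wf_digraph E" and J: "lpa_good E J"
    and a: "a \<in> gideal E (P_ppi E)" "a \<notin> J"
  shows "\<exists>c\<in>carrier (free_algebra (lpa_gens E)). \<exists>d\<in>carrier (free_algebra (lpa_gens E)).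
    \<exists>r1\<in>carrier (free_algebra (lpa_gens E)). \<exists>r2\<in>carrier (free_algebra (lpa_gens E)).
    \<exists>s1\<in>carrier (free_algebra (lpa_gens E)). \<exists>s2\<in>carrier (free_algebra (lpa_gens E)).
      ring_cong.pinf_witness J (c * a * d) r1 r2 s1 s2"
proof -
  interpret lpa_cong E J
    by (rule lpa_good_locale[OF wf J])
  let ?S = "P_ppi E" and ?A = "carrier (free_algebra (lpa_gens E) :: ('k, _) module)" and ?r = "restr (lpa_gens E)"
  have S: "hereditary E ?S"
    by (rule P_ppi_hereditary[OF wf])
  have Sv: "?S \<subseteq> verts E"
    by (auto simp: P_ppi_def)
  have pi: "properly_infinite E u" and nb: "\<not> breaking_vertex E u" if "u \<in> ?S" for u
    using that tree_refl[OF wf, of u] by (auto simp: P_ppi_def P_pi_def)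
  have "vx ` ?S \<subseteq> lspan mon (midx ?S)"
    using vx_lspan[OF _ Sv] by blast
  then have al: "a \<in> lspan mon (midx ?S)"
    using gideal_least[OF lspan_good[OF S]] a(1) by blast
  show ?thesis
  proof (cases rule: reduction[OF S al a(2)])
    case (1 c d u)
    obtain r1 r2 s1 s2 where r: "r1 * vx u * s1 \<approx> vx u" "r2 * vx u * s1 \<approx> 0" "r2 * vx u * s2 \<approx> vx u"
      using properly_infinite_kset[OF pi[OF 1(1)]] unfolding kset_def by blast
    have uA: "vx u \<in> ?A"
      using 1(2) by (intro carrier_gen) (simp add: lpa_gens_def)
    \<comment> \<open>The witnesses must lie in the nonunital carrier: \<open>restr\<close> removes
      foreign letters, and the factor \<open>vx u\<close> removes constant terms.\<close>
    have L: "vx u * ?r x \<approx> vx u * x" and R: "?r x * vx u \<approx> x * vx u" for x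
      by (intro cong_mult cong_refl cong_sym[OF restr_cong])+
    have vi: "vx u * vx u \<approx> vx u"
      using 1(2) by (rule vx_idem)
    have *: "(vx u * ?r x) * z * (?r y * vx u) \<approx> vx u * w * vx u" if "x * z * y \<approx> w" for x y z w
    proof -
      have "(vx u * ?r x) * z * (?r y * vx u) \<approx> (vx u * x) * z * (y * vx u)"
        by (intro cong_mult cong_refl L R)
      also have "\<dots> = vx u * (x * z * y) * vx u"
        by (simp add: mult.assoc)
      also have "\<dots> \<approx> vx u * w * vx u"
        by (intro cong_mult cong_refl that)
      finally show ?thesis .
    qed
    have **: "vx u * vx u * vx u \<approx> vx u"
      by (rule cls_eqD) (simp add: cls_hom cls_rule[OF vi])
    let ?e = "(vx u * ?r c) * a * (?r d * vx u)"
    have e: "?e \<approx> vx u"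
      by (rule cong_trans[OF *[OF 1(4)] **])
    have re: "(vx u * ?r x) * ?e * (?r y * vx u) \<approx> vx u * w * vx u" if "x * vx u * y \<approx> w" for x y w
      by (rule cong_trans[OF _ *[OF that]]) (intro cong_mult cong_refl e)
    have "pinf_witness ?e (vx u * ?r r1) (vx u * ?r r2) (?r s1 * vx u) (?r s2 * vx u)"
      unfolding pinf_witness_def
    proof (intro conjI)
      show "?e \<notin> J"
        using cong_mem[OF e] 1(3) by simp
      show "?e * ?e \<approx> ?e"
        by (rule cong_trans[OF cong_mult[OF e e] cong_trans[OF vi cong_sym[OF e]]])
      show "(vx u * ?r r1) * ?e * (?r s1 * vx u) \<approx> ?e" "(vx u * ?r r2) * ?e * (?r s2 * vx u) \<approx> ?e"
        by (rule cong_trans[OF cong_trans[OF re[OF r(1)] **] cong_sym[OF e]],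
            rule cong_trans[OF cong_trans[OF re[OF r(3)] **] cong_sym[OF e]])
      show "(vx u * ?r r2) * ?e * (?r s1 * vx u) \<approx> 0"
        using re[OF r(2)] by simp
    qed
    moreover have "vx u * ?r x \<in> ?A" "?r x * vx u \<in> ?A" for x
      using uA by (rule carrier_mult_restr, rule carrier_restr_mult)
    ultimately show ?thesis
      by blast
  next
    case (2 c d u k r p)
    obtain J' :: "(('v, 'e) lpa_gen word \<Rightarrow>\<^sub>0 'k) set" where J': "lpa_good E J'"
      "\<And>v. v \<in> verts E \<Longrightarrow> vx v \<in> J' \<longleftrightarrow> \<not> connects E v u"
      "\<And>x y. (vx u * x * vx u) * (vx u * y * vx u) - (vx u * y * vx u) * (vx u * x * vx u) \<in> J'"
      "\<And>k G \<kappa>. k \<noteq> 0 \<Longrightarrow> [] \<notin> G \<Longrightarrow> cst k * vx u + (\<Sum>\<gamma>\<in>G. cst (\<kappa> \<gamma>) * (vx u * pth \<gamma> * vx u)) \<notin> J'"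
      by (rule exists_commutative_ideal[OF wf 2(4)], rule that)
    interpret J': lpa_cong E J'
      by (rule lpa_good_locale[OF wf J'(1)])
    have comm: "J'.cong ((vx u * x * vx u) * (vx u * y * vx u)) ((vx u * y * vx u) * (vx u * x * vx u))" for x y
      using J'(3) by (simp add: J'.cong_def)
    have vi: "J'.cong (vx u) (vx u * vx u * vx u)"
      by (rule J'.cls_eqD) (simp add: J'.cls_hom J'.cls_rule[OF J'.vx_idem[OF 2(2)]])
    have "vx u \<in> J'"
      by (rule J'.properly_infinite_noncommutative[OF pi[OF 2(1)] J'.commutes_if_corner_commutes[OF 2(2) comm vi]])
    then show ?thesis
      using J'(4)[of 1 "{}"] by simp
  next
    case (3 c d u)
    have uv: "u \<in> verts E"
      using 3(2) by (simp add: infinite_emitter_def)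
    show ?thesis
    proof (cases "esc u = {}")
      case True
      then have "hat u = vx u"
        by (simp add: hat_def)
      then have "vx u \<in> J"
        using hat_commutes[OF uv 3(3)] by (intro properly_infinite_noncommutative pi 3(1)) simp
      then show ?thesis
        using 3(4) by simp
    next
      case False
      \<comment> \<open>The set \<open>killed\<close> itself is the hereditary saturated set for
        which \<open>u\<close> is breaking.\<close>
      have "{e \<in> out_arcs E u. head E e \<in> verts E - killed} = esc u"
        by (auto simp: esc_def)
      then have "u \<in> breaking_set E killed"
        using 3 uv False by (auto simp: breaking_set_def Let_def card_gt_0_iff killed_def)
      then have "breaking_vertex E u"
        using killed_hereditary killed_saturated unfolding breaking_vertex_def by blast
      then show ?thesis
        using nb[OF 3(1)] by simp
    qed
  qed
qed

text \<open>The ring-theoretic property of an ideal, expressed in the ambient algebra. It is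
  demanded only of elements over the letters of the graph, and the witnesses may come from the whole
  ambient algebra.\<close>

locale pinf_ideal =
  fixes E :: "('v, 'e) pre_digraph" and I :: "(('v, 'e) lpa_gen word \<Rightarrow>\<^sub>0 'k::field) set"
  assumes wf: "wf_digraph E" and good: "lpa_good E I"
    and pinf: "\<And>J a. lpa_good E J \<Longrightarrow> a \<in> carrier (free_algebra (lpa_gens E)) \<Longrightarrow> a \<in> I \<Longrightarrow> a \<notin> J \<Longrightarrow>
      \<exists>c d r1 r2 s1 s2. ring_cong.pinf_witness J (c * a * d) r1 r2 s1 s2"
begin

sublocale I: lpa_cong E I
  by (rule lpa_good_locale[OF wf good])

text \<open>Elements of \<open>I\<close> outside \<open>J\<close> dominate a properly infinite
  idempotent, which \<open>commutative_corner\<close> forbids. Except for the acyclic corner, all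
  conclusions from \<open>pinf\<close> go through this lemma.\<close>

lemma commutative_mem:
  assumes J: "lpa_good E J" and y: "y \<in> I" and u: "u \<in> verts E"
    and corner: "ring_cong.cong J y (vx u * y * vx u)"
    and comm: "\<And>a b. ring_cong.cong J (y * a * y * b * y) (y * b * y * a * y)"
  shows "y \<in> J"
proof (rule ccontr)
  assume "y \<notin> J"
  interpret J: lpa_cong E J
    by (rule lpa_good_locale[OF wf J])
  \<comment> \<open>A congruent replacement of \<open>y\<close> to which \<open>pinf\<close>
    applies. It stays in \<open>I\<close>, since \<open>I\<close> is good as well.\<close>
  define z where "z = vx u * restr (lpa_gens E) y * vx u"
  have zA: "z \<in> carrier (free_algebra (lpa_gens E))"
    unfolding z_def using u by (intro carrier_mult carrier_mult_restr carrier_gen) (auto simp: lpa_gens_def)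
  have "restr (lpa_gens E) y \<in> I"
    using I.cong_mem[OF I.restr_cong] y by blast
  then have zI: "z \<in> I"
    unfolding z_def by (intro I.mult_mem_left I.mult_mem_right)
  have zy: "J.cong z y"
    unfolding z_def
    by (rule J.cong_trans[OF _ J.cong_sym[OF corner]])
      (intro J.cong_mult J.cong_refl J.cong_sym[OF J.restr_cong])
  have "z \<notin> J"
    using J.cong_mem[OF zy] \<open>y \<notin> J\<close> by simp
  then obtain c d r1 r2 s1 s2 where w: "J.pinf_witness (c * z * d) r1 r2 s1 s2"
    using pinf[OF J zA zI] by blast
  have eq: "J.cong (z * a * z * b * z) (y * a * y * b * y)" for a b
    by (intro J.cong_mult J.cong_refl zy)
  have "J.cong (z * a * z * b * z) (z * b * z * a * z)" for a b
    by (rule J.cong_trans[OF J.cong_trans[OF eq comm] J.cong_sym[OF eq]])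
  then have "c * z * d \<in> J"
    using w unfolding J.pinf_witness_def by (elim conjE) (rule J.commutative_corner[where y = z and c = c and d = d], auto)
  then show False
    using w by (simp add: J.pinf_witness_def)
qed

lemma hat_mem:
  assumes J: "lpa_good E J" and u: "infinite_emitter E u" "finite (lpa_cong.esc E J u)"
    and hI: "lpa_cong.hat E J u \<in> I"
  shows "lpa_cong.hat E J u \<in> J"
proof -
  interpret J: lpa_cong E J
    by (rule lpa_good_locale[OF wf J])
  have uv: "u \<in> verts E"
    using u by (simp add: infinite_emitter_def)
  have "J.cong (vx u * J.hat u * vx u) (J.hat u * vx u)"
    by (intro J.cong_mult J.cong_refl J.vx_hat uv u)
  moreover have "J.cong (J.hat u * vx u) (J.hat u)"
    using J.hat_vx[OF uv u(2) uv] by simp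
  ultimately have "J.cong (J.hat u) (vx u * J.hat u * vx u)"
    by (rule J.cong_sym[OF J.cong_trans])
  then show ?thesis
    by (rule commutative_mem[OF J hI uv _ J.hat_commutes[OF uv u(2)]])
qed

text \<open>The ideal of \<open>exists_commutative_ideal\<close> makes the corner at
  \<open>u\<close> commutative, yet contains no such combination with nonzero constant term. With
  empty \<open>G\<close> this excludes the vertex itself.\<close>

lemma cycle_mem:
  assumes u: "CSP E u = {p}" and y: "y \<in> I"
    and y_eq: "y = cst k * vx u + (\<Sum>\<gamma>\<in>G. cst (\<kappa> \<gamma>) * (vx u * pth \<gamma> * vx u))" "[] \<notin> G"
  shows "k = 0"
proof (rule ccontr)
  assume "k \<noteq> 0"
  obtain J' :: "(('v, 'e) lpa_gen word \<Rightarrow>\<^sub>0 'k) set" where J': "lpa_good E J'"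
      "\<And>v. v \<in> verts E \<Longrightarrow> vx v \<in> J' \<longleftrightarrow> \<not> connects E v u"
    "\<And>x y. (vx u * x * vx u) * (vx u * y * vx u) - (vx u * y * vx u) * (vx u * x * vx u) \<in> J'"
    "\<And>k G \<kappa>. k \<noteq> 0 \<Longrightarrow> [] \<notin> G \<Longrightarrow> cst k * vx u + (\<Sum>\<gamma>\<in>G. cst (\<kappa> \<gamma>) * (vx u * pth \<gamma> * vx u)) \<notin> J'"
    by (rule exists_commutative_ideal[OF wf u], rule that)
  interpret J': lpa_cong E J'
    by (rule lpa_good_locale[OF wf J'(1)])
  have "p \<in> CSP E u"
    using u by simp
  then have uv: "u \<in> verts E"
    by (auto simp: CSP_def)
  have 3: "J'.cong (vx u * (vx u * a * vx u) * vx u) (vx u * a * vx u)" for a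
    by (rule J'.cls_eqD) (simp add: J'.cls_hom J'.cls_rule[OF J'.vx_idem[OF uv]])
  have vi: "J'.cong (vx u * vx u * vx u) (vx u)"
    by (rule J'.cls_eqD) (simp add: J'.cls_hom J'.cls_rule[OF J'.vx_idem[OF uv]])
  have "vx u * y * vx u = cst k * (vx u * vx u * vx u)
      + (\<Sum>\<gamma>\<in>G. cst (\<kappa> \<gamma>) * (vx u * (vx u * pth \<gamma> * vx u) * vx u))"
    unfolding y_eq
    by (simp add: distrib_left distrib_right sum_distrib_left sum_distrib_right cst_left_commute mult.assoc)
  then have "J'.cong (vx u * y * vx u) y"
    unfolding y_eq(1)[symmetric]
    by (simp only:) (subst y_eq(1), intro J'.cong_add J'.cong_sum J'.cong_mult J'.cong_refl vi 3)
  then have c: "J'.cong y (vx u * y * vx u)"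
    by (rule J'.cong_sym)
  have comm: "J'.cong ((vx u * x * vx u) * (vx u * y * vx u)) ((vx u * y * vx u) * (vx u * x * vx u))" for x y
    using J'(3) by (simp add: J'.cong_def)
  have "y \<in> J'"
    by (rule commutative_mem[OF J'(1) y uv c J'.commutes_if_corner_commutes[OF uv comm c]])
  then show False
    using J'(4)[OF \<open>k \<noteq> 0\<close> y_eq(2)] y_eq(1) by blast
qed

text \<open>Take an ideal whose vertices are exactly the set for which \<open>v\<close> breaks.
  \<open>hat v\<close> is in \<open>I\<close> along with \<open>v\<close>, so \<open>hat_mem\<close>
  puts it into that ideal; but \<open>exists_ideal_killing\<close> keeps such differences
  out.\<close>

lemma killed_not_breaking:
  assumes v: "v \<in> I.killed"
  shows "\<not> breaking_vertex E v"
proof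
  assume "breaking_vertex E v"
  then obtain X where X: "hereditary E X" "saturated E X" and b: "v \<in> breaking_set E X"
    unfolding breaking_vertex_def by blast
  obtain J :: "(('v, 'e) lpa_gen word \<Rightarrow>\<^sub>0 'k) set" where J: "lpa_good E J"
    "\<And>v. v \<in> verts E \<Longrightarrow> vx v \<in> J \<longleftrightarrow> v \<in> X"
    "\<And>v F. infinite_emitter E v \<Longrightarrow> v \<notin> X \<Longrightarrow> F \<subseteq> out_arcs E v \<Longrightarrow> vx v - (\<Sum>e\<in>F. ed e * gh e) \<notin> J"
    by (rule exists_ideal_killing[OF wf X], rule that)
  interpret J: lpa_cong E J
    by (rule lpa_good_locale[OF wf J(1)])
  have "J.killed = X"
    using J(2) X(1) by (auto simp: J.killed_def hereditary_def)
  then have esc: "J.esc v = {e \<in> out_arcs E v. head E e \<in> verts E - X}"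
    by (auto simp: J.esc_def)
  then have fin: "finite (J.esc v)" and em: "infinite_emitter E v" and vX: "v \<notin> X"
    using b by (auto simp: breaking_set_def Let_def)
  have "ed e \<in> I" if "e \<in> J.esc v" for e
    using that v I.cong_mem[OF I.absorb(1), of e] by (auto simp: J.esc_def I.killed_def I.mult_mem_right)
  then have "J.hat v \<in> I"
    unfolding J.hat_def using v by (intro I.diff_mem I.sum_mem I.mult_mem_right) (auto simp: I.killed_def)
  then have "J.hat v \<in> J"
    by (rule hat_mem[OF J(1) em fin])
  moreover have "J.esc v \<subseteq> out_arcs E v"
    by (auto simp: J.esc_def)
  ultimately show False
    using J(3)[OF em vX] by (simp add: J.hat_def)
qed

text \<open>Otherwise \<open>v\<close> survives when everything below it with two closed simple
  paths is factored out. A surviving vertex with a closed simple path then has only one, which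
  \<open>cycle_mem\<close> excludes; if there is none, \<open>acyclic_corner\<close>
  applies.\<close>

lemma killed_properly_infinite:
  assumes v: "v \<in> I.killed"
  shows "properly_infinite E v"
proof (rule ccontr)
  assume np: "\<not> properly_infinite E v"
  have vv: "v \<in> verts E"
    using v by (simp add: I.killed_def)
  define W0 where "W0 = {w \<in> tree E v. \<exists>a b. a \<in> CSP E w \<and> b \<in> CSP E w \<and> a \<noteq> b}"
  have W0v: "W \<subseteq> verts E" if "W \<subseteq> W0" for W
    using that by (auto simp: W0_def tree_def)
  \<comment> \<open>\<open>properly_infinite\<close> admits only finite \<open>W\<close>, so the
    closures of finite sets are united. The union is saturated, as a regular vertex emits finitely
    many edges and the finite sets belonging to their ranges can be merged.\<close>
  define X where "X = (\<Union>W\<in>{W. finite W \<and> W \<subseteq> W0}. hs_closure E W)"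
  note hv = hereditary_verts[OF wf]
  have vX: "v \<notin> X"
    using np vv unfolding properly_infinite_def two_CSP X_def W0_def by blast
  have W0X: "w \<in> X" if "w \<in> W0" for w
    using that hs_closure_superset[of "{w}" E] by (auto simp: X_def intro!: exI[of _ "{w}"])
  have hX: "hereditary E X"
    using hs_closure_hereditary[OF hv W0v] unfolding X_def hereditary_def by blast
  have sX: "saturated E X"
    unfolding saturated_def
  proof (intro conjI allI impI)
    show "X \<subseteq> verts E"
      using hX by (simp add: hereditary_def)
    fix u assume u: "regular_vertex E u" and h: "head E ` out_arcs E u \<subseteq> X"
    have "\<exists>W. finite W \<and> W \<subseteq> W0 \<and> head E e \<in> hs_closure E W" if "e \<in> out_arcs E u" for e
    proof -
      have "head E e \<in> X"
        using that h by blast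
      then show ?thesis
        unfolding X_def by blast
    qed
    then obtain Wf where Wf: "\<And>e. e \<in> out_arcs E u \<Longrightarrow> finite (Wf e) \<and> Wf e \<subseteq> W0 \<and> head E e \<in> hs_closure E (Wf e)"
      by metis
    define W where "W = (\<Union>e\<in>out_arcs E u. Wf e)"
    have "finite (out_arcs E u)"
      using u by (auto simp: regular_vertex_def infinite_emitter_def)
    then have "finite W"
      using Wf unfolding W_def by blast
    moreover have "W \<subseteq> W0"
      using Wf unfolding W_def by blast
    ultimately have W: "finite W" "W \<subseteq> W0"
      by simp_all
    have "head E e \<in> hs_closure E W" if "e \<in> out_arcs E u" for e
    proof -
      have "Wf e \<subseteq> W"
        using that unfolding W_def by blast
      then show ?thesis
        using Wf[OF that] hs_closure_mono by blast
    qed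
    then have "u \<in> hs_closure E W"
      using hs_closure_saturated[OF hv W0v[OF W(2)]] u by (auto simp: saturated_def)
    then show "u \<in> X"
      using W unfolding X_def by blast
  qed
  show False
  proof (cases "\<exists>w\<in>tree E v. w \<notin> X \<and> CSP E w \<noteq> {}")
    case True
    then obtain w p where w: "w \<in> tree E v" "w \<notin> X" "p \<in> CSP E w"
      by blast
    then have "CSP E w = {p}"
      using W0X by (auto simp: W0_def)
    moreover have "w \<in> I.killed"
      using w(1) v I.killed_hereditary by (auto simp: tree_def hereditary_def)
    ultimately have "(1 :: 'k) = 0"
      by (intro cycle_mem[where u = w and p = p and y = "vx w" and k = 1 and G = "{}"]) (auto simp: I.killed_def)
    then show False
      by simp
  next
    case False
    obtain J :: "(('v, 'e) lpa_gen word \<Rightarrow>\<^sub>0 'k) set" where J: "lpa_good E J"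
      "\<And>v. v \<in> verts E \<Longrightarrow> vx v \<in> J \<longleftrightarrow> v \<in> X"
      "\<And>v F. infinite_emitter E v \<Longrightarrow> v \<notin> X \<Longrightarrow> F \<subseteq> out_arcs E v \<Longrightarrow> vx v - (\<Sum>e\<in>F. ed e * gh e) \<notin> J"
      by (rule exists_ideal_killing[OF wf hX sX], rule that)
    interpret J: lpa_cong E J
      by (rule lpa_good_locale[OF wf J(1)])
    have "vx v \<in> carrier (free_algebra (lpa_gens E) :: ('k, _) module)"
      using vv by (intro carrier_gen) (simp add: lpa_gens_def)
    moreover have "vx v \<in> I" "vx v \<notin> J"
      using v vX J(2)[OF vv] by (auto simp: I.killed_def)
    ultimately obtain c d r1 r2 s1 s2 where w: "J.pinf_witness (c * vx v * d) r1 r2 s1 s2"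
      using pinf[OF J(1)] by blast
    have acyclic: "CSP E w = {}" if "connects E v w" "vx w \<notin> J" for w
    proof -
      have "w \<in> verts E"
        using that(1) wf_digraph.awalk_last_in_verts[OF wf] by (auto simp: connects_def)
      then show ?thesis
        using False that J(2) by (auto simp: tree_def)
    qed
    have "c * vx v * d \<in> J"
      using w unfolding J.pinf_witness_def
      by (elim conjE) (rule J.acyclic_corner[OF vv acyclic, where c = c and d = d], auto)
    then show False
      using w by (simp add: J.pinf_witness_def)
  qed
qed

lemma killed_P_ppi: "I.killed \<subseteq> P_ppi E"
proof
  fix v assume v: "v \<in> I.killed"
  then have "tree E v \<subseteq> I.killed"
    using I.killed_hereditary by (auto simp: tree_def hereditary_def)
  then show "v \<in> P_ppi E"
    using v killed_not_breaking killed_properly_infinite by (auto simp: P_ppi_def P_pi_def I.killed_def)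
qed

text \<open>\<open>I\<close> is generated by its vertices: an element outside the ideal
  \<open>?J\<close> of these would reduce modulo \<open>?J\<close> to a normal form. This still lies
  in \<open>I\<close>, because \<open>?J\<close> is contained in \<open>I\<close>, and all three
  normal forms are excluded.\<close>

theorem subset_P_ppi_ideal:
  assumes x: "x \<in> carrier (free_algebra (lpa_gens E))" "x \<in> I"
  shows "x \<in> gideal E (P_ppi E)"
proof -
  let ?J = "gideal E I.killed :: (('v, 'e) lpa_gen word \<Rightarrow>\<^sub>0 'k) set"
  interpret J: lpa_cong E ?J
    by (rule lpa_good_locale[OF wf gideal_good])
  have sub: "?J \<subseteq> I"
    by (rule gideal_least[OF good]) (auto simp: I.killed_def)
  have mem: "y \<in> I" if "J.cong (c * x * d) y" for c d y
  proof -
    have "I.cong (c * x * d) y"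
      using that sub by (auto simp: J.cong_def I.cong_def)
    then show ?thesis
      using I.cong_mem x(2) I.mult_mem_left I.mult_mem_right by blast
  qed
  have kill: "vx u \<in> ?J" if "u \<in> verts E" "vx u \<in> I" for u
    using that by (intro vx_gideal) (simp add: I.killed_def)
  have "x \<in> ?J"
  proof (rule ccontr)
    assume "x \<notin> ?J"
    then show False
    proof (cases rule: J.reduction[OF hereditary_verts[OF wf] J.carrier_lspan[OF x(1)], consumes 1])
      case (1 c d u)
      then show False
        using mem[OF 1(4)] kill[OF 1(2)] by simp
    next
      case (2 c d u k r p)
      obtain G \<kappa> where G: "G \<subseteq> J.loops u" "J.cong r (\<Sum>\<gamma>\<in>G. cst (\<kappa> \<gamma>) * (vx u * pth \<gamma> * vx u))"
        using 2(6) unfolding J.lspan_def by blast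
      have "cst k * vx u + (\<Sum>\<gamma>\<in>G. cst (\<kappa> \<gamma>) * (vx u * pth \<gamma> * vx u)) \<in> I"
        by (rule mem[OF J.cong_trans[OF 2(7)]]) (intro J.cong_add J.cong_refl G)
      then have "k = 0"
        using G(1) by (intro cycle_mem[OF 2(4) _ refl]) (auto simp: J.loops_def)
      then show False
        using 2(5) by simp
    next
      case (3 c d u)
      then show False
        using hat_mem[OF gideal_good 3(2,3) mem[OF 3(6)]] by simp
    qed
  qed
  then show ?thesis
    using gideal_mono[OF killed_P_ppi] by blast
qed

end

section \<open>A ring-theoretic property of ideals\<close>

definition pre_rng :: "('a, 'm) ring_scheme \<Rightarrow> bool" where
  "pre_rng R \<longleftrightarrow> group (add_monoid R) \<and> (\<forall>x\<in>carrier R. \<forall>y\<in>carrier R. x \<otimes>\<^bsub>R\<^esub> y \<in> carrier R)"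

text \<open>Negatives appear as solutions of an equation, a form that passes directly through
  additive bijections.\<close>

lemma two_sided_ideal_iff:
  assumes "group (add_monoid R)"
  shows "two_sided_ideal I R \<longleftrightarrow> I \<subseteq> carrier R \<and> \<zero>\<^bsub>R\<^esub> \<in> I \<and> (\<forall>a\<in>I. \<forall>b\<in>I. a \<oplus>\<^bsub>R\<^esub> b \<in> I) \<and>
    (\<forall>a\<in>I. \<exists>b\<in>I. b \<oplus>\<^bsub>R\<^esub> a = \<zero>\<^bsub>R\<^esub>) \<and>
    (\<forall>a\<in>I. \<forall>x\<in>carrier R. x \<otimes>\<^bsub>R\<^esub> a \<in> I \<and> a \<otimes>\<^bsub>R\<^esub> x \<in> I)"
    (is "_ \<longleftrightarrow> ?rhs")
proof -
  interpret A: group "add_monoid R"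
    by fact
  have "additive_subgroup I R \<longleftrightarrow> I \<subseteq> carrier R \<and> \<zero>\<^bsub>R\<^esub> \<in> I \<and> (\<forall>a\<in>I. \<forall>b\<in>I. a \<oplus>\<^bsub>R\<^esub> b \<in> I) \<and>
    (\<forall>a\<in>I. \<exists>b\<in>I. b \<oplus>\<^bsub>R\<^esub> a = \<zero>\<^bsub>R\<^esub>)" (is "_ \<longleftrightarrow> ?r")
  proof
    assume "additive_subgroup I R"
    then have s: "subgroup I (add_monoid R)"
      by (simp add: additive_subgroup_def)
    then have "\<exists>b\<in>I. b \<oplus>\<^bsub>R\<^esub> a = \<zero>\<^bsub>R\<^esub>" if "a \<in> I" for a
      using subgroup.m_inv_closed[OF s that] A.l_inv[of a] subgroup.subset[OF s] that by auto
    then show ?r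
      using subgroup.subset[OF s] subgroup.one_closed[OF s] subgroup.m_closed[OF s] by auto
  next
    assume r: ?r
    have "inv\<^bsub>add_monoid R\<^esub> a \<in> I" if a: "a \<in> I" for a
    proof -
      obtain b where b: "b \<in> I" "b \<oplus>\<^bsub>R\<^esub> a = \<zero>\<^bsub>R\<^esub>"
        using r a by blast
      moreover have "a \<in> carrier R" "b \<in> carrier R"
        using r a b by blast+
      ultimately show ?thesis
        using A.inv_equality[of b a] by simp
    qed
    then show "additive_subgroup I R"
      using r unfolding additive_subgroup_def by (intro subgroup.intro) auto
  qed
  then show ?thesis
    unfolding two_sided_ideal_def by blast
qed

text \<open>Congruence without subtraction, so that an isomorphism need only respect sums.\<close>

definition modeq :: "('a, 'm) ring_scheme \<Rightarrow> 'a set \<Rightarrow> 'a \<Rightarrow> 'a \<Rightarrow> bool" where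
  "modeq R J a b \<longleftrightarrow> (\<exists>j\<in>J. a = b \<oplus>\<^bsub>R\<^esub> j)"

definition pinf_in :: "('a, 'm) ring_scheme \<Rightarrow> 'a set \<Rightarrow> 'a \<Rightarrow> 'a \<Rightarrow> 'a \<Rightarrow> 'a \<Rightarrow> 'a \<Rightarrow> bool" where
  "pinf_in R J e r1 r2 s1 s2 \<longleftrightarrow> e \<notin> J \<and> modeq R J (e \<otimes>\<^bsub>R\<^esub> e) e \<and>
     modeq R J (r1 \<otimes>\<^bsub>R\<^esub> e \<otimes>\<^bsub>R\<^esub> s1) e \<and> modeq R J (r2 \<otimes>\<^bsub>R\<^esub> e \<otimes>\<^bsub>R\<^esub> s2) e \<and> r2 \<otimes>\<^bsub>R\<^esub> e \<otimes>\<^bsub>R\<^esub> s1 \<in> J"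

definition dominates_pinf :: "('a, 'm) ring_scheme \<Rightarrow> 'a set \<Rightarrow> bool" where
  "dominates_pinf R I \<longleftrightarrow> (\<forall>J x. two_sided_ideal J R \<longrightarrow> x \<in> I \<longrightarrow> x \<notin> J \<longrightarrow>
     (\<exists>c\<in>carrier R. \<exists>d\<in>carrier R. \<exists>r1\<in>carrier R. \<exists>r2\<in>carrier R. \<exists>s1\<in>carrier R. \<exists>s2\<in>carrier R.
       pinf_in R J (c \<otimes>\<^bsub>R\<^esub> x \<otimes>\<^bsub>R\<^esub> d) r1 r2 s1 s2))"

section \<open>Transport along ring isomorphisms\<close>

context
  fixes R :: "('a, 'm) ring_scheme" and S :: "('b, 'n) ring_scheme" and \<phi>
  assumes R: "pre_rng R" and S: "pre_rng S" and phi: "\<phi> \<in> rng_iso R S"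
begin

lemma iso_facts:
  shows iso_mult: "x \<in> carrier R \<Longrightarrow> y \<in> carrier R \<Longrightarrow> \<phi> (x \<otimes>\<^bsub>R\<^esub> y) = \<phi> x \<otimes>\<^bsub>S\<^esub> \<phi> y"
    and iso_add: "x \<in> carrier R \<Longrightarrow> y \<in> carrier R \<Longrightarrow> \<phi> (x \<oplus>\<^bsub>R\<^esub> y) = \<phi> x \<oplus>\<^bsub>S\<^esub> \<phi> y"
    and iso_bij: "bij_betw \<phi> (carrier R) (carrier S)"
    and iso_closed: "x \<in> carrier R \<Longrightarrow> \<phi> x \<in> carrier S"
    and iso_zero: "\<phi> \<zero>\<^bsub>R\<^esub> = \<zero>\<^bsub>S\<^esub>"
proof -
  have "\<phi> \<in> hom (add_monoid R) (add_monoid S)"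
    using phi by (auto simp: rng_iso_def iso_def)
  then show "\<phi> \<zero>\<^bsub>R\<^esub> = \<zero>\<^bsub>S\<^esub>"
    using hom_one[of \<phi> "add_monoid R" "add_monoid S"] R S by (simp add: pre_rng_def)
qed (use phi in \<open>auto simp: rng_iso_def iso_def hom_def bij_betw_def\<close>)

lemma preimage_ideal:
  assumes "two_sided_ideal J S"
  shows "two_sided_ideal {x \<in> carrier R. \<phi> x \<in> J} R"
proof -
  interpret AR: group "add_monoid R"
    using R by (simp add: pre_rng_def)
  have gS: "group (add_monoid S)" and mR: "\<And>x y. x \<in> carrier R \<Longrightarrow> y \<in> carrier R \<Longrightarrow> x \<otimes>\<^bsub>R\<^esub> y \<in> carrier R"
    using R S by (auto simp: pre_rng_def)
  have J: "J \<subseteq> carrier S" "\<zero>\<^bsub>S\<^esub> \<in> J" "\<And>a b. a \<in> J \<Longrightarrow> b \<in> J \<Longrightarrow> a \<oplus>\<^bsub>S\<^esub> b \<in> J"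
    "\<And>a. a \<in> J \<Longrightarrow> \<exists>b\<in>J. b \<oplus>\<^bsub>S\<^esub> a = \<zero>\<^bsub>S\<^esub>"
    "\<And>a x. a \<in> J \<Longrightarrow> x \<in> carrier S \<Longrightarrow> x \<otimes>\<^bsub>S\<^esub> a \<in> J \<and> a \<otimes>\<^bsub>S\<^esub> x \<in> J"
    using assms unfolding two_sided_ideal_iff[OF gS] by blast+
  have cl: "\<zero>\<^bsub>R\<^esub> \<in> carrier R" "\<And>x y. x \<in> carrier R \<Longrightarrow> y \<in> carrier R \<Longrightarrow> x \<oplus>\<^bsub>R\<^esub> y \<in> carrier R"
    using AR.one_closed AR.m_closed by auto
  have neg: "\<exists>b\<in>{x \<in> carrier R. \<phi> x \<in> J}. b \<oplus>\<^bsub>R\<^esub> a = \<zero>\<^bsub>R\<^esub>" if a: "a \<in> carrier R" "\<phi> a \<in> J" for a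
  proof -
    obtain b' where b': "b' \<in> J" "b' \<oplus>\<^bsub>S\<^esub> \<phi> a = \<zero>\<^bsub>S\<^esub>"
      using J(4) a by blast
    then obtain b where b: "b \<in> carrier R" "b' = \<phi> b"
      using J(1) iso_bij by (auto simp: bij_betw_def)
    have "\<phi> (b \<oplus>\<^bsub>R\<^esub> a) = \<phi> \<zero>\<^bsub>R\<^esub>"
      using b b' a by (simp add: iso_add iso_zero)
    then have "b \<oplus>\<^bsub>R\<^esub> a = \<zero>\<^bsub>R\<^esub>"
      using iso_bij b a cl by (auto simp: bij_betw_def inj_on_def)
    then show ?thesis
      using b b' by auto
  qed
  show ?thesis
    unfolding two_sided_ideal_iff[OF AR.group_axioms]
    using J cl mR neg iso_mult iso_add iso_zero iso_closed by auto
qed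

lemma rng_iso_inverse: "inv_into (carrier R) \<phi> \<in> rng_iso S R"
proof -
  interpret AR: group "add_monoid R"
    using R by (simp add: pre_rng_def)
  have 1: "inv_into (carrier R) \<phi> \<in> iso (add_monoid S) (add_monoid R)"
    using AR.iso_set_sym[of \<phi> "add_monoid S"] phi by (simp add: rng_iso_def)
  let ?\<psi> = "inv_into (carrier R) \<phi>"
  have b: "bij_betw ?\<psi> (carrier S) (carrier R)"
    by (rule bij_betw_inv_into[OF iso_bij])
  then have cl: "?\<psi> y \<in> carrier R" if "y \<in> carrier S" for y
    using that by (auto simp: bij_betw_def)
  have "?\<psi> (x \<otimes>\<^bsub>S\<^esub> y) = ?\<psi> x \<otimes>\<^bsub>R\<^esub> ?\<psi> y" if "x \<in> carrier S" "y \<in> carrier S" for x y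
  proof -
    have "\<phi> (?\<psi> x \<otimes>\<^bsub>R\<^esub> ?\<psi> y) = x \<otimes>\<^bsub>S\<^esub> y"
      using that cl iso_mult bij_betw_inv_into_right[OF iso_bij] by simp
    moreover have "?\<psi> x \<otimes>\<^bsub>R\<^esub> ?\<psi> y \<in> carrier R"
      using cl that R by (simp add: pre_rng_def)
    ultimately show ?thesis
      using bij_betw_inv_into_left[OF iso_bij] by metis
  qed
  then have "?\<psi> \<in> iso S R"
    using b cl by (auto simp: iso_def hom_def)
  then show ?thesis
    using 1 by (simp add: rng_iso_def)
qed

text \<open>An ideal \<open>J\<close> of the target is tested through its preimage; the witnesses
  found there are mapped forward.\<close>

lemma dominates_pinf_image:
  assumes I: "I \<subseteq> carrier R" "dominates_pinf R I"
  shows "dominates_pinf S (\<phi> ` I)"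
  unfolding dominates_pinf_def
proof (intro allI impI)
  fix J y assume J: "two_sided_ideal J S" and y: "y \<in> \<phi> ` I" "y \<notin> J"
  let ?J = "{x \<in> carrier R. \<phi> x \<in> J}"
  have mR: "\<And>x y. x \<in> carrier R \<Longrightarrow> y \<in> carrier R \<Longrightarrow> x \<otimes>\<^bsub>R\<^esub> y \<in> carrier R"
    using R by (auto simp: pre_rng_def)
  obtain x where x: "x \<in> I" "y = \<phi> x" "x \<in> carrier R"
    using y I by auto
  obtain c d r1 r2 s1 s2 where w: "c \<in> carrier R" "d \<in> carrier R" "r1 \<in> carrier R" "r2 \<in> carrier R"
    "s1 \<in> carrier R" "s2 \<in> carrier R" and p: "pinf_in R ?J (c \<otimes>\<^bsub>R\<^esub> x \<otimes>\<^bsub>R\<^esub> d) r1 r2 s1 s2"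
    using I(2) preimage_ideal[OF J] x y(2) unfolding dominates_pinf_def by blast
  define e where "e = c \<otimes>\<^bsub>R\<^esub> x \<otimes>\<^bsub>R\<^esub> d"
  have e: "e \<in> carrier R"
    using w x mR by (simp add: e_def)
  have m: "modeq S J (\<phi> a) (\<phi> b)" if "modeq R ?J a b" "b \<in> carrier R" for a b
    using that iso_add by (auto simp: modeq_def)
  have "\<phi> c \<otimes>\<^bsub>S\<^esub> y \<otimes>\<^bsub>S\<^esub> \<phi> d = \<phi> e"
    using w x mR by (simp add: e_def iso_mult)
  moreover have "pinf_in S J (\<phi> e) (\<phi> r1) (\<phi> r2) (\<phi> s1) (\<phi> s2)"
    using p e w m[of _ e] mR unfolding pinf_in_def e_def[symmetric]
    by (simp flip: iso_mult)
  ultimately show "\<exists>c\<in>carrier S. \<exists>d\<in>carrier S. \<exists>r1\<in>carrier S. \<exists>r2\<in>carrier S. \<exists>s1\<in>carrier S. \<exists>s2\<in>carrier S.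
       pinf_in S J (c \<otimes>\<^bsub>S\<^esub> y \<otimes>\<^bsub>S\<^esub> d) r1 r2 s1 s2"
    using w iso_closed by metis
qed

end

section \<open>Ideals of the Leavitt path algebra\<close>

lemma free_algebra_simps [simp]:
  "monoid.mult (free_algebra X) = (*)" "add (free_algebra X) = (+)" "zero (free_algebra X) = 0"
  "smult (free_algebra X) c f = cst c * f"
  by (simp_all add: free_algebra_def cst_def mult_map_scale_conv_mult)

lemma free_algebra_group: "group (add_monoid (free_algebra X))"
proof (rule groupI)
  fix x assume "x \<in> carrier (add_monoid (free_algebra X))"
  then show "\<exists>y\<in>carrier (add_monoid (free_algebra X)). y \<otimes>\<^bsub>add_monoid (free_algebra X)\<^esub> x = \<one>\<^bsub>add_monoid (free_algebra X)\<^esub>"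
    by (intro bexI[of _ "- x"]) (auto intro: carrier_uminus)
qed (auto intro: carrier_add)

lemma relations_carrier:
  fixes E :: "('v, 'e) pre_digraph"
  assumes "wf_digraph E"
  shows "lpa_relations E \<subseteq> carrier (free_algebra (lpa_gens E) :: ('k::field, _) module)"
proof
  interpret wf_digraph E
    by fact
  fix x :: "('v, 'e) lpa_gen word \<Rightarrow>\<^sub>0 'k"
  assume "x \<in> lpa_relations E"
  then show "x \<in> carrier (free_algebra (lpa_gens E))"
    by cases (auto simp: regular_vertex_def lpa_gens_def
        intro!: carrier_diff carrier_sum carrier_mult carrier_gen)
qed

section \<open>Correspondence with ideals of the ambient algebra\<close>

context wf_digraph
begin

abbreviation lpa_free :: "('k::field, ('a, 'b) lpa_gen word \<Rightarrow>\<^sub>0 'k) module" where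
  "lpa_free \<equiv> free_algebra (lpa_gens G)"

abbreviation res :: "(('a, 'b) lpa_gen word \<Rightarrow>\<^sub>0 'k::field) \<Rightarrow> ('a, 'b) lpa_gen word \<Rightarrow>\<^sub>0 'k" where
  "res \<equiv> restr (lpa_gens G)"

definition pr :: "(('a, 'b) lpa_gen word \<Rightarrow>\<^sub>0 'k::field) \<Rightarrow> ('k, 'a, 'b) lpa" where
  "pr x = lpa_ideal G +>\<^bsub>lpa_free\<^esub> x"

lemma lpa_ideal_eq:
  "lpa_ideal G = carrier lpa_free \<inter> (gideal G {} :: (('a, 'b) lpa_gen word \<Rightarrow>\<^sub>0 'k::field) set)"
proof
  let ?N = "gideal G {} :: (('a, 'b) lpa_gen word \<Rightarrow>\<^sub>0 'k) set"
  interpret N: lpa_cong G ?N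
    by (rule lpa_good_locale[OF wf_digraph_axioms gideal_good])
  have "two_sided_ideal (carrier lpa_free \<inter> ?N) lpa_free"
    unfolding two_sided_ideal_iff[OF free_algebra_group]
    by (auto intro: carrier_add carrier_mult N.add_mem N.mult_mem_left N.mult_mem_right
        intro!: bexI[of _ "- _"] carrier_uminus N.uminus_mem)
  moreover have "\<forall>c. \<forall>a\<in>carrier lpa_free \<inter> ?N. c \<odot>\<^bsub>lpa_free\<^esub> a \<in> carrier lpa_free \<inter> ?N"
    by (auto intro: carrier_cst_mult N.mult_mem_left)
  moreover have "lpa_relations G \<subseteq> carrier lpa_free \<inter> ?N"
    using relations_carrier[OF wf_digraph_axioms] N.relations by blast
  ultimately show "lpa_ideal G \<subseteq> carrier lpa_free \<inter> ?N"
    unfolding lpa_ideal_def algebra_ideal_generated_def by blast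
  show "carrier lpa_free \<inter> ?N \<subseteq> lpa_ideal G"
    unfolding lpa_ideal_def algebra_ideal_generated_def
  proof (intro Inter_greatest subsetI)
    fix I :: "(('a, 'b) lpa_gen word \<Rightarrow>\<^sub>0 'k) set" and x
    assume I: "I \<in> {I. two_sided_ideal I lpa_free \<and> (\<forall>c. \<forall>a\<in>I. c \<odot>\<^bsub>lpa_free\<^esub> a \<in> I) \<and> lpa_relations G \<subseteq> I}"
      and x: "x \<in> carrier lpa_free \<inter> ?N"
    then have I': "0 \<in> I" "\<And>a b. a \<in> I \<Longrightarrow> b \<in> I \<Longrightarrow> a + b \<in> I" "\<And>c a. a \<in> I \<Longrightarrow> cst c * a \<in> I"
      "\<And>a x. a \<in> I \<Longrightarrow> x \<in> carrier lpa_free \<Longrightarrow> x * a \<in> I" "\<And>a x. a \<in> I \<Longrightarrow> x \<in> carrier lpa_free \<Longrightarrow> a * x \<in> I"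
      "lpa_relations G \<subseteq> I"
      unfolding two_sided_ideal_iff[OF free_algebra_group] by auto
    \<comment> \<open>The extension of \<open>I\<close> to the ambient algebra: \<open>res\<close>
      sends foreign letters to 0, so they belong to it automatically.\<close>
    let ?T = "{y. res y \<in> I}"
    have "ring_ideal ?T"
      by (rule ring_ideal_by_gens)
        (auto simp: restr_add restr_mult restr_gen intro: I' carrier_gen)
    moreover have "res y = y" if "y \<in> lpa_relations G" for y :: "('a, 'b) lpa_gen word \<Rightarrow>\<^sub>0 'k"
      using relations_carrier[OF wf_digraph_axioms] that restr_carrier by blast
    ultimately have "lpa_good G ?T"
      using I' by (auto simp: lpa_good_def restr_gen)
    then have "?N \<subseteq> ?T"
      by (rule gideal_least) simp
    then show "x \<in> I"
      using x by (auto simp: restr_carrier)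
  qed
qed

lemma pr_eq: "pr x = {n + x |n. n \<in> lpa_ideal G}"
  by (auto simp: pr_def a_r_coset_def')

lemma pr_eq_iff:
  assumes "x \<in> carrier lpa_free" "y \<in> carrier lpa_free"
  shows "pr x = pr y \<longleftrightarrow> x - y \<in> (gideal G {} :: (('a, 'b) lpa_gen word \<Rightarrow>\<^sub>0 'k::field) set)"
proof -
  let ?N = "gideal G {} :: (('a, 'b) lpa_gen word \<Rightarrow>\<^sub>0 'k) set"
  interpret N: lpa_cong G ?N
    by (rule lpa_good_locale[OF wf_digraph_axioms gideal_good])
  show ?thesis
  proof
    assume "pr x = pr y"
    moreover have "x \<in> pr x"
      by (auto simp: pr_eq lpa_ideal_eq intro!: exI[of _ 0])
    ultimately show "x - y \<in> ?N"
      by (auto simp: pr_eq lpa_ideal_eq)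
  next
    have *: "pr x \<subseteq> pr y" if "x - y \<in> ?N" "x \<in> carrier lpa_free" "y \<in> carrier lpa_free" for x y
    proof
      fix z assume "z \<in> pr x"
      then obtain n where "n \<in> carrier lpa_free" "n \<in> ?N" "z = n + x"
        by (auto simp: pr_eq lpa_ideal_eq)
      then show "z \<in> pr y"
        using that carrier_add[OF _ carrier_diff, of n _ x y] N.add_mem[of n "x - y"]
        by (auto simp: pr_eq lpa_ideal_eq intro!: exI[of _ "n + (x - y)"])
    qed
    assume "x - y \<in> ?N"
    then show "pr x = pr y"
      using *[OF _ assms] *[OF _ assms(2,1)] N.uminus_mem[of "x - y"] by auto
  qed
qed

abbreviation lpa_alg :: "('k::field, ('k, 'a, 'b) lpa) module" where
  "lpa_alg \<equiv> leavitt_path_algebra G"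

lemma
  fixes x y :: "('a, 'b) lpa_gen word \<Rightarrow>\<^sub>0 'k::field"
  shows lpa_carrier: "carrier lpa_alg = pr ` carrier (lpa_free :: ('k, _) module)"
    and lpa_zero: "zero lpa_alg = (pr 0 :: ('k, 'a, 'b) lpa)"
    and lpa_mult: "x \<in> carrier lpa_free \<Longrightarrow> y \<in> carrier lpa_free \<Longrightarrow> pr x \<otimes>\<^bsub>lpa_alg\<^esub> pr y = pr (x * y)"
    and lpa_add: "x \<in> carrier lpa_free \<Longrightarrow> y \<in> carrier lpa_free \<Longrightarrow> pr x \<oplus>\<^bsub>lpa_alg\<^esub> pr y = pr (x + y)"
proof -
  let ?N = "gideal G {} :: (('a, 'b) lpa_gen word \<Rightarrow>\<^sub>0 'k) set"
  interpret N: lpa_cong G ?N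
    by (rule lpa_good_locale[OF wf_digraph_axioms gideal_good])
  have L: "carrier lpa_alg = carrier (lpa_free Quot lpa_ideal G)"
    "zero lpa_alg = (lpa_ideal G :: ('k, 'a, 'b) lpa)"
    "monoid.mult lpa_alg = rcoset_mult lpa_free (lpa_ideal G :: ('k, 'a, 'b) lpa)"
    "add lpa_alg = set_add (lpa_free :: ('k, _) module)"
    by (simp_all add: leavitt_path_algebra_def ring.defs FactRing_def Let_def)
  show "carrier lpa_alg = pr ` carrier (lpa_free :: ('k, _) module)"
    unfolding L by (auto simp: FactRing_def A_RCOSETS_def' pr_def)
  show "zero lpa_alg = (pr 0 :: ('k, 'a, 'b) lpa)"
    unfolding L by (simp add: pr_eq)
  have mem: "a \<in> carrier lpa_free" "a - x \<in> ?N" if "x \<in> carrier lpa_free" "a \<in> pr x" for a x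
    using that by (auto simp: pr_eq lpa_ideal_eq intro: carrier_add)
  have self: "x \<in> pr x" for x :: "('a, 'b) lpa_gen word \<Rightarrow>\<^sub>0 'k"
    by (auto simp: pr_eq lpa_ideal_eq intro!: exI[of _ 0])
  show "pr x \<otimes>\<^bsub>lpa_alg\<^esub> pr y = pr (x * y)" if x: "x \<in> carrier lpa_free" and y: "y \<in> carrier lpa_free"
  proof -
    have "pr (a * b) = pr (x * y)" if "a \<in> pr x" "b \<in> pr y" for a b
      using mem[OF x that(1)] mem[OF y that(2)] x y N.cong_mult[of a x b y]
      by (subst pr_eq_iff) (auto simp: N.cong_def intro: carrier_mult)
    then have "(\<Union>a\<in>pr x. \<Union>b\<in>pr y. pr (a * b)) = pr (x * y)"
      using self by blast
    then show ?thesis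
      by (simp add: L rcoset_mult_def flip: pr_def)
  qed
  show "pr x \<oplus>\<^bsub>lpa_alg\<^esub> pr y = pr (x + y)" if x: "x \<in> carrier lpa_free" and y: "y \<in> carrier lpa_free"
  proof -
    have "pr x \<oplus>\<^bsub>lpa_alg\<^esub> pr y = {a + b |a b. a \<in> pr x \<and> b \<in> pr y}"
      by (auto simp: L set_add_def set_mult_def)
    also have "\<dots> = pr (x + y)"
    proof
      show "{a + b |a b. a \<in> pr x \<and> b \<in> pr y} \<subseteq> pr (x + y)"
      proof
        fix z assume "z \<in> {a + b |a b. a \<in> pr x \<and> b \<in> pr y}"
        then obtain n m where "n \<in> lpa_ideal G" "m \<in> lpa_ideal G" "z = (n + m) + (x + y)"
          by (auto simp: pr_eq algebra_simps)
        then show "z \<in> pr (x + y)"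
          by (auto simp: pr_eq lpa_ideal_eq intro!: exI[of _ "n + m"] carrier_add N.add_mem)
      qed
      show "pr (x + y) \<subseteq> {a + b |a b. a \<in> pr x \<and> b \<in> pr y}"
      proof
        fix z assume "z \<in> pr (x + y)"
        then obtain n where n: "n \<in> lpa_ideal G" "z = (n + x) + y"
          by (auto simp: pr_eq algebra_simps)
        then have "n + x \<in> pr x"
          by (auto simp: pr_eq)
        then show "z \<in> {a + b |a b. a \<in> pr x \<and> b \<in> pr y}"
          using n(2) self[of y] by blast
      qed
    qed
    finally show ?thesis .
  qed
qed

lemma lpa_group: "group (add_monoid (lpa_alg :: ('k::field, _) module))"
proof (rule groupI)
  fix X assume "X \<in> carrier (add_monoid (lpa_alg :: ('k, _) module))"
  then obtain x where x: "X = pr x" "x \<in> carrier lpa_free"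
    by (auto simp: lpa_carrier)
  then have "pr (- x) \<oplus>\<^bsub>lpa_alg\<^esub> X = pr 0"
    using lpa_add[of "- x" x] carrier_uminus[OF x(2)] by simp
  then show "\<exists>Y\<in>carrier (add_monoid (lpa_alg :: ('k, _) module)).
      Y \<otimes>\<^bsub>add_monoid lpa_alg\<^esub> X = \<one>\<^bsub>add_monoid lpa_alg\<^esub>"
    using x carrier_uminus[OF x(2)] by (intro bexI[of _ "pr (- x)"]) (simp_all add: lpa_carrier lpa_zero)
qed (auto simp: lpa_carrier lpa_add lpa_zero add.assoc carrier_add)

lemma lpa_pre_rng: "pre_rng (lpa_alg :: ('k::field, _) module)"
proof -
  have "X \<otimes>\<^bsub>lpa_alg\<^esub> Y \<in> carrier (lpa_alg :: ('k, _) module)"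
    if "X \<in> carrier lpa_alg" "Y \<in> carrier lpa_alg" for X Y
    using that by (auto simp: lpa_carrier lpa_mult carrier_mult)
  then show ?thesis
    using lpa_group unfolding pre_rng_def by blast
qed

definition proj :: "(('a, 'b) lpa_gen word \<Rightarrow>\<^sub>0 'k::field) set \<Rightarrow> ('k, 'a, 'b) lpa set" where
  "proj J = pr ` (J \<inter> carrier lpa_free)"

text \<open>The preimage in the ambient algebra, tested after removing foreign letters; the carrier
  condition excludes constant terms.\<close>

definition lift :: "('k::field, 'a, 'b) lpa set \<Rightarrow> (('a, 'b) lpa_gen word \<Rightarrow>\<^sub>0 'k) set" where
  "lift I = {x. res x \<in> carrier lpa_free \<and> pr (res x) \<in> I}"

lemma pr_mem_proj:
  assumes J: "lpa_good G J" and x: "x \<in> carrier lpa_free"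
  shows "pr x \<in> proj J \<longleftrightarrow> x \<in> J"
proof
  interpret J: lpa_cong G J
    by (rule lpa_good_locale[OF wf_digraph_axioms J])
  assume "pr x \<in> proj J"
  then obtain y where y: "y \<in> J" "y \<in> carrier lpa_free" "pr x = pr y"
    by (auto simp: proj_def)
  then have "x - y \<in> gideal G {}"
    using pr_eq_iff x by blast
  then have "x - y \<in> J"
    using gideal_least[OF J, of "{}"] by auto
  then show "x \<in> J"
    using J.add_mem[of "x - y" y] y by simp
qed (use x in \<open>auto simp: proj_def\<close>)

lemma proj_ideal:
  assumes J: "lpa_good G J"
  shows "two_sided_ideal (proj J) lpa_alg"
proof -
  interpret J: lpa_cong G J
    by (rule lpa_good_locale[OF wf_digraph_axioms J])
  show ?thesis
    unfolding two_sided_ideal_iff[OF lpa_group]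
  proof (intro conjI ballI)
    fix X assume "X \<in> proj J"
    then obtain x where x: "X = pr x" "x \<in> J" "x \<in> carrier lpa_free"
      by (auto simp: proj_def)
    show "\<exists>Y\<in>proj J. Y \<oplus>\<^bsub>lpa_alg\<^esub> X = \<zero>\<^bsub>lpa_alg\<^esub>"
      using x by (intro bexI[of _ "pr (- x)"])
        (auto simp: proj_def lpa_add lpa_zero carrier_uminus J.uminus_mem)
  qed (auto simp: proj_def lpa_carrier lpa_add lpa_mult lpa_zero
      intro!: imageI J.add_mem carrier_add carrier_mult intro: J.mult_mem_left J.mult_mem_right)
qed

lemma local_unit:
  assumes "x \<in> carrier lpa_free"
  shows "\<exists>w\<in>carrier lpa_free. x - w * x \<in> (gideal G {} :: (('a, 'b) lpa_gen word \<Rightarrow>\<^sub>0 'k::field) set) \<and> x - x * w \<in> gideal G {}"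
proof -
  let ?N = "gideal G {} :: (('a, 'b) lpa_gen word \<Rightarrow>\<^sub>0 'k) set"
  interpret N: lpa_cong G ?N
    by (rule lpa_good_locale[OF wf_digraph_axioms gideal_good])
  let ?u = "\<lambda>F. \<Sum>v\<in>F. vx v :: ('a, 'b) lpa_gen word \<Rightarrow>\<^sub>0 'k"
  \<comment> \<open>Every finite set of vertices beyond \<open>F0\<close> has to work: then the
    units of two summands are compatible, and the union of their sets serves the sum.\<close>
  define unit where "unit y F0 \<longleftrightarrow> finite F0 \<and> F0 \<subseteq> verts G \<and>
      (\<forall>F. finite F \<longrightarrow> F0 \<subseteq> F \<longrightarrow> F \<subseteq> verts G \<longrightarrow> N.cong (?u F * y) y \<and> N.cong (y * ?u F) y)" for y F0
  have unitD: "N.cong (?u F * y) y" "N.cong (y * ?u F) y" "finite F0" "F0 \<subseteq> verts G"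
    if "unit y F0" "finite F" "F0 \<subseteq> F" "F \<subseteq> verts G" for y F0 F
    using that by (auto simp: unit_def)
  have unitI: "unit y F0" if "finite F0" "F0 \<subseteq> verts G"
    "\<And>F. finite F \<Longrightarrow> F0 \<subseteq> F \<Longrightarrow> F \<subseteq> verts G \<Longrightarrow> N.cong (?u F * y) y \<and> N.cong (y * ?u F) y" for y F0
    using that by (simp add: unit_def)
  have unit_fin: "finite F0" "F0 \<subseteq> verts G" if "unit y F0" for y F0
    using that by (simp_all add: unit_def)
  have gen: "\<exists>F0. unit (gen g) F0"
    if g: "g \<in> lpa_gens G" for g
  proof -
    obtain a b where ab: "a \<in> verts G" "b \<in> verts G"
      and l: "\<And>v. v \<in> verts G \<Longrightarrow> N.cong (vx v * gen g) (if v = a then gen g else 0)"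
      and r: "\<And>v. v \<in> verts G \<Longrightarrow> N.cong (gen g * vx v) (if v = b then gen g else 0)"
    proof -
      from g consider v where "g = Vertex v" "v \<in> verts G" | e where "g = Edge e" "e \<in> arcs G"
        | e where "g = Ghost e" "e \<in> arcs G"
        by (auto simp: lpa_gens_def)
      then show thesis
      proof cases
        case 1
        have "N.cong (vx w * vx v) (if w = v then vx v else 0)" if "w \<in> verts G" for w
          using N.vx_vx[OF that 1(2)] by (cases "w = v") auto
        moreover have "N.cong (vx v * vx w) (if w = v then vx v else 0)" if "w \<in> verts G" for w
          using N.vx_vx[OF 1(2) that] by (cases "w = v") auto
        ultimately show thesis
          by (intro that[unfolded 1(1), of v v] 1(2))
      next
        case 2
        show thesis
          by (rule that[unfolded 2(1), OF _ _ N.vx_ed[OF _ 2(2)] N.ed_vx[OF _ 2(2)]])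
            (use 2(2) in auto)
      next
        case 3
        show thesis
          by (rule that[unfolded 3(1), OF _ _ N.vx_gh[OF _ 3(2)] N.gh_vx[OF _ 3(2)]])
            (use 3(2) in auto)
      qed
    qed
    have "N.cong (?u F * gen g) (gen g) \<and> N.cong (gen g * ?u F) (gen g)"
      if F: "finite F" "{a, b} \<subseteq> F" "F \<subseteq> verts G" for F
    proof -
      have "N.cong (\<Sum>v\<in>F. vx v * gen g) (\<Sum>v\<in>F. if v = a then gen g else 0)"
        "N.cong (\<Sum>v\<in>F. gen g * vx v) (\<Sum>v\<in>F. if v = b then gen g else 0)"
        using F by (intro N.cong_sum l r; auto)+
      then show ?thesis
        using F by (simp add: sum_distrib_left sum_distrib_right)
    qed
    then have "unit (gen g) {a, b}"
      using ab by (intro unitI) auto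
    then show ?thesis ..
  qed
  have "\<exists>F0. unit x F0"
    using assms
  proof (induction rule: carrier_induct)
    case (word c gs)
    obtain g hs where g: "gs = g # hs" "g \<in> lpa_gens G"
      using word by (cases gs) auto
    obtain h ks where h: "gs = ks @ [h]" "h \<in> lpa_gens G"
      using word by (cases gs rule: rev_cases) auto
    obtain F1 where F1: "unit (gen g) F1"
      using gen[OF g(2)] ..
    obtain F2 where F2: "unit (gen h) F2"
      using gen[OF h(2)] ..
    let ?x = "cst c * prod_list (map gen gs) :: ('a, 'b) lpa_gen word \<Rightarrow>\<^sub>0 'k"
    have "N.cong (?u F * ?x) ?x \<and> N.cong (?x * ?u F) ?x"
      if F: "finite F" "F1 \<union> F2 \<subseteq> F" "F \<subseteq> verts G" for F
    proof
      have "?u F * ?x = cst c * (?u F * gen g) * prod_list (map gen hs)"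
        by (simp add: g cst_left_commute mult.assoc)
      also have "N.cong \<dots> (cst c * gen g * prod_list (map gen hs))"
        using F by (intro N.cong_mult N.cong_refl unitD(1)[OF F1]) auto
      finally show "N.cong (?u F * ?x) ?x"
        by (simp add: g mult.assoc)
      have "?x * ?u F = cst c * prod_list (map gen ks) * (gen h * ?u F)"
        by (simp add: h mult.assoc)
      also have "N.cong \<dots> (cst c * prod_list (map gen ks) * gen h)"
        using F by (intro N.cong_mult N.cong_refl unitD(2)[OF F2]) auto
      finally show "N.cong (?x * ?u F) ?x"
        by (simp add: h mult.assoc)
    qed
    then have "unit ?x (F1 \<union> F2)"
      using unit_fin[OF F1] unit_fin[OF F2] by (intro unitI) auto
    then show ?case ..
  next
    case (add x y)
    obtain F1 F2 where F1: "unit x F1" and F2: "unit y F2"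
      using add.IH by blast
    have "N.cong (?u F * (x + y)) (x + y) \<and> N.cong ((x + y) * ?u F) (x + y)"
      if F: "finite F" "F1 \<union> F2 \<subseteq> F" "F \<subseteq> verts G" for F
      unfolding distrib_left distrib_right
      using F by (intro conjI N.cong_add unitD(1)[OF F1] unitD(2)[OF F1] unitD(1)[OF F2] unitD(2)[OF F2]) auto
    then have "unit (x + y) (F1 \<union> F2)"
      using unit_fin[OF F1] unit_fin[OF F2] by (intro unitI) auto
    then show ?case ..
  next
    have "unit 0 {}"
      by (rule unitI) auto
    then show "\<exists>F0. unit 0 F0" ..
  qed
  then obtain F where "unit x F" ..
  then have F: "F \<subseteq> verts G" "N.cong (?u F * x) x" "N.cong (x * ?u F) x"
    using unit_fin unitD[of x F F] by auto
  have "?u F \<in> carrier lpa_free"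
    using F(1) by (intro carrier_sum carrier_gen) (auto simp: lpa_gens_def)
  then show ?thesis
    using F(2,3)[THEN N.cong_sym] by (auto simp: N.cong_def)
qed

text \<open>The point is absorption of ambient factors with a constant term, scalars included. A
  local unit \<open>w\<close> of \<open>x\<close> turns \<open>y x\<close> into
  \<open>(y w) x\<close>, whose first factor comes from the Leavitt path algebra.\<close>

lemma lift_good:
  assumes I: "two_sided_ideal I (lpa_alg :: ('k::field, _) module)"
  shows "lpa_good G (lift I)"
proof -
  have I': "pr 0 \<in> I" "\<And>a b. a \<in> I \<Longrightarrow> b \<in> I \<Longrightarrow> a \<oplus>\<^bsub>lpa_alg\<^esub> b \<in> I"
    "\<And>a x. a \<in> I \<Longrightarrow> x \<in> carrier lpa_alg \<Longrightarrow> x \<otimes>\<^bsub>lpa_alg\<^esub> a \<in> I"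
    "\<And>a x. a \<in> I \<Longrightarrow> x \<in> carrier lpa_alg \<Longrightarrow> a \<otimes>\<^bsub>lpa_alg\<^esub> x \<in> I"
    using I unfolding two_sided_ideal_iff[OF lpa_group] by (auto simp: lpa_zero)
  interpret N: lpa_cong G "gideal G {} :: (('a, 'b) lpa_gen word \<Rightarrow>\<^sub>0 'k) set"
    by (rule lpa_good_locale[OF wf_digraph_axioms gideal_good])
  have m: "pr (res y * x) \<in> I" "pr (x * res y) \<in> I"
    if x: "x \<in> carrier lpa_free" "pr x \<in> I" for x y :: "('a, 'b) lpa_gen word \<Rightarrow>\<^sub>0 'k"
  proof -
    obtain w :: "('a, 'b) lpa_gen word \<Rightarrow>\<^sub>0 'k" where w: "w \<in> carrier lpa_free"
      "N.cong x (w * x)" "N.cong x (x * w)"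
      using local_unit[OF x(1)] by (auto simp: N.cong_def)
    have c: "res y * x \<in> carrier lpa_free" "x * res y \<in> carrier lpa_free"
      "(res y * w) * x \<in> carrier lpa_free" "x * (w * res y) \<in> carrier lpa_free"
      using w(1) x(1) by (simp_all add: carrier_mult_restr carrier_restr_mult carrier_mult)
    have "pr (res y * x) = pr ((res y * w) * x)" "pr (x * res y) = pr (x * (w * res y))"
      using N.cong_mult[OF N.cong_refl w(2), of "res y"] N.cong_mult[OF w(3) N.cong_refl, of "res y"]
      unfolding pr_eq_iff[OF c(1,3)] pr_eq_iff[OF c(2,4)] by (simp_all add: N.cong_def mult.assoc)
    moreover have "pr ((res y * w) * x) = pr (res y * w) \<otimes>\<^bsub>lpa_alg\<^esub> pr x"
      "pr (x * (w * res y)) = pr x \<otimes>\<^bsub>lpa_alg\<^esub> pr (w * res y)"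
      using w x by (simp_all add: lpa_mult carrier_mult_restr carrier_restr_mult)
    ultimately show "pr (res y * x) \<in> I" "pr (x * res y) \<in> I"
      using I'(3,4)[OF x(2)] w(1) by (auto simp: lpa_carrier carrier_mult_restr carrier_restr_mult)
  qed
  have "ring_ideal (lift I)"
    unfolding ring_ideal_def lift_def
    using I' m by (auto simp: restr_add restr_mult carrier_add carrier_mult_restr carrier_restr_mult simp flip: lpa_add)
  moreover have "lpa_relations G \<subseteq> lift I"
  proof
    fix x :: "('a, 'b) lpa_gen word \<Rightarrow>\<^sub>0 'k" assume x: "x \<in> lpa_relations G"
    then have xc: "x \<in> carrier lpa_free"
      using relations_carrier[OF wf_digraph_axioms] by blast
    moreover have "pr x = pr 0"
      using xc x N.relations by (subst pr_eq_iff) auto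
    ultimately show "x \<in> lift I"
      using I'(1) by (simp add: lift_def restr_carrier)
  qed
  ultimately show ?thesis
    using I'(1) by (auto simp: lpa_good_def lift_def restr_gen)
qed

lemma mem_lift: "x \<in> carrier lpa_free \<Longrightarrow> x \<in> lift I \<longleftrightarrow> pr x \<in> I"
  by (simp add: lift_def restr_carrier)

lemma vertex_ideal_eq: "X \<subseteq> verts G \<Longrightarrow> vertex_ideal G X = proj (gideal G X :: (('a, 'b) lpa_gen word \<Rightarrow>\<^sub>0 'k::field) set)"
proof
  assume X: "X \<subseteq> verts G"
  have v: "vx v \<in> carrier (lpa_free :: ('k, _) module)" if "v \<in> X" for v
    using that X by (intro carrier_gen) (auto simp: lpa_gens_def)
  have "lpa_vertex G ` X \<subseteq> proj (gideal G X :: (('a, 'b) lpa_gen word \<Rightarrow>\<^sub>0 'k) set)"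
    using v vx_gideal by (fastforce simp: proj_def lpa_vertex_def pr_def)
  then show "vertex_ideal G X \<subseteq> proj (gideal G X :: (('a, 'b) lpa_gen word \<Rightarrow>\<^sub>0 'k) set)"
    unfolding vertex_ideal_def ideal_generated_def using proj_ideal[OF gideal_good] by blast
  show "proj (gideal G X :: (('a, 'b) lpa_gen word \<Rightarrow>\<^sub>0 'k) set) \<subseteq> vertex_ideal G X"
    unfolding vertex_ideal_def ideal_generated_def
  proof (intro Inter_greatest subsetI)
    fix I Y assume I: "I \<in> {I. two_sided_ideal I (lpa_alg :: ('k, _) module) \<and> lpa_vertex G ` X \<subseteq> I}"
      and Y: "Y \<in> proj (gideal G X :: (('a, 'b) lpa_gen word \<Rightarrow>\<^sub>0 'k) set)"
    have "vx ` X \<subseteq> lift I"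
      using I v by (auto simp: mem_lift pr_def lpa_vertex_def)
    then have "gideal G X \<subseteq> lift I"
      using I by (intro gideal_least lift_good) auto
    then show "Y \<in> I"
      using Y by (auto simp: proj_def mem_lift)
  qed
qed

lemma modeq_proj:
  assumes J: "two_sided_ideal J (lpa_alg :: ('k::field, _) module)"
    and x: "x \<in> carrier lpa_free" "y \<in> carrier lpa_free"
  shows "modeq lpa_alg J (pr x) (pr y) \<longleftrightarrow> x - y \<in> lift J"
proof
  have Jc: "J \<subseteq> carrier lpa_alg"
    using J unfolding two_sided_ideal_iff[OF lpa_group] by blast
  interpret J: lpa_cong G "lift J"
    by (rule lpa_good_locale[OF wf_digraph_axioms lift_good[OF J]])
  show "x - y \<in> lift J" if m: "modeq lpa_alg J (pr x) (pr y)"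
  proof -
    obtain j where j: "pr j \<in> J" "j \<in> carrier lpa_free" "pr x = pr y \<oplus>\<^bsub>lpa_alg\<^esub> pr j"
      using m Jc by (auto simp: modeq_def lpa_carrier)
    then have "x - (y + j) \<in> gideal G {}"
      using x by (simp add: lpa_add pr_eq_iff carrier_add)
    then have "x - (y + j) \<in> lift J"
      using gideal_least[OF lift_good[OF J], of "{}"] by auto
    moreover have "j \<in> lift J"
      using j by (simp add: mem_lift)
    ultimately show ?thesis
      using J.add_mem by fastforce
  qed
  show "modeq lpa_alg J (pr x) (pr y)" if "x - y \<in> lift J"
    using that x unfolding modeq_def
    by (intro bexI[of _ "pr (x - y)"]) (auto simp: lpa_add carrier_diff mem_lift)
qed

lemma pinf_in_pr:
  assumes J: "two_sided_ideal J (lpa_alg :: ('k::field, _) module)"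
    and c: "e \<in> carrier lpa_free" "r1 \<in> carrier lpa_free" "r2 \<in> carrier lpa_free" "s1 \<in> carrier lpa_free" "s2 \<in> carrier lpa_free"
  shows "pinf_in lpa_alg J (pr e) (pr r1) (pr r2) (pr s1) (pr s2) \<longleftrightarrow> ring_cong.pinf_witness (lift J) e r1 r2 s1 s2"
proof -
  interpret J: lpa_cong G "lift J"
    by (rule lpa_good_locale[OF wf_digraph_axioms lift_good[OF J]])
  show ?thesis
    unfolding pinf_in_def J.pinf_witness_def J.cong_def
    using c by (simp add: lpa_mult carrier_mult modeq_proj[OF J] mem_lift)
qed

theorem dominates_pinf_P_ppi: "dominates_pinf lpa_alg (vertex_ideal G (P_ppi G) :: ('k::field, 'a, 'b) lpa set)"
  unfolding dominates_pinf_def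
proof (intro allI impI)
  fix J and X :: "('k, 'a, 'b) lpa"
  assume J: "two_sided_ideal J (lpa_alg :: ('k, _) module)" and X: "X \<in> vertex_ideal G (P_ppi G)" "X \<notin> J"
  have "P_ppi G \<subseteq> verts G"
    by (auto simp: P_ppi_def)
  then obtain x where x: "X = pr x" "x \<in> gideal G (P_ppi G)" "x \<in> carrier lpa_free"
    using X(1) by (auto simp: vertex_ideal_eq proj_def)
  have "x \<notin> lift J"
    using X(2) x by (simp add: mem_lift)
  then obtain c d r1 r2 s1 s2 where w: "c \<in> carrier lpa_free" "d \<in> carrier lpa_free"
    "r1 \<in> carrier lpa_free" "r2 \<in> carrier lpa_free" "s1 \<in> carrier lpa_free" "s2 \<in> carrier lpa_free"
    "ring_cong.pinf_witness (lift J) (c * x * d) r1 r2 s1 s2"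
    using P_ppi_pinf[OF wf_digraph_axioms lift_good[OF J] x(2)] by blast
  have "pr c \<otimes>\<^bsub>lpa_alg\<^esub> X \<otimes>\<^bsub>lpa_alg\<^esub> pr d = pr (c * x * d)"
    using w x by (simp add: lpa_mult carrier_mult)
  then have *: "pinf_in lpa_alg J (pr c \<otimes>\<^bsub>lpa_alg\<^esub> X \<otimes>\<^bsub>lpa_alg\<^esub> pr d) (pr r1) (pr r2) (pr s1) (pr s2)"
    using w x by (simp add: pinf_in_pr[OF J] carrier_mult)
  have m: "pr y \<in> carrier lpa_alg" if "y \<in> carrier lpa_free" for y :: "('a, 'b) lpa_gen word \<Rightarrow>\<^sub>0 'k"
    using that by (simp add: lpa_carrier)
  show "\<exists>c\<in>carrier lpa_alg. \<exists>d\<in>carrier lpa_alg. \<exists>r1\<in>carrier lpa_alg. \<exists>r2\<in>carrier lpa_alg.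
      \<exists>s1\<in>carrier lpa_alg. \<exists>s2\<in>carrier lpa_alg. pinf_in lpa_alg J (c \<otimes>\<^bsub>lpa_alg\<^esub> X \<otimes>\<^bsub>lpa_alg\<^esub> d) r1 r2 s1 s2"
    by (intro bexI, rule *) (intro m w)+
qed

theorem dominates_pinf_subset:
  assumes I: "two_sided_ideal I (lpa_alg :: ('k::field, _) module)" "dominates_pinf lpa_alg I"
  shows "I \<subseteq> vertex_ideal G (P_ppi G)"
proof -
  have Ic: "I \<subseteq> carrier lpa_alg"
    using I(1) unfolding two_sided_ideal_iff[OF lpa_group] by blast
  interpret P: pinf_ideal G "lift I"
  proof (rule pinf_ideal.intro)
    show "wf_digraph G"
      by (rule wf_digraph_axioms)
    show "lpa_good G (lift I)"
      by (rule lift_good[OF I(1)])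
    fix J :: "(('a, 'b) lpa_gen word \<Rightarrow>\<^sub>0 'k) set" and x
    assume J: "lpa_good G J" and x: "x \<in> carrier lpa_free" "x \<in> lift I" "x \<notin> J"
    interpret J: lpa_cong G J
      by (rule lpa_good_locale[OF wf_digraph_axioms J])
    have Jp: "two_sided_ideal (proj J) lpa_alg"
      by (rule proj_ideal[OF J])
    have lp: "y \<in> lift (proj J) \<longleftrightarrow> y \<in> J" if "y \<in> carrier lpa_free" for y
      using that by (simp add: mem_lift pr_mem_proj[OF J])
    have prx: "pr x \<in> I" "pr x \<notin> proj J"
      using x by (simp_all add: mem_lift pr_mem_proj[OF J])
    obtain C D R1 R2 S1 S2 where C: "C \<in> carrier lpa_alg" "D \<in> carrier lpa_alg"
      "R1 \<in> carrier lpa_alg" "R2 \<in> carrier lpa_alg" "S1 \<in> carrier lpa_alg" "S2 \<in> carrier lpa_alg"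
      "pinf_in lpa_alg (proj J) (C \<otimes>\<^bsub>lpa_alg\<^esub> pr x \<otimes>\<^bsub>lpa_alg\<^esub> D) R1 R2 S1 S2"
      using I(2)[unfolded dominates_pinf_def, rule_format, OF Jp prx] by blast
    then obtain c d r1 r2 s1 s2 where w: "c \<in> carrier lpa_free" "d \<in> carrier lpa_free"
      "r1 \<in> carrier lpa_free" "r2 \<in> carrier lpa_free" "s1 \<in> carrier lpa_free" "s2 \<in> carrier lpa_free"
      "pinf_in lpa_alg (proj J) (pr c \<otimes>\<^bsub>lpa_alg\<^esub> pr x \<otimes>\<^bsub>lpa_alg\<^esub> pr d) (pr r1) (pr r2) (pr s1) (pr s2)"
      unfolding lpa_carrier by (elim imageE) simp
    then have "ring_cong.pinf_witness (lift (proj J)) (c * x * d) r1 r2 s1 s2"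
      using x by (simp add: lpa_mult carrier_mult pinf_in_pr[OF Jp])
    moreover interpret L: lpa_cong G "lift (proj J)"
      by (rule lpa_good_locale[OF wf_digraph_axioms lift_good[OF Jp]])
    \<comment> \<open>\<open>lift (proj J)\<close> and \<open>J\<close> agree on the carrier, where
      all elements in the equations lie.\<close>
    have "L.pinf_witness e r1 r2 s1 s2 = J.pinf_witness e r1 r2 s1 s2" if "e \<in> carrier lpa_free" for e
      unfolding L.pinf_witness_def J.pinf_witness_def L.cong_def J.cong_def
      using that w by (simp add: lp carrier_mult carrier_diff)
    ultimately have "J.pinf_witness (c * x * d) r1 r2 s1 s2"
      using w x by (simp add: carrier_mult)
    then show "\<exists>c d r1 r2 s1 s2. J.pinf_witness (c * x * d) r1 r2 s1 s2"
      by blast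
  qed
  have "P_ppi G \<subseteq> verts G"
    by (auto simp: P_ppi_def)
  moreover have "X \<in> proj (gideal G (P_ppi G))" if X: "X \<in> I" for X
  proof -
    obtain x where x: "X = pr x" "x \<in> carrier lpa_free"
      using X Ic by (auto simp: lpa_carrier)
    then have "x \<in> gideal G (P_ppi G)"
      using X by (intro P.subset_P_ppi_ideal) (simp_all add: mem_lift)
    then show ?thesis
      using x by (simp add: proj_def)
  qed
  ultimately show ?thesis
    using vertex_ideal_eq by blast
qed

end

text \<open>Read as a preimage under the inverse map, the image is an ideal. It inherits
  \<open>dominates_pinf\<close>, and \<open>vertex_ideal F (P_ppi F)\<close> is the largest ideal
  with this property.\<close>

lemma image_vertex_ideal_subset:
  fixes \<phi> :: "('k::field, 'v, 'e) lpa \<Rightarrow> ('k, 'w, 'f) lpa"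
  assumes E: "wf_digraph E" and F: "wf_digraph F"
    and phi: "\<phi> \<in> rng_iso (leavitt_path_algebra E) (leavitt_path_algebra F)"
  shows "\<phi> ` vertex_ideal E (P_ppi E) \<subseteq> vertex_ideal F (P_ppi F)"
    and "vertex_ideal E (P_ppi E) \<subseteq> carrier (leavitt_path_algebra E :: ('k, _) module)"
proof -
  let ?R = "leavitt_path_algebra E :: ('k, ('k, 'v, 'e) lpa) module"
  let ?S = "leavitt_path_algebra F :: ('k, ('k, 'w, 'f) lpa) module"
  let ?I = "vertex_ideal E (P_ppi E) :: ('k, 'v, 'e) lpa set"
  have R: "pre_rng ?R" and S: "pre_rng ?S"
    using wf_digraph.lpa_pre_rng E F by blast+
  have sub: "P_ppi E \<subseteq> verts E"
    by (auto simp: P_ppi_def)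
  have I: "two_sided_ideal ?I ?R"
    unfolding wf_digraph.vertex_ideal_eq[OF E sub] by (rule wf_digraph.proj_ideal[OF E gideal_good])
  then show Ic: "?I \<subseteq> carrier ?R"
    by (simp add: two_sided_ideal_def additive_subgroup.a_subset)
  let ?\<psi> = "inv_into (carrier ?R) \<phi>"
  have bij: "bij_betw \<phi> (carrier ?R) (carrier ?S)"
    by (rule iso_bij[OF R S phi])
  have "\<phi> ` ?I = {y \<in> carrier ?S. ?\<psi> y \<in> ?I}"
  proof (intro equalityI subsetI)
    fix y assume "y \<in> \<phi> ` ?I"
    then obtain x where x: "x \<in> ?I" "y = \<phi> x" ..
    then have "x \<in> carrier ?R"
      using Ic by blast
    then show "y \<in> {y \<in> carrier ?S. ?\<psi> y \<in> ?I}"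
      using x bij_betw_inv_into_left[OF bij] bij_betw_apply[OF bij] by simp
  next
    fix y assume "y \<in> {y \<in> carrier ?S. ?\<psi> y \<in> ?I}"
    then show "y \<in> \<phi> ` ?I"
      using bij_betw_inv_into_right[OF bij, of y] by (intro image_eqI[of _ _ "?\<psi> y"]) simp_all
  qed
  then have "two_sided_ideal (\<phi> ` ?I) ?S"
    using preimage_ideal[OF S R rng_iso_inverse[OF R S phi] I] by simp
  then show "\<phi> ` ?I \<subseteq> vertex_ideal F (P_ppi F)"
    using dominates_pinf_image[OF R S phi Ic wf_digraph.dominates_pinf_P_ppi[OF E]]
    by (rule wf_digraph.dominates_pinf_subset[OF F])
qed

theorem corollary4p14:
  fixes E :: "('v, 'e) pre_digraph"
    and F :: "('w, 'f) pre_digraph"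
    and \<phi> :: "('k::field, 'v, 'e) lpa \<Rightarrow> ('k, 'w, 'f) lpa"
  assumes "wf_digraph E" and "wf_digraph F"
    and "\<phi> \<in> rng_iso (leavitt_path_algebra E) (leavitt_path_algebra F)"
  shows "\<phi> ` vertex_ideal E (P_ppi E) = vertex_ideal F (P_ppi F)"
proof
  let ?R = "leavitt_path_algebra E :: ('k, ('k, 'v, 'e) lpa) module"
  let ?S = "leavitt_path_algebra F :: ('k, ('k, 'w, 'f) lpa) module"
  have R: "pre_rng ?R" and S: "pre_rng ?S"
    using wf_digraph.lpa_pre_rng assms(1,2) by blast+
  show "\<phi> ` vertex_ideal E (P_ppi E) \<subseteq> vertex_ideal F (P_ppi F)"
    by (rule image_vertex_ideal_subset[OF assms])
  let ?\<psi> = "inv_into (carrier ?R) \<phi>"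
  have "?\<psi> \<in> rng_iso ?S ?R"
    by (rule rng_iso_inverse[OF R S assms(3)])
  note inv = image_vertex_ideal_subset[OF assms(2,1) this]
  show "vertex_ideal F (P_ppi F) \<subseteq> \<phi> ` vertex_ideal E (P_ppi E)"
  proof
    fix y :: "('k, 'w, 'f) lpa" assume y: "y \<in> vertex_ideal F (P_ppi F)"
    then have "\<phi> (?\<psi> y) = y"
      using inv(2) by (intro bij_betw_inv_into_right[OF iso_bij[OF R S assms(3)]]) auto
    moreover have "?\<psi> y \<in> vertex_ideal E (P_ppi E)"
      using inv(1) y by blast
    ultimately show "y \<in> \<phi> ` vertex_ideal E (P_ppi E)"
      by (intro image_eqI[of _ _ "?\<psi> y"]) simp_all
  qed
qed

end
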